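(* Let $\mathbf{\Gamma}$ be a non self-dual Borel class of rank two, $(2^\omega,\mathbb{C})$ be $\mathbf{\Gamma}$-good, $X$ be an analytic space, and $R$ be a locally countable Borel relation on $X$ whose sections are in $\mathbf{\Gamma}$. Exactly one of the following holds: (a) the relation $R$ is a $\mathbf{\Gamma}$ subset of $X^2$; (b) one of the following holds: (1) there is a diagonally complex relation $\mathbb{R}$ on $2^\omega$ such that $(2^\omega,\mathbb{R})\sqsubseteq_c(X,R)$; (2) there is a relation $\mathbb{R}$ on $\mathbb{D}$ such that $(\mathbb{D},\mathbb{R})\sqsubseteq_c(X,R)$ and, writing $\mathbb{R}_{\varepsilon,\eta}\cap\Delta(2^\omega)=\Delta(E_{\varepsilon,\eta})$ for $\varepsilon,\eta\in\{0,1\}$, (i) $E_{0,1}=\mathbb{C}=S_0$, $E_{1,0}\in\{S_j\mid j\leq 3\}$, and $E_{\varepsilon,\varepsilon}\in\{S_j\mid 1\leq j\leq 3\}$ for each $\varepsilon\in\{0,1\}$; (ii) $\mathbb{R}_{\varepsilon,\eta}\subseteq\Delta(E_{\varepsilon,\eta})\cup\mathbb{P}_f^2$ for each $\varepsilon,\eta\in\{0,1\}$ (in particular, $\mathbb{R}_{0,1}$ is diagonally complex).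
   Context: A relation on $X$ is a subset of $X^2$. Its sections are $R_x=\{y\mid(x,y)\in R\}$ and $R^y=\{x\mid(x,y)\in R\}$; it is locally countable if all its sections are countable. $(X,A)\sqsubseteq_c(Y,B)$ means there is an injective continuous $f:X\to Y$ with $A=(f\times f)^{-1}(B)$. An analytic space is a separable metrizable space homeomorphic to an analytic subset of a Polish space. The non self-dual Borel classes of rank two are $\mathbf{\Sigma}^0_2$ and $\mathbf{\Pi}^0_2$. $\mathbb{P}_\infty=\{\alpha\in 2^\omega\mid\alpha(n)=1\text{ for infinitely many }n\}$, $\mathbb{P}_f=2^\omega\setminus\mathbb{P}_\infty$. For rank two, $(2^\omega,\mathbb{C})$ is $\mathbf{\Gamma}$-good exactly when $\mathbb{C}=\mathbb{P}_\infty$ (if $\mathbf{\Gamma}=\mathbf{\Sigma}^0_2$) or $\mathbb{C}=\mathbb{P}_f$ (if $\mathbf{\Gamma}=\mathbf{\Pi}^0_2$). $\Delta(E)=\{(x,x)\mid x\in E\}$. A relation $\mathcal{R}$ on $2^\omega$ is diagonally complex if $\mathcal{R}\cap\Delta(2^\omega)=\Delta(\mathbb{C})$ and $\mathcal{R}\subseteq\Delta(\mathbb{C})\cup\mathbb{P}_f^2$. $S_0=\mathbb{C}$, $S_1=\emptyset$, $S_2=2^\omega\setminus\mathbb{C}$, $S_3=2^\omega$. $\mathbb{D}=2\times 2^\omega$, and for a relation $\mathbb{R}$ on $\mathbb{D}$ and $\varepsilon,\eta\in\{0,1\}$, $\mathbb{R}_{\varepsilon,\eta}=\{(\alpha,\beta)\in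 2^\omega\times 2^\omega\mid((\varepsilon,\alpha),(\eta,\beta))\in\mathbb{R}\}$. *)

theory Defs
  imports "HOL-Analysis.Analysis"
begin

section \<open>Analytic spaces\<close>

definition polish_space :: "'a topology \<Rightarrow> bool" where
  "polish_space Y \<longleftrightarrow> separable_space Y \<and> completely_metrizable_space Y"

text \<open>
  In the next two definitions, existence of a Polish space is expressed with a Polish space whose
  points are of type \<^typ>\<open>nat \<Rightarrow> real\<close>, carrying an arbitrary topology. This is no restriction:
  every Polish space is homeomorphic to one of this form (lemma \<open>polish_space_universe\<close> below), so
  that Polish spaces over any type can be used as witnesses (lemmas \<open>analytic_set_inI\<close> and
  \<open>analytic_spaceI\<close>).
\<close>

definition analytic_set_in :: "'a topology \<Rightarrow> 'a set \<Rightarrow> bool" where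
  "analytic_set_in Y A \<longleftrightarrow>
     (\<exists>(Z :: (nat \<Rightarrow> real) topology) g.
        polish_space Z \<and> continuous_map Z Y g \<and> g ` topspace Z = A)"

definition analytic_space :: "'a topology \<Rightarrow> bool" where
  "analytic_space X \<longleftrightarrow>
     separable_space X \<and> metrizable_space X \<and>
     (\<exists>(Y :: (nat \<Rightarrow> real) topology) A.
        polish_space Y \<and> analytic_set_in Y A \<and> X homeomorphic_space subtopology Y A)"

lemma polish_space_universe:
  fixes Y :: "'a topology"
  assumes "polish_space Y"
  obtains Z :: "(nat \<Rightarrow> real) topology" where "polish_space Z" "Y homeomorphic_space Z"
proof -
  have cm: "completely_metrizable_space Y" and "separable_space Y"
    using assms by (auto simp: polish_space_def)
  then obtain C where C: "countable C" "C \<subseteq> topspace Y" "Y closure_of C = topspace Y"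
    by (auto simp: separable_space_def)
  obtain M d where M: "Metric_space M d" and Y: "Y = Metric_space.mtopology M d"
    using cm by (auto simp: completely_metrizable_space_def)
  interpret Metric_space M d by (fact M)
  have top: "topspace Y = M" by (simp add: Y)
  define f :: "'a \<Rightarrow> nat \<Rightarrow> real" where "f = (\<lambda>x n. d x (from_nat_into C n))"
  have inj: "inj_on f M"
  proof (rule inj_onI, rule ccontr)
    fix x y assume xy: "x \<in> M" "y \<in> M" "f x = f y" "x \<noteq> y"
    then have pos: "d x y > 0" by simp
    have "x \<in> mtopology closure_of C" using C xy top Y by simp
    then obtain c where c: "c \<in> C" "c \<in> mball x (d x y / 2)"
      using pos half_gt_zero[OF pos] unfolding metric_closure_of by blast
    obtain n where "from_nat_into C n = c"
      using C(1) c(1) from_nat_into_surj by metis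
    then have "d x c = d y c" using fun_cong[OF xy(3), of n] by (simp add: f_def)
    moreover have "c \<in> M" "d x c < d x y / 2" using c by auto
    ultimately show False using triangle[of x c y] xy commute by fastforce
  qed
  define g where "g = inv_into M f"
  define Z where "Z = pullback_topology (f ` M) g Y"
  have gf: "g (f x) = x" if "x \<in> M" for x using that inj by (simp add: g_def)
  have topZ: "topspace Z = f ` M"
    using gf by (auto simp: Z_def topspace_pullback_topology top)
  have "homeomorphic_maps Y Z f g"
    unfolding homeomorphic_maps_def
  proof (intro conjI ballI)
    show "continuous_map Y Z f"
      unfolding Z_def
    proof (rule continuous_map_pullback')
      show "continuous_map Y Y (g \<circ> f)"
        by (rule continuous_map_eq[OF continuous_map_id]) (use gf top in auto)
      show "topspace Y \<subseteq> f -` (f ` M)" using top by auto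
    qed
    show "continuous_map Z Y g"
      unfolding Z_def using continuous_map_pullback[OF continuous_map_id, of "f ` M" g Y] by simp
  qed (use gf topZ top in auto)
  then have hom: "Y homeomorphic_space Z"
    by (auto simp: homeomorphic_space_def)
  have "completely_metrizable_space Z"
    using cm hom homeomorphic_completely_metrizable_space by blast
  moreover have "separable_space Z"
    using \<open>separable_space Y\<close> hom homeomorphic_separable_space by blast
  ultimately show ?thesis
    using that hom by (simp add: polish_space_def)
qed

lemma analytic_set_inI:
  assumes "polish_space W" "continuous_map W Y g" "g ` topspace W = A"
  shows "analytic_set_in Y A"
proof -
  obtain Z :: "(nat \<Rightarrow> real) topology" where Z: "polish_space Z" "W homeomorphic_space Z"
    using polish_space_universe assms(1) by blast
  then obtain h k where "homeomorphic_maps Z W h k"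
    using homeomorphic_space_sym homeomorphic_space_def by metis
  then have h: "homeomorphic_map Z W h" by (rule homeomorphic_maps_map[THEN iffD1, THEN conjunct1])
  then have "continuous_map Z Y (g \<circ> h)"
    using assms(2) continuous_map_compose homeomorphic_imp_continuous_map by blast
  moreover have "(g \<circ> h) ` topspace Z = A"
    using assms(3) homeomorphic_imp_surjective_map[OF h] by (metis image_comp)
  ultimately show ?thesis
    using Z(1) unfolding analytic_set_in_def by blast
qed

lemma analytic_spaceI:
  assumes "separable_space X" "metrizable_space X"
    and "polish_space Y" "analytic_set_in Y A" "X homeomorphic_space subtopology Y A"
  shows "analytic_space X"
proof -
  obtain Z :: "(nat \<Rightarrow> real) topology" where Z: "polish_space Z" "Y homeomorphic_space Z"
    using polish_space_universe assms(3) by blast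
  then obtain h where h: "homeomorphic_map Y Z h"
    using homeomorphic_space by blast
  have sub: "A \<subseteq> topspace Y"
    using assms(4) continuous_map_image_subset_topspace by (fastforce simp: analytic_set_in_def)
  obtain W :: "(nat \<Rightarrow> real) topology" and g where
    W: "polish_space W" "continuous_map W Y g" "g ` topspace W = A"
    using assms(4) by (auto simp: analytic_set_in_def)
  have "analytic_set_in Z (h ` A)"
  proof (rule analytic_set_inI[OF W(1)])
    show "continuous_map W Z (h \<circ> g)"
      using W(2) h continuous_map_compose homeomorphic_imp_continuous_map by blast
    show "(h \<circ> g) ` topspace W = h ` A" using W(3) by auto
  qed
  moreover have "h ` (topspace Y \<inter> A) = topspace Z \<inter> h ` A"
    using sub homeomorphic_imp_surjective_map[OF h] by blast
  then have "homeomorphic_map (subtopology Y A) (subtopology Z (h ` A)) h"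
    using homeomorphic_map_subtopologies[OF h] by blast
  then have "X homeomorphic_space subtopology Z (h ` A)"
    using assms(5) homeomorphic_space homeomorphic_space_trans by blast
  ultimately show ?thesis
    using assms(1,2) Z(1) by (auto simp: analytic_space_def)
qed


section \<open>Borel sets and the non self-dual Borel classes of rank two\<close>

definition borel_set_in :: "'a topology \<Rightarrow> 'a set \<Rightarrow> bool" where
  "borel_set_in X A \<longleftrightarrow> A \<in> sigma_sets (topspace X) {U. openin X U}"

datatype rank_two_class = Sigma02 | Pi02

fun in_class :: "rank_two_class \<Rightarrow> 'a topology \<Rightarrow> 'a set \<Rightarrow> bool" where
  "in_class Sigma02 X A \<longleftrightarrow> fsigma_in X A"
| "in_class Pi02 X A \<longleftrightarrow> gdelta_in X A"


section \<open>Relations\<close>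

definition section_right :: "('a \<times> 'b) set \<Rightarrow> 'a \<Rightarrow> 'b set" where
  "section_right R x = {y. (x, y) \<in> R}"

definition section_left :: "('a \<times> 'b) set \<Rightarrow> 'b \<Rightarrow> 'a set" where
  "section_left R y = {x. (x, y) \<in> R}"

definition locally_countable :: "'a topology \<Rightarrow> ('a \<times> 'a) set \<Rightarrow> bool" where
  "locally_countable X R \<longleftrightarrow>
     (\<forall>x \<in> topspace X. countable (section_right R x) \<and> countable (section_left R x))"

definition sections_in_class :: "rank_two_class \<Rightarrow> 'a topology \<Rightarrow> ('a \<times> 'a) set \<Rightarrow> bool" where
  "sections_in_class \<Gamma> X R \<longleftrightarrow>
     (\<forall>x \<in> topspace X. in_class \<Gamma> X (section_right R x) \<and> in_class \<Gamma> X (section_left R x))"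

definition reducible_c ::
  "'a topology \<Rightarrow> ('a \<times> 'a) set \<Rightarrow> 'b topology \<Rightarrow> ('b \<times> 'b) set \<Rightarrow> bool" where
  "reducible_c X A Y B \<longleftrightarrow>
     (\<exists>f. continuous_map X Y f \<and> inj_on f (topspace X) \<and>
          A = {(x, y) \<in> topspace X \<times> topspace X. (f x, f y) \<in> B})"


section \<open>The Cantor space\<close>

text \<open>
  The digits 0 and 1 are \<^const>\<open>False\<close> and \<^const>\<open>True\<close>. The instance topology on
  \<^typ>\<open>bool\<close> is discrete and that on \<^typ>\<open>nat \<Rightarrow> bool\<close> is the product topology.
\<close>

type_synonym cantor = "nat \<Rightarrow> bool"

definition P_inf :: "cantor set" where
  "P_inf = {\<alpha>. infinite {n. \<alpha> n}}"

definition P_fin :: "cantor set" where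
  "P_fin = - P_inf"

fun good :: "rank_two_class \<Rightarrow> cantor set \<Rightarrow> bool" where
  "good Sigma02 C \<longleftrightarrow> C = P_inf"
| "good Pi02 C \<longleftrightarrow> C = P_fin"

text \<open>The diagonal on a set \<open>E\<close> is \<^term>\<open>Id_on E\<close>.\<close>

definition diagonally_complex :: "cantor set \<Rightarrow> (cantor \<times> cantor) set \<Rightarrow> bool" where
  "diagonally_complex C R \<longleftrightarrow>
     R \<inter> Id_on UNIV = Id_on C \<and> R \<subseteq> Id_on C \<union> P_fin \<times> P_fin"

definition S_set :: "cantor set \<Rightarrow> nat \<Rightarrow> cantor set" where
  "S_set C j = [C, {}, - C, UNIV] ! j"

text \<open>
  The space \<open>2 \<times> 2\<^sup>\<omega>\<close> is the type \<^typ>\<open>bool \<times> cantor\<close> with its instance (product) topology.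
\<close>

definition component ::
  "((bool \<times> cantor) \<times> (bool \<times> cantor)) set \<Rightarrow> bool \<Rightarrow> bool \<Rightarrow> (cantor \<times> cantor) set" where
  "component R \<epsilon> \<eta> = {(\<alpha>, \<beta>). ((\<epsilon>, \<alpha>), (\<eta>, \<beta>)) \<in> R}"

end

theory Submission
  imports Defs
begin

text \<open>Write \<open>P\<^sub>\<infinity>\<close> and \<open>P\<^sub>f\<close> for the binary sequences with infinitely many, respectively finitely many,
digits 1.

Membership in the class excludes both alternatives, because the pullback of \<open>R\<close> along
\<open>\<alpha> \<mapsto> (f \<alpha>, f' \<alpha>)\<close> is the set \<open>C\<close>, and by the Baire category theorem \<open>P\<^sub>\<infinity>\<close> is not F-sigma
(\<open>good_not_in_class\<close>).

Conversely, let \<open>R\<close> fail to be in the class. Let \<open>A\<close> be \<open>R\<close> for the class of F-sigma sets and the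
complement of \<open>R\<close> for the class of G-delta sets, and let \<open>B\<close> be the complement of \<open>A\<close>. Then no
F-sigma set separates \<open>A\<close> from \<open>B\<close>, while the sections of \<open>A\<close> are F-sigma. As \<open>A\<close> is Borel in a square
of an analytic space, \<open>A = g[Z]\<close> for a Polish space \<open>Z\<close> and a continuous \<open>g\<close>. After removing from \<open>Z\<close> all
open sets whose image can be separated from \<open>B\<close> (\<open>exists_closed_nowhere_small_image\<close>), the image of
every nonempty open set accumulates at a point of \<open>B\<close>. The argument of Hurewicz then maps the Cantor
space into the square: a finite binary sequence followed by zeros goes to a point of \<open>B\<close>, each further
digit 1 moves to a small open subset of \<open>Z\<close> with image close to that point, and a sequence in
\<open>P\<^sub>\<infinity>\<close> goes to \<open>g z\<close> for the point \<open>z\<close> in which its open sets shrink (\<open>cantor_scheme.embedding\<close>).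

Two demands go beyond this. First, both coordinates of the map have to be injective. They can be made
so because the fibres of each coordinate of \<open>g\<close> are nowhere dense: a fibre with an interior point would
put an image of an open set inside one section of \<open>A\<close>, which is F-sigma.

Second, two different sequences may only be related by \<open>R\<close>, in any combination of the coordinates, if
both are in \<open>P\<^sub>f\<close>. It is not enough that the pullback of \<open>R\<close> to \<open>Z \<times> Z\<close> is meager, since the points of
\<open>B\<close> used in the construction are not generic in any sense. What works is the following use of local
countability, in place of the uniformization theorem of Lusin and Novikov: for a coordinate \<open>h\<close> of \<open>g\<close>,
the set of all \<open>(z, y)\<close> with \<open>(h z, y)\<close> in \<open>R\<close> or its converse is covered by countably many
thin sets, that is, sets such that no section \<open>{z. (z, y) \<in> closure F}\<close> has an interior point
(\<open>thin_covered_relation\<close>). Indeed, an analytic set that resists such a covering, together with all its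
nonempty open pieces, contains a perfect subset of a single section (\<open>thick_image.uncountable_section\<close>).
Thinness allows to choose every new open subset of \<open>Z\<close>, and a neighbourhood of every other point present
at that stage, so that their product misses the thin sets listed so far.

The two alternatives and the sets \<open>S\<^sub>j\<close> come from reductions made in advance. The sets \<open>A\<close> and \<open>B\<close> are
cut into finitely many pieces according to which pairs of coordinates of a point are in \<open>R\<close>; one piece of
\<open>A\<close> is still inseparable from one piece of \<open>B\<close>, and for these each \<open>E \<epsilon> \<eta>\<close> is determined on \<open>P\<^sub>\<infinity>\<close> and on
\<open>P\<^sub>f\<close> (\<open>not_in_class_embedding\<close>). If \<open>g\<close> takes its values in the diagonal, then both coordinates agree and give
the first alternative. Otherwise \<open>Z\<close> is replaced by an open set on which the coordinates stay in disjoint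
closed balls; this gives the second alternative, except when some \<open>E \<epsilon> \<epsilon>\<close> equals \<open>C\<close>, and then the
coordinate \<open>\<epsilon>\<close> alone gives the first one.\<close>

section \<open>Polish spaces\<close>

lemma separable_metrizable_imp_second_countable:
  assumes "separable_space X" "metrizable_space X"
  shows "second_countable X"
proof -
  obtain M d where M: "Metric_space M d" and X: "X = Metric_space.mtopology M d"
    using assms(2) by (auto simp: metrizable_space_def)
  interpret Metric_space M d by (fact M)
  obtain D where D: "countable D" "D \<subseteq> M" "mtopology closure_of D = M"
    using assms(1) by (auto simp: separable_space_def X)
  define \<B> where "\<B> = (\<lambda>(c, k). mball c (1 / Suc k)) ` (D \<times> (UNIV :: nat set))"
  have "\<exists>V\<in>\<B>. x \<in> V \<and> V \<subseteq> U" if U: "openin mtopology U" "x \<in> U" for U x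
  proof -
    obtain r where r: "r > 0" "mball x r \<subseteq> U"
      using U by (auto simp: openin_mtopology)
    have x: "x \<in> M" using U openin_mtopology by blast
    obtain k :: nat where k: "1 / Suc k < r / 2"
      using nat_approx_posE[of "r/2"] r(1) by auto
    have "x \<in> mtopology closure_of D" using D x by simp
    then have "\<forall>e>0. \<exists>c\<in>D. c \<in> mball x e"
      unfolding metric_closure_of by blast
    then obtain c where c: "c \<in> D" "c \<in> mball x (1 / Suc k)"
      by (metis of_nat_0_less_iff zero_less_Suc zero_less_divide_1_iff)
    have "mball c (1 / Suc k) \<subseteq> mball x r"
    proof
      fix y assume y: "y \<in> mball c (1 / Suc k)"
      have "d x y \<le> d x c + d c y" using c y by (intro triangle) auto
      also have "\<dots> < 1 / Suc k + 1 / Suc k" using c y by (intro add_strict_mono) auto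
      finally show "y \<in> mball x r" using k y x by auto
    qed
    moreover have "x \<in> mball c (1 / Suc k)" using c x commute by auto
    ultimately show ?thesis using c r unfolding \<B>_def by (intro bexI[of _ "mball c (1 / Suc k)"]) auto
  qed
  moreover have "countable \<B>" using D by (auto simp: \<B>_def)
  moreover have "\<forall>V\<in>\<B>. openin mtopology V" by (auto simp: \<B>_def)
  ultimately show ?thesis unfolding X second_countable_def by blast
qed

lemma polish_space_iff:
  "polish_space X \<longleftrightarrow> second_countable X \<and> completely_metrizable_space X"
  by (meson completely_metrizable_imp_metrizable_space polish_space_def
      second_countable_imp_separable_space separable_metrizable_imp_second_countable)

lemma polish_space_closedin:
  "polish_space X \<Longrightarrow> closedin X C \<Longrightarrow> polish_space (subtopology X C)"
  by (simp add: polish_space_iff second_countable_subtopology completely_metrizable_space_closedin)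

lemma polish_space_openin:
  "polish_space X \<Longrightarrow> openin X U \<Longrightarrow> polish_space (subtopology X U)"
  by (simp add: polish_space_iff second_countable_subtopology completely_metrizable_space_openin)

lemma separable_space_prod_topology:
  assumes "separable_space X" "separable_space Y"
  shows "separable_space (prod_topology X Y)"
proof -
  obtain C D where "countable C" "C \<subseteq> topspace X" "X closure_of C = topspace X"
    "countable D" "D \<subseteq> topspace Y" "Y closure_of D = topspace Y"
    using assms by (auto simp: separable_space_def)
  then show ?thesis
    unfolding separable_space_def
    by (intro exI[of _ "C \<times> D"]) (auto simp: closure_of_Times)
qed

text \<open>The sequences that take values in fixed countable dense sets and eventually agree with a fixed
point of the product form a countable dense set.\<close>

lemma separable_space_product_topology:
  assumes "\<And>n. separable_space (Z n)"
  shows "separable_space (product_topology Z (UNIV :: nat set))"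
proof (cases "topspace (product_topology Z (UNIV :: nat set)) = {}")
  case True
  then show ?thesis unfolding separable_space_def by (intro exI[of _ "{}"]) simp
next
  case False
  then obtain c where "c \<in> topspace (product_topology Z (UNIV :: nat set))" by blast
  then have c: "c n \<in> topspace (Z n)" for n by (simp add: PiE_iff)
  have "\<exists>D. countable D \<and> D \<subseteq> topspace (Z n) \<and> Z n closure_of D = topspace (Z n)" for n
    using assms[of n] by (simp add: separable_space_def)
  then obtain D where D: "countable (D n)" "D n \<subseteq> topspace (Z n)"
    "Z n closure_of D n = topspace (Z n)" for n
    by metis
  define E where "E N = {z. (\<forall>n<N. z n \<in> D n) \<and> (\<forall>n\<ge>N. z n = c n)}" for N :: nat
  have "countable (E N)" for N
  proof (rule countable_subset)
    show "E N \<subseteq> (\<lambda>z n. if n < N then z n else c n) ` (PiE {..<N} D)"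
    proof
      fix z assume z: "z \<in> E N"
      have "z = (\<lambda>n. if n < N then (restrict z {..<N}) n else c n)"
        using z by (auto simp: E_def)
      moreover have "restrict z {..<N} \<in> PiE {..<N} D" using z by (auto simp: E_def)
      ultimately show "z \<in> (\<lambda>z n. if n < N then z n else c n) ` (PiE {..<N} D)" by blast
    qed
    show "countable ((\<lambda>z n. if n < N then z n else c n) ` (PiE {..<N} D))"
      using D by (intro countable_image countable_PiE) auto
  qed
  then have "countable (\<Union>N. E N)" by blast
  moreover have sub: "(\<Union>N. E N) \<subseteq> topspace (product_topology Z UNIV)"
  proof -
    have "z n \<in> topspace (Z n)" if "z \<in> E N" for z N n
      using that D(2)[of n] c[of n] by (cases "n < N") (auto simp: E_def)
    then show ?thesis by (auto simp: PiE_iff)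
  qed
  moreover have "product_topology Z UNIV closure_of (\<Union>N. E N) = topspace (product_topology Z UNIV)"
  proof -
    have "\<exists>y\<in>\<Union>N. E N. y \<in> T" if T: "openin (product_topology Z UNIV) T" "z \<in> T" for T z
    proof -
      have "\<exists>U. finite {i \<in> UNIV. U i \<noteq> topspace (Z i)} \<and> (\<forall>i\<in>UNIV. openin (Z i) (U i)) \<and>
          z \<in> PiE UNIV U \<and> PiE UNIV U \<subseteq> T"
        using T unfolding openin_product_topology_alt by blast
      then obtain U where U: "finite {i. U i \<noteq> topspace (Z i)}" "\<And>i. openin (Z i) (U i)" "z \<in> PiE UNIV U"
        "PiE UNIV U \<subseteq> T"
        by auto
      obtain N where "\<forall>i\<in>{i. U i \<noteq> topspace (Z i)}. i < N"
        using U(1) finite_nat_set_iff_bounded by blast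
      then have N: "U i = topspace (Z i)" if "i \<ge> N" for i using that by fastforce
      have "\<exists>y\<in>D i. y \<in> U i" for i
      proof -
        have zU: "z i \<in> U i" using U(3) by (simp add: PiE_iff)
        then have "z i \<in> Z i closure_of D i" using U(2)[of i] D(3)[of i] openin_subset by blast
        then show ?thesis using U(2)[of i] zU unfolding in_closure_of by blast
      qed
      then obtain y where y: "\<And>i. y i \<in> D i \<and> y i \<in> U i" by metis
      define w where "w = (\<lambda>i. if i < N then y i else c i)"
      have "w \<in> PiE UNIV U" using y N c by (simp add: w_def PiE_iff)
      moreover have "w \<in> E N" using y by (auto simp: E_def w_def)
      ultimately show ?thesis using U(4) by blast
    qed
    then show ?thesis unfolding closure_of_def by blast
  qed
  ultimately show ?thesis unfolding separable_space_def by blast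
qed

lemma polish_space_prod_topology:
  "polish_space X \<Longrightarrow> polish_space Y \<Longrightarrow> polish_space (prod_topology X Y)"
  by (auto simp: polish_space_def separable_space_prod_topology completely_metrizable_space_prod_topology)

lemma polish_space_product_topology:
  "(\<And>n. polish_space (Z n)) \<Longrightarrow> polish_space (product_topology Z (UNIV :: nat set))"
  by (auto simp: polish_space_def separable_space_product_topology completely_metrizable_space_product_topology)

lemma polish_space_nat: "polish_space (discrete_topology (UNIV :: nat set))"
  by (simp add: polish_space_iff second_countable_discrete_topology completely_metrizable_space_discrete_topology)

section \<open>Analytic sets\<close>

lemma analytic_set_in_subset: "analytic_set_in T A \<Longrightarrow> A \<subseteq> topspace T"
  using continuous_map_image_subset_topspace by (fastforce simp: analytic_set_in_def)

lemma analytic_set_in_empty: "analytic_set_in T {}"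
proof (rule analytic_set_inI)
  show "polish_space (discrete_topology ({} :: nat set))"
    by (simp add: polish_space_iff second_countable_discrete_topology completely_metrizable_space_discrete_topology)
qed auto

lemma analytic_set_in_Times:
  assumes "analytic_set_in T A" "analytic_set_in T' A'"
  shows "analytic_set_in (prod_topology T T') (A \<times> A')"
proof -
  obtain Z Z' :: "(nat \<Rightarrow> real) topology" and g g' where
    Z: "polish_space Z" "continuous_map Z T g" "g ` topspace Z = A" and
    Z': "polish_space Z'" "continuous_map Z' T' g'" "g' ` topspace Z' = A'"
    using assms by (auto simp: analytic_set_in_def)
  show ?thesis
  proof (rule analytic_set_inI)
    show "polish_space (prod_topology Z Z')" using Z Z' polish_space_prod_topology by blast
    show "continuous_map (prod_topology Z Z') (prod_topology T T') (\<lambda>(x, y). (g x, g' y))"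
      using Z(2) Z'(2) continuous_map_prod_top by blast
    show "(\<lambda>(x, y). (g x, g' y)) ` topspace (prod_topology Z Z') = A \<times> A'"
      using Z(3) Z'(3) by auto
  qed
qed

lemma analytic_set_in_Int_open_or_closed:
  assumes "analytic_set_in T A" "openin T U \<or> closedin T U"
  shows "analytic_set_in T (A \<inter> U)"
proof -
  obtain Z :: "(nat \<Rightarrow> real) topology" and g where
    Z: "polish_space Z" "continuous_map Z T g" "g ` topspace Z = A"
    using assms by (auto simp: analytic_set_in_def)
  define D where "D = {z \<in> topspace Z. g z \<in> U}"
  have "openin Z D \<or> closedin Z D"
    using assms(2) Z(2) openin_continuous_map_preimage closedin_continuous_map_preimage
    unfolding D_def by blast
  then have "polish_space (subtopology Z D)"
    using Z(1) polish_space_openin polish_space_closedin by blast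
  then show ?thesis
  proof (rule analytic_set_inI)
    show "continuous_map (subtopology Z D) T g" using Z(2) continuous_map_from_subtopology by blast
    show "g ` topspace (subtopology Z D) = A \<inter> U" using Z(3) by (auto simp: D_def)
  qed
qed

text \<open>If \<open>A n\<close> is the image of \<open>Z n\<close> under \<open>g n\<close>, then the intersection is the image of the closed set of those points
of the product of all \<open>Z n\<close> at which all \<open>g n\<close> agree.\<close>

lemma analytic_set_in_Inter:
  fixes A :: "nat \<Rightarrow> 'a set"
  assumes "Hausdorff_space T" "\<And>n. analytic_set_in T (A n)"
  shows "analytic_set_in T (\<Inter>n. A n)"
proof -
  have "\<exists>(Z :: (nat \<Rightarrow> real) topology) g. polish_space Z \<and> continuous_map Z T g \<and> g ` topspace Z = A n" for n
    using assms(2) by (auto simp: analytic_set_in_def)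
  then obtain Z :: "nat \<Rightarrow> (nat \<Rightarrow> real) topology" and g where
    Z: "\<And>n. polish_space (Z n)" "\<And>n. continuous_map (Z n) T (g n)" "\<And>n. g n ` topspace (Z n) = A n"
    by metis
  define P where "P = product_topology Z UNIV"
  have proj: "continuous_map P T (\<lambda>z. g n (z n))" for n
    using continuous_map_compose[OF continuous_map_product_projection[of n UNIV Z] Z(2)[of n]]
    by (simp add: P_def o_def)
  define D where "D = (\<Inter>n. {z \<in> topspace P. g n (z n) = g 0 (z 0)})"
  have "closedin P D" unfolding D_def
    by (intro closedin_Inter) (auto intro!: closedin_continuous_maps_eq[OF assms(1)] proj)
  then have "polish_space (subtopology P D)"
    using Z(1) polish_space_product_topology polish_space_closedin unfolding P_def by blast
  then show ?thesis
  proof (rule analytic_set_inI)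
    show "continuous_map (subtopology P D) T (\<lambda>z. g 0 (z 0))"
      using proj continuous_map_from_subtopology by blast
    show "(\<lambda>z. g 0 (z 0)) ` topspace (subtopology P D) = (\<Inter>n. A n)"
    proof (intro equalityI subsetI)
      fix y assume "y \<in> (\<lambda>z. g 0 (z 0)) ` topspace (subtopology P D)"
      then obtain z where z: "z \<in> topspace P" "\<And>n. g n (z n) = y" by (auto simp: D_def)
      have "y \<in> A n" for n
        using z(1) z(2)[of n, symmetric] Z(3)[of n, symmetric] by (auto simp: P_def PiE_iff)
      then show "y \<in> (\<Inter>n. A n)" by blast
    next
      fix y assume "y \<in> (\<Inter>n. A n)"
      then have "\<exists>z. z \<in> topspace (Z n) \<and> g n z = y" for n using Z(3)[of n] by blast
      then obtain z where "\<And>n. z n \<in> topspace (Z n) \<and> g n (z n) = y" by metis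
      then show "y \<in> (\<lambda>z. g 0 (z 0)) ` topspace (subtopology P D)"
        by (intro image_eqI[of _ _ z]) (auto simp: P_def D_def PiE_iff)
    qed
  qed
qed

text \<open>Here a disjoint sum of the spaces \<open>Z n\<close> is replaced by the product of a discrete copy of the
natural numbers with all \<open>Z n\<close>, where the number selects the coordinate that is mapped.\<close>

lemma analytic_set_in_Union:
  fixes A :: "nat \<Rightarrow> 'a set"
  assumes "\<And>n. analytic_set_in T (A n)"
  shows "analytic_set_in T (\<Union>n. A n)"
proof (cases "(\<Union>n. A n) = {}")
  case True
  then show ?thesis using analytic_set_in_empty by simp
next
  case False
  then obtain m where m: "A m \<noteq> {}" by auto
  \<comment> \<open>The product below must not become empty, so empty sets of the family are replaced.\<close>
  define A' where "A' n = (if A n = {} then A m else A n)" for n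
  have eq: "(\<Union>n. A n) = (\<Union>n. A' n)" by (auto simp: A'_def split: if_splits)
  have A': "A' n \<noteq> {}" "analytic_set_in T (A' n)" for n using m assms by (auto simp: A'_def)
  have "\<exists>(Z :: (nat \<Rightarrow> real) topology) g. polish_space Z \<and> continuous_map Z T g \<and> g ` topspace Z = A' n" for n
    using A'(2) by (auto simp: analytic_set_in_def)
  then obtain Z :: "nat \<Rightarrow> (nat \<Rightarrow> real) topology" and g where
    Z: "\<And>n. polish_space (Z n)" "\<And>n. continuous_map (Z n) T (g n)" "\<And>n. g n ` topspace (Z n) = A' n"
    by metis
  define P where "P = product_topology Z UNIV"
  have proj: "continuous_map P T (\<lambda>z. g n (z n))" for n
    using continuous_map_compose[OF continuous_map_product_projection[of n UNIV Z] Z(2)[of n]]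
    by (simp add: P_def o_def)
  obtain c where c: "\<And>n. c n \<in> topspace (Z n)"
  proof -
    have "\<exists>c. c \<in> topspace (Z n)" for n using A'(1)[of n] Z(3)[of n] by blast
    then show thesis using that by metis
  qed
  let ?W = "prod_topology (discrete_topology (UNIV :: nat set)) P"
  show ?thesis unfolding eq
  proof (rule analytic_set_inI)
    show "polish_space ?W"
      using Z(1) polish_space_product_topology polish_space_prod_topology polish_space_nat
      unfolding P_def by blast
    show "continuous_map ?W T (\<lambda>(n, z). g n (z n))"
      unfolding continuous_map_def
    proof (intro conjI allI impI)
      show "(\<lambda>(n, z). g n (z n)) \<in> topspace ?W \<rightarrow> topspace T"
        using continuous_map_image_subset_topspace[OF proj] by fastforce
      fix U assume U: "openin T U"
      have "{x \<in> topspace ?W. (case x of (n, z) \<Rightarrow> g n (z n)) \<in> U}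
          = (\<Union>n. {n} \<times> {z \<in> topspace P. g n (z n) \<in> U})" by auto
      moreover have "openin ?W ({n} \<times> {z \<in> topspace P. g n (z n) \<in> U})" for n
        using openin_continuous_map_preimage[OF proj U] by (simp add: openin_prod_Times_iff)
      ultimately show "openin ?W {x \<in> topspace ?W. (case x of (n, z) \<Rightarrow> g n (z n)) \<in> U}"
        by (auto intro: openin_Union)
    qed
    show "(\<lambda>(n, z). g n (z n)) ` topspace ?W = (\<Union>n. A' n)"
    proof (intro equalityI subsetI)
      fix y assume "y \<in> (\<Union>n. A' n)"
      then obtain n z where "z \<in> topspace (Z n)" "y = g n z" using Z(3) by blast
      then show "y \<in> (\<lambda>(n, z). g n (z n)) ` topspace ?W"
        using c by (intro image_eqI[of _ _ "(n, c(n := z))"]) (auto simp: P_def)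
    next
      fix y assume "y \<in> (\<lambda>(n, z). g n (z n)) ` topspace ?W"
      then obtain n z where "z n \<in> topspace (Z n)" "y = g n (z n)" by (auto simp: P_def PiE_iff)
      then show "y \<in> (\<Union>n. A' n)" using Z(3) by blast
    qed
  qed
qed

text \<open>The sets that are analytic together with their complement form a \<open>\<sigma>\<close>-algebra that contains the
open sets.\<close>

lemma borel_set_in_imp_analytic:
  assumes T: "Hausdorff_space T" "analytic_set_in T (topspace T)" and A: "borel_set_in T A"
  shows "analytic_set_in T A"
proof -
  have "A \<in> sigma_sets (topspace T) {U. openin T U}" using A by (simp add: borel_set_in_def)
  then have "analytic_set_in T A \<and> analytic_set_in T (topspace T - A)"
  proof (induction rule: sigma_sets.induct)
    case (Basic U)
    then have U: "openin T U" "U \<subseteq> topspace T" using openin_subset by auto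
    show ?case
      using analytic_set_in_Int_open_or_closed[OF T(2), of U]
        analytic_set_in_Int_open_or_closed[OF T(2), of "topspace T - U"]
      by (simp add: Int_absorb1 Int_absorb2 Diff_subset closedin_diff U)
  next
    case Empty
    then show ?case using T analytic_set_in_empty by simp
  next
    case (Compl A)
    then have "topspace T - (topspace T - A) = A"
      using analytic_set_in_subset[of T A] by blast
    then show ?case using Compl by simp
  next
    case (Union A)
    have "topspace T - (\<Union>i. A i) = (\<Inter>i. topspace T - A i)" by auto
    then show ?case
      using Union analytic_set_in_Union[of T A] analytic_set_in_Inter[OF T(1), of "\<lambda>i. topspace T - A i"]
      by simp
  qed
  then show ?thesis ..
qed

lemma analytic_space_imp_analytic_topspace:
  assumes "analytic_space X"
  shows "analytic_set_in X (topspace X)"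
proof -
  obtain Y :: "(nat \<Rightarrow> real) topology" and A where
    Y: "analytic_set_in Y A" "X homeomorphic_space subtopology Y A"
    using assms by (auto simp: analytic_space_def)
  obtain Z :: "(nat \<Rightarrow> real) topology" and g where
    Z: "polish_space Z" "continuous_map Z Y g" "g ` topspace Z = A"
    using Y(1) by (auto simp: analytic_set_in_def)
  obtain h where h: "homeomorphic_map (subtopology Y A) X h"
    using Y(2) homeomorphic_space homeomorphic_space_sym by blast
  show ?thesis
  proof (rule analytic_set_inI[OF Z(1)])
    have "continuous_map Z (subtopology Y A) g"
      using Z by (auto simp: continuous_map_in_subtopology)
    then show "continuous_map Z X (h \<circ> g)"
      using h continuous_map_compose homeomorphic_imp_continuous_map by blast
    have "topspace (subtopology Y A) = A" using analytic_set_in_subset[OF Y(1)] by auto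
    then have "h ` A = topspace X" using homeomorphic_imp_surjective_map[OF h] by simp
    then show "(h \<circ> g) ` topspace Z = topspace X" using Z(3) by auto
  qed
qed

lemma borel_set_in_preimage:
  assumes "continuous_map X Y f" "borel_set_in Y A"
  shows "borel_set_in X {x \<in> topspace X. f x \<in> A}"
proof -
  let ?B = "sigma_sets (topspace X) {U. openin X U}"
  have "A \<in> sigma_sets (topspace Y) {U. openin Y U}" using assms(2) by (simp add: borel_set_in_def)
  then have "{x \<in> topspace X. f x \<in> A} \<in> ?B"
  proof (induction rule: sigma_sets.induct)
    case (Basic U)
    then show ?case using openin_continuous_map_preimage[OF assms(1)] by (auto intro: sigma_sets.Basic)
  next
    case Empty
    then show ?case by (simp add: sigma_sets.Empty)
  next
    case (Compl A)
    have "{x \<in> topspace X. f x \<in> topspace Y - A} = topspace X - {x \<in> topspace X. f x \<in> A}"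
      using continuous_map_image_subset_topspace[OF assms(1)] by auto
    then show ?case using sigma_sets.Compl[OF Compl.IH] by simp
  next
    case (Union A)
    have "{x \<in> topspace X. f x \<in> (\<Union>i. A i)} = (\<Union>i. {x \<in> topspace X. f x \<in> A i})" by auto
    then show ?case using sigma_sets.Union[OF Union.IH] by simp
  qed
  then show ?thesis by (simp add: borel_set_in_def)
qed

lemma borel_set_in_sigma_algebra: "sigma_algebra (topspace X) {A. borel_set_in X A}"
proof -
  have "{A. borel_set_in X A} = sigma_sets (topspace X) {U. openin X U}"
    by (auto simp: borel_set_in_def)
  moreover have "{U. openin X U} \<subseteq> Pow (topspace X)" using openin_subset by auto
  ultimately show ?thesis using sigma_algebra_sigma_sets by metis
qed

section \<open>Removing the open sets with small image\<close>

text \<open>A derivative that stops after one step. The basic open sets with small image are countably many, so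
their union has a small image, too. Any relatively open set with small image in the complement of this
union can be added to it, and hence was empty. The lemma is used for the \<open>\<sigma>\<close>-ideal of the sets that are
separable by an F-sigma set from a fixed set, and for the \<open>\<sigma>\<close>-ideal generated by the thin sets below.\<close>

lemma exists_closed_nowhere_small_image:
  fixes I :: "'b set \<Rightarrow> bool"
  assumes Z: "second_countable Z"
    and mono: "\<And>A B. I B \<Longrightarrow> A \<subseteq> B \<Longrightarrow> I A"
    and Un: "\<And>\<A>. countable \<A> \<Longrightarrow> (\<And>A. A \<in> \<A> \<Longrightarrow> I A) \<Longrightarrow> I (\<Union>\<A>)"
    and big: "\<not> I (f ` topspace Z)"
  shows "\<exists>C. closedin Z C \<and> C \<noteq> {} \<and> (\<forall>V. openin (subtopology Z C) V \<and> V \<noteq> {} \<longrightarrow> \<not> I (f ` V))"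
proof -
  obtain \<B> where base: "countable \<B>" "\<forall>V\<in>\<B>. openin Z V"
    "\<forall>U x. openin Z U \<and> x \<in> U \<longrightarrow> (\<exists>V\<in>\<B>. x \<in> V \<and> V \<subseteq> U)"
    using Z unfolding second_countable_def by (elim exE conjE) (rule that)
  note \<B> = base(1) bspec[OF base(2)] base(3)[rule_format, OF conjI]
  define \<S> where "\<S> = {V \<in> \<B>. I (f ` V)}"
  define C where "C = topspace Z - \<Union>\<S>"
  have small: "I (f ` \<Union>\<S>)"
  proof -
    have "f ` \<Union>\<S> = \<Union>((`) f ` \<S>)" by auto
    moreover have "countable ((`) f ` \<S>)" using \<B>(1) by (auto simp: \<S>_def)
    moreover have "I A" if "A \<in> (`) f ` \<S>" for A using that by (auto simp: \<S>_def)
    ultimately show ?thesis using Un by metis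
  qed
  show ?thesis
  proof (intro exI[of _ C] conjI allI impI; (elim conjE)?)
    show "closedin Z C" using \<B>(2) unfolding C_def by (intro closedin_diff) (auto simp: \<S>_def)
    show "C \<noteq> {}"
    proof
      assume "C = {}"
      then have "topspace Z \<subseteq> \<Union>\<S>" by (auto simp: C_def)
      then show False using mono[OF small image_mono] big by blast
    qed
    fix V assume V: "openin (subtopology Z C) V" "V \<noteq> {}"
    show "\<not> I (f ` V)"
    proof
      assume IV: "I (f ` V)"
      obtain W where W: "openin Z W" "V = W \<inter> C" using V(1) by (auto simp: openin_subtopology)
      obtain x where x: "x \<in> V" using V(2) by auto
      then obtain B where B: "B \<in> \<B>" "x \<in> B" "B \<subseteq> W" using \<B>(3) W by blast
      have "I (\<Union>{f ` V, f ` \<Union>\<S>})" by (rule Un) (use IV small in auto)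
      moreover have "B \<subseteq> V \<union> \<Union>\<S>"
        using B W openin_subset[OF W(1)] by (auto simp: C_def)
      then have "f ` B \<subseteq> \<Union>{f ` V, f ` \<Union>\<S>}" by auto
      ultimately have "I (f ` B)" by (rule mono)
      then have "B \<in> \<S>" using B by (simp add: \<S>_def)
      then show False using x B W by (auto simp: C_def)
    qed
  qed
qed

section \<open>Binary nodes and shrinking open sets\<close>

text \<open>The finite sequences of length \<open>m\<close> are coded by the infinite sequences that extend them by zeros.
So a node and its left child are the same sequence, as are the members of \<open>P\<^sub>f\<close> and the nodes, and
whatever is attached to a node when it appears is attached to a point of the Cantor space.\<close>

definition node :: "nat \<Rightarrow> cantor set" where
  "node m = {s. \<forall>i\<ge>m. \<not> s i}"

definition trunc :: "nat \<Rightarrow> cantor \<Rightarrow> cantor" where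
  "trunc m \<alpha> = (\<lambda>i. i < m \<and> \<alpha> i)"

lemma trunc_node: "trunc m \<alpha> \<in> node m"
  by (simp add: node_def trunc_def)

lemma trunc_of_node: "\<alpha> \<in> node n \<Longrightarrow> n \<le> m \<Longrightarrow> trunc m \<alpha> = \<alpha>"
proof (rule ext)
  fix i assume *: "\<alpha> \<in> node n" "n \<le> m"
  show "trunc m \<alpha> i = \<alpha> i"
  proof (cases "i < m")
    case False
    then have "n \<le> i" using *(2) by simp
    then show ?thesis using False *(1) by (simp add: node_def trunc_def)
  qed (simp add: trunc_def)
qed

lemma trunc_Suc: "trunc (Suc m) \<alpha> = (if \<alpha> m then (trunc m \<alpha>)(m := True) else trunc m \<alpha>)"
proof (rule ext)
  show "trunc (Suc m) \<alpha> i = (if \<alpha> m then (trunc m \<alpha>)(m := True) else trunc m \<alpha>) i" for i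
    by (cases "i = m") (simp_all add: trunc_def less_Suc_eq)
qed

lemma trunc_eq_iff: "trunc m \<alpha> = trunc m \<beta> \<longleftrightarrow> (\<forall>i<m. \<alpha> i = \<beta> i)"
  unfolding trunc_def fun_eq_iff by blast

lemma node_0: "node 0 = {\<lambda>_. False}"
  by (auto simp: node_def)

lemma node_SucE:
  assumes "t \<in> node (Suc m)"
  obtains "t \<in> node m" "\<not> t m" | s where "s \<in> node m" "t = s(m := True)"
proof (cases "t m")
  case True
  then show ?thesis using assms that(2)[of "t(m := False)"]
    by (simp add: node_def fun_eq_iff le_Suc_eq)
next
  case False
  then show ?thesis using assms that(1)
    by (simp add: node_def Suc_le_eq) (metis le_neq_implies_less)
qed

lemma node_upd: "s \<in> node m \<Longrightarrow> s(m := True) \<in> node (Suc m)" "s \<in> node m \<Longrightarrow> s \<in> node (Suc m)"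
  "s \<in> node m \<Longrightarrow> \<not> s m" 
  by (simp_all add: node_def)

lemma finite_node: "finite (node m)"
proof (induction m)
  case 0
  then show ?case by (simp add: node_0)
next
  case (Suc m)
  have "node (Suc m) \<subseteq> node m \<union> (\<lambda>s. s(m := True)) ` node m"
    by (auto elim: node_SucE)
  then show ?case using Suc finite_subset by blast
qed

lemma P_fin_iff: "\<alpha> \<in> P_fin \<longleftrightarrow> (\<exists>n. \<alpha> \<in> node n)"
proof -
  have "\<alpha> \<in> P_fin \<longleftrightarrow> (\<exists>n. \<forall>i\<in>{i. \<alpha> i}. i < n)"
    by (simp only: P_fin_def P_inf_def Compl_iff mem_Collect_eq not_not finite_nat_set_iff_bounded)
  also have "\<dots> \<longleftrightarrow> (\<exists>n. \<alpha> \<in> node n)"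
    by (intro arg_cong[where f = Ex] ext) (auto simp: node_def linorder_not_less[symmetric])
  finally show ?thesis .
qed

lemma P_inf_iff: "\<alpha> \<in> P_inf \<longleftrightarrow> (\<forall>n. \<exists>m\<ge>n. \<alpha> m)"
  unfolding P_inf_def by (simp add: infinite_nat_iff_unbounded_le)

lemma open_trunc_eq: "open {\<beta>. trunc m \<beta> = trunc m \<alpha>}"
proof -
  have "open ((\<lambda>\<beta> :: cantor. \<beta> i) -` {\<alpha> i})" for i
    by (rule open_vimage[OF open_discrete continuous_on_product_coordinates])
  then have "open (\<Inter>i<m. (\<lambda>\<beta> :: cantor. \<beta> i) -` {\<alpha> i})" by (intro open_INT) auto
  moreover have "(\<Inter>i<m. (\<lambda>\<beta> :: cantor. \<beta> i) -` {\<alpha> i}) = {\<beta>. trunc m \<beta> = trunc m \<alpha>}"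
    by (auto simp: trunc_eq_iff)
  ultimately show ?thesis by simp
qed

lemma (in Metric_space) shrink_small_open:
  assumes "openin mtopology V" "V \<noteq> {}" "V \<subseteq> W" "r > 0"
  obtains V' where "openin mtopology V'" "V' \<noteq> {}" "V' \<subseteq> V" "mtopology closure_of V' \<subseteq> W"
    "\<exists>a. V' \<subseteq> mcball a r"
proof -
  obtain z where z: "z \<in> V" using assms by auto
  then obtain q where q: "q > 0" "mball z q \<subseteq> V" using assms(1) by (auto simp: openin_mtopology)
  have zM: "z \<in> M" using openin_subset[OF assms(1)] z by auto
  define t where "t = min (q / 2) r"
  have t: "t > 0" "t < q" "t \<le> r" using q(1) assms(4) by (auto simp: t_def)
  have "mtopology closure_of (mball z t) \<subseteq> mcball z t"
    by (intro closure_of_minimal) auto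
  also have "\<dots> \<subseteq> mball z q" using t by auto
  finally have "mtopology closure_of (mball z t) \<subseteq> W" using q assms by blast
  moreover have "mball z t \<subseteq> mcball z r" using t by auto
  moreover have "mball z t \<subseteq> V" using t q by auto
  moreover have "mball z t \<noteq> {}" using zM t by auto
  ultimately show thesis using that by blast
qed

text \<open>In the schemes below, the sets along a branch of the Cantor space shrink only at the digits 1 of the
branch. Therefore small diameter and nested closures are required at infinitely many steps instead of all.\<close>

lemma (in Metric_space) nested_common_point:
  assumes "mcomplete" and ne: "\<And>n. W n \<noteq> {}" and sub: "\<And>n. W n \<subseteq> M" and dec: "decseq W"
    and small: "\<And>n. \<exists>m\<ge>n. mtopology closure_of W (Suc m) \<subseteq> W m \<and> (\<exists>a. W (Suc m) \<subseteq> mcball a ((1/2) ^ m))"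
  obtains l where "\<And>n. l \<in> W n"
proof -
  define C where "C n = mtopology closure_of (W n)" for n
  have WC: "W n \<subseteq> C n" for n
    unfolding C_def using closure_of_subset[of "W n" mtopology] sub by simp
  have "\<exists>l. l \<in> M \<and> \<Inter> (range C) = {l}"
  proof (rule mcomplete_nest_sing[THEN iffD1, OF assms(1), rule_format], intro conjI allI impI)
    show "closedin mtopology (C n)" for n by (simp add: C_def)
    show "C n \<noteq> {}" for n using WC[of n] ne[of n] by blast
    show "decseq C" unfolding decseq_Suc_iff C_def
      using closure_of_mono[OF decseq_SucD[OF dec]] by blast
    fix e :: real assume e: "e > 0"
    obtain k where k: "(1/2) ^ k < e" using real_arch_pow_inv[OF e, of "1/2"] by auto
    obtain m a where m: "m \<ge> k" "W (Suc m) \<subseteq> mcball a ((1/2) ^ m)" using small by blast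
    have "(1/2) ^ m \<le> e"
      using order_trans[OF power_decreasing[OF m(1), of "1/2"] less_imp_le[OF k]] by simp
    then have "mcball a ((1/2) ^ m) \<subseteq> mcball a e" by auto
    moreover have "C (Suc m) \<subseteq> mcball a ((1/2) ^ m)"
      unfolding C_def using m(2) by (intro closure_of_minimal) auto
    ultimately show "\<exists>n a. C n \<subseteq> mcball a e" by blast
  qed
  then obtain l where l: "\<And>n. l \<in> C n" by blast
  have "l \<in> W n" for n
  proof -
    obtain m where m: "m \<ge> n" "mtopology closure_of W (Suc m) \<subseteq> W m" using small by blast
    have "l \<in> W m" using l[of "Suc m"] m(2) by (auto simp: C_def)
    then show ?thesis using decseqD[OF dec m(1)] by blast
  qed
  then show thesis using that by blast
qed

definition nonempty_opens :: "'z topology \<Rightarrow> 'i set \<Rightarrow> ('i \<Rightarrow> 'z set) \<Rightarrow> bool" where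
  "nonempty_opens T I V \<longleftrightarrow> (\<forall>i\<in>I. openin T (V i) \<and> V i \<noteq> {})"

text \<open>Finitely many requirements on a family of open sets can be met one after the other, if
each survives shrinking and can be met by shrinking.\<close>

lemma finite_refinement:
  assumes "finite K" and "nonempty_opens T I V0"
    and anti: "\<And>P V V'. P \<in> K \<Longrightarrow> P V \<Longrightarrow> (\<And>i. i \<in> I \<Longrightarrow> V' i \<subseteq> V i) \<Longrightarrow> P V'"
    and dense: "\<And>P V. P \<in> K \<Longrightarrow> nonempty_opens T I V \<Longrightarrow> (\<And>i. i \<in> I \<Longrightarrow> V i \<subseteq> V0 i) \<Longrightarrow>
      \<exists>V'. nonempty_opens T I V' \<and> (\<forall>i\<in>I. V' i \<subseteq> V i) \<and> P V'"
  obtains V where "nonempty_opens T I V" "\<And>i. i \<in> I \<Longrightarrow> V i \<subseteq> V0 i" "\<And>P. P \<in> K \<Longrightarrow> P V"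
proof -
  have "\<exists>V. nonempty_opens T I V \<and> (\<forall>i\<in>I. V i \<subseteq> V0 i) \<and> (\<forall>P\<in>K'. P V)" if "K' \<subseteq> K" for K'
    using finite_subset[OF that assms(1)] that
  proof (induction K' rule: finite_induct)
    case empty
    then show ?case using assms(2) by auto
  next
    case (insert P K')
    then obtain V where V: "nonempty_opens T I V" "\<forall>i\<in>I. V i \<subseteq> V0 i" "\<forall>P\<in>K'. P V" by auto
    obtain V' where V': "nonempty_opens T I V'" "\<forall>i\<in>I. V' i \<subseteq> V i" "P V'"
      using dense[of P V] insert.prems V by auto
    have "P' V'" if "P' \<in> insert P K'" for P'
    proof (cases "P' = P")
      case False
      then have "P' \<in> K" "P' V" using that V(3) insert.prems by blast+
      then show ?thesis by (rule anti) (use V'(2) in blast)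
    qed (use V'(3) in simp)
    moreover have "\<forall>i\<in>I. V' i \<subseteq> V0 i" using V(2) V'(2) by blast
    ultimately show ?case using V'(1) by (intro exI[of _ V'] conjI ballI) simp_all
  qed
  from this[OF order_refl] obtain V where "nonempty_opens T I V" "\<forall>i\<in>I. V i \<subseteq> V0 i" "\<forall>P\<in>K. P V"
    by (elim exE conjE)
  then show thesis using that by blast
qed

lemma dense_single_coordinate:
  assumes "nonempty_opens T I V" "s \<in> I"
    and "\<And>U. openin T U \<Longrightarrow> U \<noteq> {} \<Longrightarrow> U \<subseteq> V s \<Longrightarrow> \<exists>U'. openin T U' \<and> U' \<noteq> {} \<and> U' \<subseteq> U \<and> Q U'"
  shows "\<exists>V'. nonempty_opens T I V' \<and> (\<forall>i\<in>I. V' i \<subseteq> V i) \<and> Q (V' s)"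
proof -
  obtain U' where "openin T U'" "U' \<noteq> {}" "U' \<subseteq> V s" "Q U'"
    using assms(1,2) assms(3)[of "V s"] unfolding nonempty_opens_def by blast
  then show ?thesis using assms(1)
    by (intro exI[of _ "V(s := U')"]) (auto simp: nonempty_opens_def)
qed

section \<open>Thin subsets of a product\<close>

text \<open>Equivalently, for every \<open>x\<close> the set of all \<open>z\<close> with \<open>(z, x)\<close> in the closure of \<open>F\<close> has empty interior.
A closed set can be meager in the product and fail this, at a meager set of points \<open>x\<close>; the points \<open>x\<close> that
matter below are not generic.\<close>

definition thin :: "'z topology \<Rightarrow> 'a topology \<Rightarrow> ('z \<times> 'a) set \<Rightarrow> bool" where
  "thin Z X F \<longleftrightarrow> (\<forall>V x. openin Z V \<and> V \<noteq> {} \<and> x \<in> topspace X \<longrightarrow>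
     (\<exists>V' N. openin Z V' \<and> V' \<noteq> {} \<and> V' \<subseteq> V \<and> openin X N \<and> x \<in> N \<and> (V' \<times> N) \<inter> F = {}))"

lemma thinD:
  assumes "thin Z X F" "openin Z V" "V \<noteq> {}" "x \<in> topspace X"
  obtains V' N where "openin Z V'" "V' \<noteq> {}" "V' \<subseteq> V" "openin X N" "x \<in> N" "(V' \<times> N) \<inter> F = {}"
proof -
  have "\<exists>V' N. openin Z V' \<and> V' \<noteq> {} \<and> V' \<subseteq> V \<and> openin X N \<and> x \<in> N \<and> (V' \<times> N) \<inter> F = {}"
    using assms by (simp add: thin_def)
  then show thesis using that by blast
qed

lemma thin_empty: "thin Z X {}"
  unfolding thin_def by (intro allI impI, rule exI, rule exI[of _ "topspace X"]) auto

lemma thin_Un: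
  assumes "thin Z X F" "thin Z X G"
  shows "thin Z X (F \<union> G)"
  unfolding thin_def
proof (intro allI impI)
  fix V x assume V: "openin Z V \<and> V \<noteq> {} \<and> x \<in> topspace X"
  obtain V1 N1 where 1: "openin Z V1" "V1 \<noteq> {}" "V1 \<subseteq> V" "openin X N1" "x \<in> N1" "(V1 \<times> N1) \<inter> F = {}"
    using thinD[OF assms(1), of V x] V by metis
  obtain V2 N2 where 2: "openin Z V2" "V2 \<noteq> {}" "V2 \<subseteq> V1" "openin X N2" "x \<in> N2" "(V2 \<times> N2) \<inter> G = {}"
    using thinD[OF assms(2) 1(1,2), of x] V by metis
  have "(V2 \<times> (N1 \<inter> N2)) \<inter> (F \<union> G) = {}" using 1(6) 2(3,6) by blast
  then show "\<exists>V' N. openin Z V' \<and> V' \<noteq> {} \<and> V' \<subseteq> V \<and> openin X N \<and> x \<in> N \<and> (V' \<times> N) \<inter> (F \<union> G) = {}"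
    using 1 2 by (intro exI[of _ V2] exI[of _ "N1 \<inter> N2"] conjI) auto
qed

definition thin_covered :: "'z topology \<Rightarrow> 'a topology \<Rightarrow> ('z \<times> 'a) set \<Rightarrow> bool" where
  "thin_covered Z X T \<longleftrightarrow> (\<exists>\<F>. countable \<F> \<and> (\<forall>F\<in>\<F>. thin Z X F) \<and> T \<subseteq> \<Union>\<F>)"

lemma thin_covered_subset: "thin_covered Z X T \<Longrightarrow> T' \<subseteq> T \<Longrightarrow> thin_covered Z X T'"
  unfolding thin_covered_def by (elim exE conjE, rule exI, intro conjI, assumption, assumption) (rule order_trans)

lemma thin_imp_thin_covered: "thin Z X T \<Longrightarrow> thin_covered Z X T"
  unfolding thin_covered_def by (intro exI[of _ "{T}"] conjI) simp_all

lemma thin_covered_Union: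
  assumes "countable \<A>" "\<And>A. A \<in> \<A> \<Longrightarrow> thin_covered Z X A"
  shows "thin_covered Z X (\<Union>\<A>)"
proof -
  have "\<forall>A\<in>\<A>. \<exists>\<F>. countable \<F> \<and> (\<forall>F\<in>\<F>. thin Z X F) \<and> A \<subseteq> \<Union>\<F>"
    using assms(2) by (simp add: thin_covered_def)
  then obtain \<F> where F: "\<forall>A\<in>\<A>. countable (\<F> A) \<and> (\<forall>F\<in>\<F> A. thin Z X F) \<and> A \<subseteq> \<Union>(\<F> A)"
    by metis
  show ?thesis unfolding thin_covered_def
  proof (intro exI conjI)
    show "countable (\<Union>A\<in>\<A>. \<F> A)" using assms(1) F by blast
    show "\<forall>F\<in>(\<Union>A\<in>\<A>. \<F> A). thin Z X F" using F by blast
    have "A \<subseteq> \<Union>(\<Union>A\<in>\<A>. \<F> A)" if "A \<in> \<A>" for A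
      using bspec[OF F that] that by blast
    then show "\<Union>\<A> \<subseteq> \<Union>(\<Union>A\<in>\<A>. \<F> A)" by (rule Union_least)
  qed
qed

text \<open>For an increasing sequence of thin sets it suffices to avoid infinitely many of them.\<close>

lemma thin_covered_incseq:
  assumes "thin_covered Z X T"
  obtains F where "incseq F" "\<And>n. thin Z X (F n)" "T \<subseteq> (\<Union>n. F n)"
proof -
  obtain \<F> where F: "countable \<F>" "\<forall>F\<in>\<F>. thin Z X F" "T \<subseteq> \<Union>\<F>"
    using assms unfolding thin_covered_def by blast
  define G where "G = from_nat_into (insert {} \<F>)"
  have rG: "range G = insert {} \<F>"
    unfolding G_def using F(1) by (intro range_from_nat_into) auto
  have G: "thin Z X (G n)" for n
  proof -
    have "G n \<in> insert {} \<F>" using rG by blast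
    then show ?thesis using F(2) thin_empty by auto
  qed
  define F' where "F' n = (\<Union>i<n. G i)" for n
  show thesis
  proof
    show "incseq F'" unfolding F'_def incseq_def by fastforce
    show "thin Z X (F' n)" for n
    proof (induction n)
      case (Suc n)
      have "F' (Suc n) = F' n \<union> G n" by (auto simp: F'_def less_Suc_eq)
      then show ?case using thin_Un[OF Suc G] by simp
    qed (simp add: F'_def thin_empty)
    show "T \<subseteq> (\<Union>n. F' n)"
    proof
      fix y assume "y \<in> T"
      then obtain A where A: "A \<in> \<F>" "y \<in> A" using F(3) by blast
      then have "A \<in> range G" using rG by simp
      then obtain n where "A = G n" by (rule imageE)
      then have "y \<in> F' (Suc n)" using A(2) by (auto simp: F'_def)
      then show "y \<in> (\<Union>n. F' n)" by (rule UN_I[OF UNIV_I])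
    qed
  qed
qed

lemma thin_nowhere_dense:
  assumes "\<And>V. openin Z V \<Longrightarrow> V \<noteq> {} \<Longrightarrow> \<exists>V'. openin Z V' \<and> V' \<noteq> {} \<and> V' \<subseteq> V \<and> V' \<inter> M = {}"
  shows "thin Z X (M \<times> UNIV)"
  unfolding thin_def
proof (intro allI impI)
  fix V x assume V: "openin Z V \<and> V \<noteq> {} \<and> x \<in> topspace X"
  then obtain V' where "openin Z V'" "V' \<noteq> {}" "V' \<subseteq> V" "V' \<inter> M = {}" using assms[of V] by blast
  then show "\<exists>V' N. openin Z V' \<and> V' \<noteq> {} \<and> V' \<subseteq> V \<and> openin X N \<and> x \<in> N \<and> (V' \<times> N) \<inter> (M \<times> UNIV) = {}"
    using V by (intro exI[of _ V'] exI[of _ "topspace X"] conjI) auto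
qed

section \<open>Relations with countable sections\<close>

lemma uncountable_cantor: "uncountable (UNIV :: cantor set)"
proof
  assume "countable (UNIV :: cantor set)"
  then obtain e :: "nat \<Rightarrow> cantor" where "range e = UNIV"
    using range_from_nat_into[OF UNIV_not_empty] by blast
  then have "(\<lambda>i. \<not> e i i) \<in> range e" by simp
  then obtain n where "e n = (\<lambda>i. \<not> e i i)" by (metis imageE)
  from fun_cong[OF this, of n] show False by simp
qed

text \<open>The situation that is to be refuted for a set with countable sections: \<open>(p0, p1)\<close> parametrizes a subset of
\<open>Z \<times> X\<close> by a complete space, and no nonempty open set of parameters has an image that is covered by countably many
thin sets. The assumption on the fibres says that a fixed second coordinate contributes
only a small part, so that second coordinates can be split.\<close>

locale thick_image =
  Q: Metric_space MQ dQ + Z: Metric_space MZ dZ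
  for MQ :: "'q set" and dQ and MZ :: "'z set" and dZ +
  fixes X :: "'a topology" and p0 :: "'q \<Rightarrow> 'z" and p1 :: "'q \<Rightarrow> 'a"
  assumes complete: "Q.mcomplete" and nonempty: "MQ \<noteq> {}" and Hausdorff: "Hausdorff_space X"
    and cont0: "continuous_map Q.mtopology Z.mtopology p0"
    and cont1: "continuous_map Q.mtopology X p1"
    and thick: "openin Q.mtopology V \<Longrightarrow> V \<noteq> {} \<Longrightarrow> \<not> thin_covered Z.mtopology X ((\<lambda>q. (p0 q, p1 q)) ` V)"
    and fibres: "thin_covered Z.mtopology X ((\<lambda>q. (p0 q, p1 q)) ` {q \<in> MQ. p1 q = x})"
begin

text \<open>The image of \<open>V\<close> accumulates at every point of \<open>U \<times> {x}\<close>. Since the image of a nonempty open set is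
not thin, each such set accumulates at some segment of this form. The segment, unlike a point of the image, leaves
the first coordinate free, which is what allows to move many parameters into one section.\<close>

definition accum :: "'q set \<Rightarrow> 'z set \<Rightarrow> 'a \<Rightarrow> bool" where
  "accum V U x \<longleftrightarrow> openin Q.mtopology V \<and> openin Z.mtopology U \<and> U \<noteq> {} \<and> x \<in> topspace X \<and>
     (\<forall>U' N. openin Z.mtopology U' \<and> U' \<noteq> {} \<and> U' \<subseteq> U \<and> openin X N \<and> x \<in> N \<longrightarrow>
        (\<exists>q\<in>V. p0 q \<in> U' \<and> p1 q \<in> N))"

lemma accumD:
  assumes "accum V U x" "openin Z.mtopology U'" "U' \<noteq> {}" "U' \<subseteq> U" "openin X N" "x \<in> N"
  shows "\<exists>q\<in>V. p0 q \<in> U' \<and> p1 q \<in> N"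
  using assms by (simp add: accum_def)

lemma accumI:
  assumes "openin Q.mtopology V" "openin Z.mtopology U" "U \<noteq> {}" "x \<in> topspace X"
    "\<And>U' N. openin Z.mtopology U' \<Longrightarrow> U' \<noteq> {} \<Longrightarrow> U' \<subseteq> U \<Longrightarrow> openin X N \<Longrightarrow> x \<in> N \<Longrightarrow>
      \<exists>q\<in>V. p0 q \<in> U' \<and> p1 q \<in> N"
  shows "accum V U x"
  using assms by (simp add: accum_def)

lemma accum_open: "accum V U x \<Longrightarrow> openin Q.mtopology V" "accum V U x \<Longrightarrow> openin Z.mtopology U"
  "accum V U x \<Longrightarrow> U \<noteq> {}" "accum V U x \<Longrightarrow> x \<in> topspace X"
  by (simp_all add: accum_def)

lemma accum_meets:
  assumes "accum V U x" "openin Z.mtopology U'" "U' \<noteq> {}" "U' \<subseteq> U"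
  shows "\<exists>q\<in>V. p0 q \<in> U'"
  using accumD[OF assms openin_topspace] accum_open(4)[OF assms(1)] by blast

lemma accum_nonempty: "accum V U x \<Longrightarrow> V \<noteq> {}"
  using accum_meets[of V U x U] accum_open(2,3)[of V U x] by blast

lemma exists_accum:
  assumes "openin Q.mtopology V" "V \<noteq> {}"
  shows "\<exists>U x. accum V U x"
proof -
  have "\<not> thin Z.mtopology X ((\<lambda>q. (p0 q, p1 q)) ` V)"
    using thick[OF assms] thin_imp_thin_covered by blast
  then have "\<exists>U x. (openin Z.mtopology U \<and> U \<noteq> {} \<and> x \<in> topspace X) \<and>
    \<not> (\<exists>U' N. openin Z.mtopology U' \<and> U' \<noteq> {} \<and> U' \<subseteq> U \<and> openin X N \<and> x \<in> N \<and>
      (U' \<times> N) \<inter> (\<lambda>q. (p0 q, p1 q)) ` V = {})"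
    by (simp only: thin_def not_all not_imp)
  then obtain U x where U: "openin Z.mtopology U" "U \<noteq> {}" "x \<in> topspace X"
    and none: "\<not> (\<exists>U' N. openin Z.mtopology U' \<and> U' \<noteq> {} \<and> U' \<subseteq> U \<and> openin X N \<and> x \<in> N \<and>
      (U' \<times> N) \<inter> (\<lambda>q. (p0 q, p1 q)) ` V = {})"
    by (elim exE conjE)
  have "\<exists>q\<in>V. p0 q \<in> U' \<and> p1 q \<in> N"
    if "openin Z.mtopology U'" "U' \<noteq> {}" "U' \<subseteq> U" "openin X N" "x \<in> N" for U' N
  proof -
    have "(U' \<times> N) \<inter> (\<lambda>q. (p0 q, p1 q)) ` V \<noteq> {}" using none that by blast
    then show ?thesis by blast
  qed
  then have "accum V U x" using accumI[OF assms(1) U] by simp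
  then show ?thesis by (intro exI)
qed

lemma accum_subset: "accum V U x \<Longrightarrow> openin Z.mtopology U' \<Longrightarrow> U' \<noteq> {} \<Longrightarrow> U' \<subseteq> U \<Longrightarrow> accum V U' x"
proof -
  assume *: "accum V U x" "openin Z.mtopology U'" "U' \<noteq> {}" "U' \<subseteq> U"
  show ?thesis
    by (rule accumI[OF accum_open(1)[OF *(1)] *(2,3) accum_open(4)[OF *(1)]])
      (rule accumD[OF *(1)], use *(4) in auto)
qed

lemma openin_p0_preimage: "openin Q.mtopology V \<Longrightarrow> openin Z.mtopology U \<Longrightarrow> openin Q.mtopology {q \<in> V. p0 q \<in> U}"
proof -
  assume *: "openin Q.mtopology V" "openin Z.mtopology U"
  have "{q \<in> V. p0 q \<in> U} = V \<inter> {q \<in> topspace Q.mtopology. p0 q \<in> U}"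
    using openin_subset[OF *(1)] by auto
  then show ?thesis using openin_Int[OF *(1) openin_continuous_map_preimage[OF cont0 *(2)]] by simp
qed

lemma openin_p1_preimage: "openin Q.mtopology V \<Longrightarrow> openin X N \<Longrightarrow> openin Q.mtopology {q \<in> V. p1 q \<in> N}"
proof -
  assume *: "openin Q.mtopology V" "openin X N"
  have "{q \<in> V. p1 q \<in> N} = V \<inter> {q \<in> topspace Q.mtopology. p1 q \<in> N}"
    using openin_subset[OF *(1)] by auto
  then show ?thesis using openin_Int[OF *(1) openin_continuous_map_preimage[OF cont1 *(2)]] by simp
qed

lemma accum_restrict:
  assumes "accum V U x"
  shows "accum {q \<in> V. p0 q \<in> U} U x"
    and "openin X N \<Longrightarrow> x \<in> N \<Longrightarrow> accum {q \<in> V. p1 q \<in> N} U x"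
proof -
  note o = accum_open[OF assms]
  show "accum {q \<in> V. p0 q \<in> U} U x"
  proof (rule accumI[OF openin_p0_preimage[OF o(1,2)] o(2-4)])
    fix U' N assume *: "openin Z.mtopology U'" "U' \<noteq> {}" "U' \<subseteq> U" "openin X N" "x \<in> N"
    then obtain q where "q \<in> V" "p0 q \<in> U'" "p1 q \<in> N" using accumD[OF assms *] by blast
    then show "\<exists>q\<in>{q \<in> V. p0 q \<in> U}. p0 q \<in> U' \<and> p1 q \<in> N" using *(3) by blast
  qed
  assume N: "openin X N" "x \<in> N"
  show "accum {q \<in> V. p1 q \<in> N} U x"
  proof (rule accumI[OF openin_p1_preimage[OF o(1) N(1)] o(2-4)])
    fix U' N' assume *: "openin Z.mtopology U'" "U' \<noteq> {}" "U' \<subseteq> U" "openin X N'" "x \<in> N'"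
    then obtain q where "q \<in> V" "p0 q \<in> U'" "p1 q \<in> N \<inter> N'"
      using accumD[OF assms *(1-3) openin_Int[OF N(1) *(4)]] N(2) by blast
    then show "\<exists>q\<in>{q \<in> V. p1 q \<in> N}. p0 q \<in> U' \<and> p1 q \<in> N'" by blast
  qed
qed

definition child :: "'q set \<Rightarrow> real \<Rightarrow> 'q set \<Rightarrow> bool" where
  "child V r V' \<longleftrightarrow> Q.mtopology closure_of V' \<subseteq> V \<and> (\<exists>a. V' \<subseteq> Q.mcball a r)"

lemma child_subset: "child V r V' \<Longrightarrow> V'' \<subseteq> V' \<Longrightarrow> child V r V''"
  using closure_of_mono[of V'' V' Q.mtopology] unfolding child_def by blast

lemma exists_child:
  assumes "openin Q.mtopology V" "V \<noteq> {}" "V \<subseteq> W" "r > 0"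
  shows "\<exists>V'. openin Q.mtopology V' \<and> V' \<noteq> {} \<and> V' \<subseteq> V \<and> child W r V'"
proof -
  obtain V' where "openin Q.mtopology V'" "V' \<noteq> {}" "V' \<subseteq> V" "Q.mtopology closure_of V' \<subseteq> W"
    "\<exists>a. V' \<subseteq> Q.mcball a r"
    by (rule Q.shrink_small_open[OF assms])
  then show ?thesis by (intro exI[of _ V']) (simp add: child_def)
qed

text \<open>First \<open>V\<close> is shrunk to a set that accumulates at \<open>Ub \<times> {x0}\<close>. The part of \<open>V\<close> above \<open>Ub\<close> is nonempty
and open, so its image is too large to have second coordinate \<open>x0\<close> only. A parameter with a different
second coordinate leads to another segment over a smaller open set, and both segments are
restricted to that set.\<close>

lemma split_accum:
  assumes "accum V U x" "r > 0"
  obtains U' V0 V1 x0 x1 where "U' \<subseteq> U" "accum V0 U' x0" "accum V1 U' x1" "child V r V0" "child V r V1"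
    "p1 ` V0 \<inter> p1 ` V1 = {}"
proof -
  note o = accum_open[OF assms(1)]
  have "openin Q.mtopology {q \<in> V. p0 q \<in> U}" "{q \<in> V. p0 q \<in> U} \<noteq> {}"
    by (rule openin_p0_preimage[OF o(1,2)], rule accum_nonempty[OF accum_restrict(1)[OF assms(1)]])
  then obtain A where A: "openin Q.mtopology A" "A \<noteq> {}" "A \<subseteq> {q \<in> V. p0 q \<in> U}" "child V r A"
    using exists_child[of "{q \<in> V. p0 q \<in> U}" V r] assms(2) by auto
  obtain Ua x0 where Ua: "accum A Ua x0" using exists_accum[OF A(1,2)] by blast
  obtain q where "q \<in> A" "p0 q \<in> Ua"
    using accum_meets[OF Ua accum_open(2,3)[OF Ua] order_refl] by blast
  then have ne: "Ua \<inter> U \<noteq> {}" using A(3) by blast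
  define Ub where "Ub = Ua \<inter> U"
  have Ub: "openin Z.mtopology Ub" "Ub \<noteq> {}" "Ub \<subseteq> U" "accum A Ub x0"
  proof -
    show *: "openin Z.mtopology Ub" unfolding Ub_def using accum_open(2)[OF Ua] o(2) by (rule openin_Int)
    show "Ub \<noteq> {}" "Ub \<subseteq> U" using ne by (auto simp: Ub_def)
    then show "accum A Ub x0" using accum_subset[OF Ua *] by (simp add: Ub_def)
  qed
  have "\<exists>q\<in>V. p0 q \<in> Ub \<and> p1 q \<noteq> x0"
  proof (rule ccontr)
    assume "\<not> ?thesis"
    then have "{q \<in> V. p0 q \<in> Ub} \<subseteq> {q \<in> MQ. p1 q = x0}" using openin_subset[OF o(1)] by auto
    then have "thin_covered Z.mtopology X ((\<lambda>q. (p0 q, p1 q)) ` {q \<in> V. p0 q \<in> Ub})"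
      by (rule thin_covered_subset[OF fibres image_mono])
    moreover have "{q \<in> V. p0 q \<in> Ub} \<noteq> {}"
      using accum_meets[OF assms(1) Ub(1-3)] by blast
    ultimately show False using thick[OF openin_p0_preimage[OF o(1) Ub(1)]] by blast
  qed
  then obtain q where q: "q \<in> V" "p0 q \<in> Ub" "p1 q \<noteq> x0" by blast
  have "q \<in> topspace Q.mtopology" using q(1) openin_subset[OF o(1)] by blast
  then have "p1 q \<in> topspace X" using continuous_map_image_subset_topspace[OF cont1] by blast
  then obtain N0 N1 where N: "openin X N0" "openin X N1" "x0 \<in> N0" "p1 q \<in> N1" "N0 \<inter> N1 = {}"
    using Hausdorff[unfolded Hausdorff_space_def disjnt_def, rule_format, of x0 "p1 q"] q(3)
      accum_open(4)[OF Ua] by auto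
  define B where "B = {q \<in> {q \<in> V. p0 q \<in> Ub}. p1 q \<in> N1}"
  have "openin Q.mtopology B" "B \<noteq> {}" "B \<subseteq> V"
    using q N openin_p1_preimage[OF openin_p0_preimage[OF o(1) Ub(1)] N(2)] by (auto simp: B_def)
  then obtain B' where B': "openin Q.mtopology B'" "B' \<noteq> {}" "B' \<subseteq> B" "child V r B'"
    using exists_child[of B V r] assms(2) by auto
  obtain Uc x1 where Uc: "accum B' Uc x1" using exists_accum[OF B'(1,2)] by blast
  obtain q' where "q' \<in> B'" "p0 q' \<in> Uc"
    using accum_meets[OF Uc accum_open(2,3)[OF Uc] order_refl] by blast
  then have ne: "Uc \<inter> Ub \<noteq> {}" using B'(3) by (auto simp: B_def)
  have U': "openin Z.mtopology (Uc \<inter> Ub)" using accum_open(2)[OF Uc] Ub(1) by blast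
  show thesis
  proof
    show "Uc \<inter> Ub \<subseteq> U" using Ub(3) by blast
    show "accum {q \<in> A. p1 q \<in> N0} (Uc \<inter> Ub) x0"
      by (rule accum_restrict(2)[OF accum_subset[OF Ub(4) U' ne]]) (use N in auto)
    show "accum B' (Uc \<inter> Ub) x1" by (rule accum_subset[OF Uc U' ne]) simp
    show "child V r {q \<in> A. p1 q \<in> N0}" by (rule child_subset[OF A(4)]) auto
    show "child V r B'" by (rule B')
    show "p1 ` {q \<in> A. p1 q \<in> N0} \<inter> p1 ` B' = {}" using N(5) B'(3) by (auto simp: B_def)
  qed
qed

lemma split_all:
  assumes "finite I" "\<forall>s\<in>I. accum (V s) U (x s)" "r > 0" "openin Z.mtopology U" "U \<noteq> {}"
  shows "\<exists>U' V0 V1 x0 x1. openin Z.mtopology U' \<and> U' \<noteq> {} \<and> U' \<subseteq> U \<and>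
    (\<forall>s\<in>I. accum (V0 s) U' (x0 s) \<and> accum (V1 s) U' (x1 s) \<and> child (V s) r (V0 s) \<and> child (V s) r (V1 s) \<and>
      p1 ` V0 s \<inter> p1 ` V1 s = {})"
  using assms(1,2)
proof (induction I rule: finite_induct)
  case empty
  then show ?case using assms(4,5) by auto
next
  case (insert i I)
  have "\<forall>s\<in>I. accum (V s) U (x s)" using insert.prems by simp
  from insert.IH[OF this] obtain U' V0 V1 x0 x1 where U': "openin Z.mtopology U'" "U' \<noteq> {}" "U' \<subseteq> U"
    and V: "\<forall>s\<in>I. accum (V0 s) U' (x0 s) \<and> accum (V1 s) U' (x1 s) \<and> child (V s) r (V0 s) \<and>
      child (V s) r (V1 s) \<and> p1 ` V0 s \<inter> p1 ` V1 s = {}"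
    by (elim exE conjE)
  have "accum (V i) U' (x i)" using insert.prems by (intro accum_subset[OF _ U']) simp
  from this assms(3) obtain U'' A0 A1 y0 y1 where
    A: "U'' \<subseteq> U'" "accum A0 U'' y0" "accum A1 U'' y1" "child (V i) r A0" "child (V i) r A1"
    "p1 ` A0 \<inter> p1 ` A1 = {}" by (rule split_accum)
  have U'': "openin Z.mtopology U''" "U'' \<noteq> {}" using accum_open[OF A(2)] by auto
  have "\<forall>s\<in>insert i I. accum ((V0(i := A0)) s) U'' ((x0(i := y0)) s) \<and>
      accum ((V1(i := A1)) s) U'' ((x1(i := y1)) s) \<and> child (V s) r ((V0(i := A0)) s) \<and>
      child (V s) r ((V1(i := A1)) s) \<and> p1 ` (V0(i := A0)) s \<inter> p1 ` (V1(i := A1)) s = {}"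
  proof
    fix s assume s: "s \<in> insert i I"
    show "accum ((V0(i := A0)) s) U'' ((x0(i := y0)) s) \<and>
      accum ((V1(i := A1)) s) U'' ((x1(i := y1)) s) \<and> child (V s) r ((V0(i := A0)) s) \<and>
      child (V s) r ((V1(i := A1)) s) \<and> p1 ` (V0(i := A0)) s \<inter> p1 ` (V1(i := A1)) s = {}"
    proof (cases "s = i")
      case True
      then show ?thesis using A by simp
    next
      case False
      then have "s \<in> I" using s by simp
      then show ?thesis using False V accum_subset[OF _ U'' A(1)] by simp
    qed
  qed
  moreover have "U'' \<subseteq> U" using A(1) U'(3) by blast
  ultimately show ?case using U'' by blast
qed

definition state :: "nat \<Rightarrow> 'z set \<times> (cantor \<Rightarrow> 'q set) \<Rightarrow> bool" where
  "state m \<sigma> \<longleftrightarrow> (\<forall>s\<in>node m. \<exists>x. accum (snd \<sigma> s) (fst \<sigma>) x)"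

definition splits :: "nat \<Rightarrow> (cantor \<Rightarrow> 'q set) \<Rightarrow> 'z set \<Rightarrow> (cantor \<Rightarrow> 'q set) \<Rightarrow> cantor \<Rightarrow> bool" where
  "splits m V U' V' s \<longleftrightarrow>
     (\<forall>t\<in>{s, s(m := True)}. child (V s) ((1/2) ^ m) (V' t) \<and> p0 ` V' t \<subseteq> U') \<and>
     p1 ` V' s \<inter> p1 ` V' (s(m := True)) = {}"

lemma extend:
  assumes st: "state m (U, V)"
  obtains U' V' where "state (Suc m) (U', V')" "\<exists>a. U' \<subseteq> Z.mcball a ((1/2) ^ m)"
    "\<And>s. s \<in> node m \<Longrightarrow> splits m V U' V' s"
proof -
  obtain x where x: "\<forall>s\<in>node m. accum (V s) U (x s)"
    using st unfolding state_def fst_conv snd_conv by metis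
  have "(\<lambda>_. False) \<in> node m" by (simp add: node_def)
  then have U: "openin Z.mtopology U" "U \<noteq> {}" using x accum_open by blast+
  have r: "(1/2 :: real) ^ m > 0" by simp
  obtain U1 V0 V1 x0 x1 where U1: "openin Z.mtopology U1" "U1 \<noteq> {}" "U1 \<subseteq> U"
    and V: "\<forall>s\<in>node m. accum (V0 s) U1 (x0 s) \<and> accum (V1 s) U1 (x1 s) \<and> child (V s) ((1/2) ^ m) (V0 s) \<and>
      child (V s) ((1/2) ^ m) (V1 s) \<and> p1 ` V0 s \<inter> p1 ` V1 s = {}"
    using split_all[OF finite_node x r U] by (elim exE conjE)
  obtain U' where U': "openin Z.mtopology U'" "U' \<noteq> {}" "U' \<subseteq> U1" "\<exists>a. U' \<subseteq> Z.mcball a ((1/2) ^ m)"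
    using Z.shrink_small_open[OF U1(1,2) order_refl r] by metis
  define V' where "V' t = {q \<in> (if t m then V1 (t(m := False)) else V0 t). p0 q \<in> U'}" for t
  have upd_cancel: "s(m := False) = s" if "s \<in> node m" for s
    using node_upd(3)[OF that] by (auto simp: fun_eq_iff)
  have V'0: "V' s = {q \<in> V0 s. p0 q \<in> U'}" "V' (s(m := True)) = {q \<in> V1 s. p0 q \<in> U'}"
    if "s \<in> node m" for s
    using node_upd(3)[OF that] by (simp_all add: V'_def upd_cancel[OF that])
  have d: "accum {q \<in> A. p0 q \<in> U'} U' y" if "accum A U1 y" for A y
    using accum_restrict(1)[OF accum_subset[OF that U'(1-3)]] .
  show thesis
  proof
    show "state (Suc m) (U', V')"
      unfolding state_def fst_conv snd_conv
    proof
      fix t assume "t \<in> node (Suc m)"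
      then show "\<exists>x. accum (V' t) U' x"
      proof (cases rule: node_SucE)
        case 1
        then show ?thesis using V'0 V d by metis
      next
        case (2 s)
        then show ?thesis using V'0(2)[OF 2(1)] V d by metis
      qed
    qed
    show "\<exists>a. U' \<subseteq> Z.mcball a ((1/2) ^ m)" by (rule U')
    fix s assume s: "s \<in> node m"
    have Vs: "child (V s) ((1/2) ^ m) (V0 s)" "child (V s) ((1/2) ^ m) (V1 s)" "p1 ` V0 s \<inter> p1 ` V1 s = {}"
      using V s by blast+
    have "child (V s) ((1/2) ^ m) (V' t) \<and> p0 ` V' t \<subseteq> U'" if "t \<in> {s, s(m := True)}" for t
    proof -
      have "V' t \<subseteq> V0 s \<or> V' t \<subseteq> V1 s" using that V'0[OF s] by auto
      moreover have "p0 ` V' t \<subseteq> U'" by (auto simp: V'_def)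
      ultimately show ?thesis using child_subset Vs by blast
    qed
    moreover have "p1 ` V' s \<inter> p1 ` V' (s(m := True)) = {}" using Vs(3) V'0[OF s] by blast
    ultimately show "splits m V U' V' s" by (simp add: splits_def)
  qed
qed

lemma scheme:
  obtains U V where "\<And>n. state n (U n, V n)" "\<And>n. \<exists>a. U (Suc n) \<subseteq> Z.mcball a ((1/2) ^ n)"
    "\<And>n s. s \<in> node n \<Longrightarrow> splits n (V n) (U (Suc n)) (V (Suc n)) s"
proof -
  let ?S = "\<lambda>n \<sigma> \<sigma>'. (\<exists>a. fst \<sigma>' \<subseteq> Z.mcball a ((1/2) ^ n)) \<and>
    (\<forall>s\<in>node n. splits n (snd \<sigma>) (fst \<sigma>') (snd \<sigma>') s)"
  have "\<exists>\<sigma>. \<forall>n. state n (\<sigma> n) \<and> ?S n (\<sigma> n) (\<sigma> (Suc n))"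
  proof (rule dependent_nat_choice)
    have "openin Q.mtopology MQ" using openin_topspace[of Q.mtopology] by simp
    then obtain U x where "accum MQ U x" using exists_accum nonempty by blast
    then have "state 0 (U, \<lambda>_. MQ)" by (auto simp: state_def)
    then show "\<exists>\<sigma>. state 0 \<sigma>" by blast
  next
    fix \<sigma> n assume "state n \<sigma>"
    then have st: "state n (fst \<sigma>, snd \<sigma>)" by simp
    obtain U' V' where "state (Suc n) (U', V')" "\<exists>a. U' \<subseteq> Z.mcball a ((1/2) ^ n)"
      "\<And>s. s \<in> node n \<Longrightarrow> splits n (snd \<sigma>) U' V' s"
      using extend[OF st] by blast
    then show "\<exists>\<sigma>'. state (Suc n) \<sigma>' \<and> ?S n \<sigma> \<sigma>'"
      by (intro exI[of _ "(U', V')"]) simp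
  qed
  then obtain \<sigma> where \<sigma>: "\<And>n. state n (\<sigma> n)" "\<And>n. ?S n (\<sigma> n) (\<sigma> (Suc n))" by blast
  show thesis
    by (rule that[of "\<lambda>n. fst (\<sigma> n)" "\<lambda>n. snd (\<sigma> n)"]) (use \<sigma> in auto)
qed

text \<open>A Cantor scheme of parameter sets, all of whose members at one level accumulate over the same open
subset of \<open>Z\<close>. These open sets shrink to one point \<open>z\<close>, so the limits of all branches lie in the section at \<open>z\<close>,
and their second coordinates are pairwise different.\<close>

lemma uncountable_section: "\<exists>z. uncountable (p1 ` {q \<in> MQ. p0 q = z})"
proof -
  obtain U V where st: "\<And>n. state n (U n, V n)" and Us: "\<And>n. \<exists>a. U (Suc n) \<subseteq> Z.mcball a ((1/2) ^ n)"
    and sp: "\<And>n s. s \<in> node n \<Longrightarrow> splits n (V n) (U (Suc n)) (V (Suc n)) s"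
    by (rule scheme, rule that) assumption+
  define v where "v n \<alpha> = V n (trunc n \<alpha>)" for n \<alpha>
  have v: "openin Q.mtopology (v n \<alpha>)" "v n \<alpha> \<noteq> {}" for n \<alpha>
    using st[of n] trunc_node[of n \<alpha>] accum_open(1) accum_nonempty
    unfolding state_def v_def fst_conv snd_conv by blast+
  have vM: "v n \<alpha> \<subseteq> MQ" for n \<alpha> using openin_subset[OF v(1)] by simp
  have vS: "child (v n \<alpha>) ((1/2) ^ n) (v (Suc n) \<alpha>)" "p0 ` v (Suc n) \<alpha> \<subseteq> U (Suc n)" for n \<alpha>
    using sp[OF trunc_node[of n \<alpha>]] unfolding splits_def v_def trunc_Suc by auto
  have dec: "decseq (\<lambda>n. v n \<alpha>)" for \<alpha>
    unfolding decseq_Suc_iff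
  proof
    fix n
    have "v (Suc n) \<alpha> \<subseteq> Q.mtopology closure_of v (Suc n) \<alpha>"
      using closure_of_subset[of "v (Suc n) \<alpha>" Q.mtopology] vM by simp
    then show "v (Suc n) \<alpha> \<subseteq> v n \<alpha>" using vS(1)[of n \<alpha>] unfolding child_def by blast
  qed
  have "\<exists>q. \<forall>n. q \<in> v n \<alpha>" for \<alpha>
  proof -
    obtain l where "\<And>n. l \<in> v n \<alpha>"
    proof (rule Q.nested_common_point[OF complete v(2) vM dec])
      show "\<exists>m\<ge>n. Q.mtopology closure_of v (Suc m) \<alpha> \<subseteq> v m \<alpha> \<and>
          (\<exists>a. v (Suc m) \<alpha> \<subseteq> Q.mcball a ((1/2) ^ m))" for n
        using vS(1)[of n \<alpha>] unfolding child_def by blast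
    qed blast
    then show ?thesis by blast
  qed
  then obtain q where q: "\<And>\<alpha> n. q \<alpha> \<in> v n \<alpha>" by metis
  have qM: "q \<alpha> \<in> MQ" for \<alpha> using q[of \<alpha> 0] vM by blast
  have zM: "p0 (q \<alpha>) \<in> MZ" for \<alpha>
    using continuous_map_image_subset_topspace[OF cont0] qM by auto
  have eq: "p0 (q \<alpha>) = p0 (q \<beta>)" for \<alpha> \<beta>
  proof (rule ccontr)
    assume "p0 (q \<alpha>) \<noteq> p0 (q \<beta>)"
    then have e: "dZ (p0 (q \<alpha>)) (p0 (q \<beta>)) / 2 > 0" using zM by simp
    obtain n where n: "(1/2) ^ n < dZ (p0 (q \<alpha>)) (p0 (q \<beta>)) / 2"
      using real_arch_pow_inv[OF e, of "1/2"] by auto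
    obtain a where a: "U (Suc n) \<subseteq> Z.mcball a ((1/2) ^ n)" using Us by blast
    have "p0 (q \<gamma>) \<in> Z.mcball a ((1/2) ^ n)" for \<gamma>
      using vS(2)[of n \<gamma>] q[of \<gamma> "Suc n"] a by blast
    then have *: "a \<in> MZ" "dZ a (p0 (q \<gamma>)) \<le> (1/2) ^ n" for \<gamma> by auto
    have "dZ (p0 (q \<alpha>)) (p0 (q \<beta>)) \<le> dZ (p0 (q \<alpha>)) a + dZ a (p0 (q \<beta>))"
      using zM *(1) by (intro Z.triangle)
    then show False using n *(2)[of \<alpha>] *(2)[of \<beta>] Z.commute[of "p0 (q \<alpha>)" a] by simp
  qed
  have ne: "p1 (q \<alpha>) \<noteq> p1 (q \<beta>)" if "\<alpha> n" "\<not> \<beta> n" "trunc n \<alpha> = trunc n \<beta>" for \<alpha> \<beta> n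
  proof -
    have "v (Suc n) \<alpha> = V (Suc n) ((trunc n \<alpha>)(n := True))" "v (Suc n) \<beta> = V (Suc n) (trunc n \<alpha>)"
      using that by (simp_all add: v_def trunc_Suc)
    then have "p1 ` v (Suc n) \<beta> \<inter> p1 ` v (Suc n) \<alpha> = {}"
      using sp[OF trunc_node[of n \<alpha>]] unfolding splits_def by simp
    then show ?thesis using q[of \<alpha> "Suc n"] q[of \<beta> "Suc n"] by (metis IntI empty_iff imageI)
  qed
  have inj: "inj (\<lambda>\<alpha>. p1 (q \<alpha>))"
  proof (rule injI, rule ccontr)
    fix \<alpha> \<beta> assume same: "p1 (q \<alpha>) = p1 (q \<beta>)" and "\<alpha> \<noteq> \<beta>"
    then have ex: "\<exists>n. \<alpha> n \<noteq> \<beta> n" by auto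
    define n where "n = (LEAST n. \<alpha> n \<noteq> \<beta> n)"
    have n: "\<alpha> n \<noteq> \<beta> n" unfolding n_def using ex by (rule LeastI_ex)
    have "trunc n \<alpha> = trunc n \<beta>"
      unfolding trunc_eq_iff n_def using not_less_Least by blast
    then show False using ne[of \<alpha> n \<beta>] ne[of \<beta> n \<alpha>] n same by (cases "\<alpha> n") auto
  qed
  define z where "z = p0 (q (\<lambda>_. False))"
  have "range (\<lambda>\<alpha>. p1 (q \<alpha>)) \<subseteq> p1 ` {q \<in> MQ. p0 q = z}"
    using qM eq by (auto simp: z_def)
  moreover have "uncountable (range (\<lambda>\<alpha>. p1 (q \<alpha>)))"
    using inj uncountable_cantor countable_image_inj_on by blast
  ultimately have "uncountable (p1 ` {q \<in> MQ. p0 q = z})" using countable_subset by blast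
  then show ?thesis by blast
qed

end

text \<open>If the image were not covered, restricting the parameters to a closed set whose open
subsets all have large image would give a \<open>thick_image\<close> and hence an uncountable section.\<close>

lemma thin_covered_countable_sections:
  assumes Q: "polish_space Q" and Z: "metrizable_space Z" and X: "Hausdorff_space X"
    and p0: "continuous_map Q Z p0" and p1: "continuous_map Q X p1"
    and ctble: "\<And>z. countable (p1 ` {q \<in> topspace Q. p0 q = z})"
    and fibres: "\<And>x. thin_covered Z X ((\<lambda>q. (p0 q, p1 q)) ` {q \<in> topspace Q. p1 q = x})"
  shows "thin_covered Z X ((\<lambda>q. (p0 q, p1 q)) ` topspace Q)"
proof (rule ccontr)
  assume not: "\<not> ?thesis"
  have sc: "second_countable Q" using Q by (simp add: polish_space_iff)
  have "\<exists>C. closedin Q C \<and> C \<noteq> {} \<and> (\<forall>V. openin (subtopology Q C) V \<and> V \<noteq> {} \<longrightarrow>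
      \<not> thin_covered Z X ((\<lambda>q. (p0 q, p1 q)) ` V))"
    by (rule exists_closed_nowhere_small_image[OF sc]) (fact thin_covered_subset thin_covered_Union not)+
  then obtain C where C: "closedin Q C" "C \<noteq> {}"
    "\<forall>V. openin (subtopology Q C) V \<and> V \<noteq> {} \<longrightarrow> \<not> thin_covered Z X ((\<lambda>q. (p0 q, p1 q)) ` V)"
    by (elim exE conjE)
  have "completely_metrizable_space (subtopology Q C)"
    using polish_space_closedin[OF Q C(1)] by (simp add: polish_space_iff)
  then obtain MQ dQ where MQ: "Metric_space MQ dQ" "Metric_space.mcomplete MQ dQ"
    "subtopology Q C = Metric_space.mtopology MQ dQ"
    unfolding completely_metrizable_space_def by blast
  obtain MZ dZ where MZ: "Metric_space MZ dZ" "Z = Metric_space.mtopology MZ dZ"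
    using Z unfolding metrizable_space_def by blast
  have MQC: "MQ = C"
    using arg_cong[OF MQ(3), of topspace] Metric_space.topspace_mtopology[OF MQ(1)] closedin_subset[OF C(1)]
    by (simp add: Int_absorb1)
  have sub: "C \<subseteq> topspace Q" by (rule closedin_subset[OF C(1)])
  interpret thick_image MQ dQ MZ dZ X p0 p1
  proof (intro thick_image.intro thick_image_axioms.intro MQ(1,2) MZ(1) X)
    show "MQ \<noteq> {}" using C(2) MQC by simp
    show "continuous_map (Metric_space.mtopology MQ dQ) (Metric_space.mtopology MZ dZ) p0"
      using continuous_map_from_subtopology[OF p0, of C] MQ(3) MZ(2) by simp
    show "continuous_map (Metric_space.mtopology MQ dQ) X p1"
      using continuous_map_from_subtopology[OF p1, of C] MQ(3) by simp
    show "\<not> thin_covered (Metric_space.mtopology MZ dZ) X ((\<lambda>q. (p0 q, p1 q)) ` V)"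
      if "openin (Metric_space.mtopology MQ dQ) V" "V \<noteq> {}" for V
      using C(3) that MQ(3) MZ(2) by simp
    have "(\<lambda>q. (p0 q, p1 q)) ` {q \<in> MQ. p1 q = x} \<subseteq> (\<lambda>q. (p0 q, p1 q)) ` {q \<in> topspace Q. p1 q = x}" for x
      using sub MQC by blast
    then show "thin_covered (Metric_space.mtopology MZ dZ) X ((\<lambda>q. (p0 q, p1 q)) ` {q \<in> MQ. p1 q = x})" for x
      using thin_covered_subset[OF fibres[of x], of "(\<lambda>q. (p0 q, p1 q)) ` {q \<in> MQ. p1 q = x}"] MZ(2)
      by simp
  qed
  obtain z where z: "uncountable (p1 ` {q \<in> MQ. p0 q = z})" using uncountable_section by blast
  have "p1 ` {q \<in> MQ. p0 q = z} \<subseteq> p1 ` {q \<in> topspace Q. p0 q = z}" using sub MQC by blast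
  then have "countable (p1 ` {q \<in> MQ. p0 q = z})" by (rule countable_subset) (rule ctble)
  then show False using z by simp
qed

text \<open>The fibres of \<open>h\<close> are closed and have empty interior. As \<open>S\<close> has countable sections in both directions, this
makes the contribution of a fixed \<open>y\<close> a countable union of thin sets.\<close>

lemma thin_covered_relation:
  assumes X: "metrizable_space X" and Z: "polish_space Z" and h: "continuous_map Z X h"
    and S: "analytic_set_in (prod_topology X X) S" "\<And>x. countable {y. (x, y) \<in> S}" "\<And>y. countable {x. (x, y) \<in> S}"
    and nonconst: "\<And>V x. openin Z V \<Longrightarrow> V \<noteq> {} \<Longrightarrow> \<exists>z\<in>V. h z \<noteq> x"
  shows "thin_covered Z X {(z, y). z \<in> topspace Z \<and> (h z, y) \<in> S}"
proof -
  have Haus: "Hausdorff_space X" using X by (rule metrizable_imp_Hausdorff_space)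
  have Zm: "metrizable_space Z"
    using Z completely_metrizable_imp_metrizable_space by (auto simp: polish_space_iff)
  obtain P :: "(nat \<Rightarrow> real) topology" and k where
    P: "polish_space P" "continuous_map P (prod_topology X X) k" "k ` topspace P = S"
    using S(1) by (auto simp: analytic_set_in_def)
  let ?ZP = "prod_topology Z P"
  define D where "D = {q \<in> topspace ?ZP. h (fst q) = fst (k (snd q))}"
  define Q where "Q = subtopology ?ZP D"
  have c: "continuous_map ?ZP X (\<lambda>q. h (fst q))" "continuous_map ?ZP X (\<lambda>q. fst (k (snd q)))"
    "continuous_map ?ZP X (\<lambda>q. snd (k (snd q)))"
  proof -
    show "continuous_map ?ZP X (\<lambda>q. h (fst q))"
      using continuous_map_compose[OF continuous_map_fst h, of P] by (simp add: o_def)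
    have kk: "continuous_map ?ZP (prod_topology X X) (\<lambda>q. k (snd q))"
      using continuous_map_compose[OF continuous_map_snd P(2), of Z] by (simp add: o_def)
    show "continuous_map ?ZP X (\<lambda>q. fst (k (snd q)))" "continuous_map ?ZP X (\<lambda>q. snd (k (snd q)))"
      using continuous_map_compose[OF kk continuous_map_fst] continuous_map_compose[OF kk continuous_map_snd]
      by (simp_all add: o_def)
  qed
  have "closedin ?ZP D" unfolding D_def by (rule closedin_continuous_maps_eq[OF Haus c(1,2)])
  then have Q: "polish_space Q"
    unfolding Q_def by (rule polish_space_closedin[OF polish_space_prod_topology[OF Z P(1)]])
  have topQ: "topspace Q = D" by (auto simp: Q_def D_def)
  have kS: "k (snd q) \<in> S" if "q \<in> D" for q using that P(3) by (auto simp: D_def)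
  have hk: "(h (fst q), snd (k (snd q))) \<in> S" if "q \<in> D" for q
    using kS[OF that] that by (simp add: D_def)
  have "thin_covered Z X ((\<lambda>q. (fst q, snd (k (snd q)))) ` topspace Q)"
  proof (rule thin_covered_countable_sections[OF Q Zm Haus])
    show "continuous_map Q Z fst"
      unfolding Q_def by (rule continuous_map_from_subtopology[OF continuous_map_fst])
    show "continuous_map Q X (\<lambda>q. snd (k (snd q)))"
      unfolding Q_def by (rule continuous_map_from_subtopology[OF c(3)])
    show "countable ((\<lambda>q. snd (k (snd q))) ` {q \<in> topspace Q. fst q = z})" for z
      by (rule countable_subset[OF _ S(2)[of "h z"]]) (use hk in \<open>auto simp: topQ\<close>)
    fix y
    define M where "M x = {z \<in> topspace Z. h z = x}" for x
    have M: "thin Z X (M x \<times> UNIV)" for x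
    proof (rule thin_nowhere_dense)
      fix V assume V: "openin Z V" "V \<noteq> {}"
      show "\<exists>V'. openin Z V' \<and> V' \<noteq> {} \<and> V' \<subseteq> V \<and> V' \<inter> M x = {}"
      proof (intro exI conjI)
        have "closedin Z (M x)"
        proof (cases "x \<in> topspace X")
          case True
          then have "closedin X {x}"
            using closedin_t1_singleton[OF Hausdorff_imp_t1_space[OF Haus]] by simp
          then show ?thesis using closedin_continuous_map_preimage[OF h, of "{x}"] by (simp add: M_def)
        next
          case False
          then have "M x = {}" using continuous_map_image_subset_topspace[OF h] by (auto simp: M_def)
          then show ?thesis by simp
        qed
        then show "openin Z (V - M x)" using V(1) by (rule openin_diff[rotated])
        show "V - M x \<noteq> {}" using nonconst[OF V, of x] by (auto simp: M_def)
      qed auto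
    qed
    have "thin_covered Z X (\<Union>((\<lambda>x. M x \<times> UNIV) ` {x. (x, y) \<in> S}))"
      by (rule thin_covered_Union) (use S(3) thin_imp_thin_covered[OF M] in auto)
    then show "thin_covered Z X ((\<lambda>q. (fst q, snd (k (snd q)))) ` {q \<in> topspace Q. snd (k (snd q)) = y})"
      by (rule thin_covered_subset) (use hk in \<open>auto simp: topQ M_def D_def\<close>)
  qed
  moreover have "{(z, y). z \<in> topspace Z \<and> (h z, y) \<in> S} \<subseteq> (\<lambda>q. (fst q, snd (k (snd q)))) ` topspace Q"
  proof clarify
    fix z y assume z: "z \<in> topspace Z" "(h z, y) \<in> S"
    then obtain p where p: "p \<in> topspace P" "k p = (h z, y)" using P(3) by (metis imageE)
    then show "(z, y) \<in> (\<lambda>q. (fst q, snd (k (snd q)))) ` topspace Q"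
      using z by (intro image_eqI[of _ _ "(z, p)"]) (auto simp: topQ D_def)
  qed
  ultimately show ?thesis by (rule thin_covered_subset)
qed

section \<open>The Cantor scheme\<close>

text \<open>The data of the main construction. The Boolean argument of \<open>g\<close> is the coordinate in the square of \<open>X\<close>; a point
of the square is written as a function on the Booleans. The set \<open>B\<close> provides the values on \<open>P\<^sub>f\<close>, and the sets \<open>F n\<close> are
to be avoided.\<close>

locale cantor_scheme =
  Z: Metric_space MZ dZ + X: Metric_space MX dX
  for MZ :: "'z set" and dZ and MX :: "'a set" and dX +
  fixes g :: "bool \<Rightarrow> 'z \<Rightarrow> 'a" and B :: "(bool \<Rightarrow> 'a) set" and F :: "nat \<Rightarrow> ('z \<times> 'a) set"
  assumes complete: "Z.mcomplete" and nonempty: "MZ \<noteq> {}"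
    and cont: "continuous_map Z.mtopology X.mtopology (g \<epsilon>)"
    and B_space: "b \<in> B \<Longrightarrow> b \<epsilon> \<in> MX"
    and adherent: "openin Z.mtopology V \<Longrightarrow> V \<noteq> {} \<Longrightarrow>
      \<exists>b\<in>B. \<forall>r>0. \<exists>z\<in>V. \<forall>\<epsilon>. dX (b \<epsilon>) (g \<epsilon> z) < r"
    and nonconst: "openin Z.mtopology V \<Longrightarrow> V \<noteq> {} \<Longrightarrow> \<exists>z\<in>V. g \<epsilon> z \<noteq> x"
    and thin: "thin Z.mtopology X.mtopology (F n)"
    and mono: "incseq F"
begin

definition near :: "(bool \<Rightarrow> 'a) \<Rightarrow> 'z set \<Rightarrow> bool" where
  "near c V \<longleftrightarrow> (\<forall>r>0. \<exists>z\<in>V. \<forall>\<epsilon>. dX (c \<epsilon>) (g \<epsilon> z) < r)"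

lemma near_mono: "near c V \<Longrightarrow> V \<subseteq> V' \<Longrightarrow> near c V'"
  unfolding near_def by blast

lemma near_nonempty: "near c V \<Longrightarrow> V \<noteq> {}"
  unfolding near_def using zero_less_one by blast

lemma g_in: "z \<in> MZ \<Longrightarrow> g \<epsilon> z \<in> MX"
  using continuous_map_image_subset_topspace[OF cont[of \<epsilon>]] by auto

lemma openin_sub: "openin Z.mtopology V \<Longrightarrow> z \<in> V \<Longrightarrow> z \<in> MZ"
  using openin_subset by fastforce

lemma openin_pullback:
  assumes "openin Z.mtopology V" "openin X.mtopology N"
  shows "openin Z.mtopology {z \<in> V. g \<epsilon> z \<in> N}"
proof -
  have "{z \<in> V. g \<epsilon> z \<in> N} = V \<inter> {z \<in> topspace Z.mtopology. g \<epsilon> z \<in> N}"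
    using openin_sub[OF assms(1)] by auto
  then show ?thesis
    using openin_Int[OF assms(1) openin_continuous_map_preimage[OF cont assms(2)]] by simp
qed

lemma openin_pullback_ball:
  assumes "openin Z.mtopology V" "\<And>\<epsilon>. c \<epsilon> \<in> MX"
  shows "openin Z.mtopology {z \<in> V. \<forall>\<epsilon>. dX (c \<epsilon>) (g \<epsilon> z) < r}"
proof -
  have "{z \<in> V. \<forall>\<epsilon>. dX (c \<epsilon>) (g \<epsilon> z) < r}
      = {z \<in> V. g True z \<in> X.mball (c True) r} \<inter> {z \<in> V. g False z \<in> X.mball (c False) r}"
  proof (rule set_eqI)
    fix z
    show "z \<in> {z \<in> V. \<forall>\<epsilon>. dX (c \<epsilon>) (g \<epsilon> z) < r} \<longleftrightarrow>
      z \<in> {z \<in> V. g True z \<in> X.mball (c True) r} \<inter> {z \<in> V. g False z \<in> X.mball (c False) r}"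
    proof (cases "z \<in> V")
      case True
      then have "z \<in> MZ" using openin_sub[OF assms(1)] by simp
      then show ?thesis using True g_in assms(2) by (simp add: all_bool_eq)
    qed simp
  qed
  then show ?thesis
    using openin_Int[OF openin_pullback[OF assms(1) X.openin_mball] openin_pullback[OF assms(1) X.openin_mball]]
    by simp
qed

lemma near_Int_ball:
  assumes "near c V" "r > 0"
  shows "near c {z \<in> V. \<forall>\<epsilon>. dX (c \<epsilon>) (g \<epsilon> z) < r}"
  unfolding near_def
proof (intro allI impI)
  fix q :: real assume "q > 0"
  then obtain z where "z \<in> V" "\<forall>\<epsilon>. dX (c \<epsilon>) (g \<epsilon> z) < min q r"
    using assms unfolding near_def by (meson min_less_iff_conj)
  then show "\<exists>z\<in>{z \<in> V. \<forall>\<epsilon>. dX (c \<epsilon>) (g \<epsilon> z) < r}. \<forall>\<epsilon>. dX (c \<epsilon>) (g \<epsilon> z) < q"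
    by auto
qed

text \<open>No point of \<open>V\<close> is paired by \<open>F n\<close> with a point at distance less than \<open>r\<close> from \<open>x\<close>. A uniform distance is asked
for because the values of the limit map are only limits of values of \<open>g\<close>.\<close>

definition away :: "nat \<Rightarrow> 'z set \<Rightarrow> 'a \<Rightarrow> real \<Rightarrow> bool" where
  "away n V x r \<longleftrightarrow> (\<forall>z\<in>V. \<forall>y\<in>MX. dX y x < r \<longrightarrow> (z, y) \<notin> F n)"

lemma shrink_off_point:
  assumes "openin Z.mtopology V" "V \<noteq> {}" "x \<in> MX"
  shows "\<exists>V'. openin Z.mtopology V' \<and> V' \<noteq> {} \<and> V' \<subseteq> V \<and> (\<exists>r>0. \<forall>z\<in>V'. r \<le> dX x (g \<epsilon> z))"
proof -
  obtain z where z: "z \<in> V" "g \<epsilon> z \<noteq> x" using nonconst assms by blast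
  have gz: "g \<epsilon> z \<in> MX" using z g_in openin_sub assms by blast
  define r where "r = dX x (g \<epsilon> z) / 2"
  have r: "r > 0" using z gz assms(3) by (auto simp: r_def)
  define V' where "V' = {w \<in> V. g \<epsilon> w \<in> X.mball (g \<epsilon> z) r}"
  have "r \<le> dX x (g \<epsilon> w)" if "w \<in> V'" for w
  proof -
    have "dX x (g \<epsilon> z) \<le> dX x (g \<epsilon> w) + dX (g \<epsilon> w) (g \<epsilon> z)"
      using that gz assms(3) by (intro X.triangle) (auto simp: V'_def)
    moreover have "dX (g \<epsilon> w) (g \<epsilon> z) < r" using that X.commute by (auto simp: V'_def)
    ultimately show ?thesis by (simp add: r_def)
  qed
  moreover have "openin Z.mtopology V'" unfolding V'_def using openin_pullback assms(1) by blast
  moreover have "z \<in> V'" using z gz r by (simp add: V'_def)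
  ultimately show ?thesis using r by (intro exI[of _ V']) (auto simp: V'_def)
qed

text \<open>Thinness enters the scheme here: it applies to every point \<open>x\<close>, in particular to the coordinates of the points of
\<open>B\<close>, over which the construction has no control.\<close>

lemma shrink_thin:
  assumes "openin Z.mtopology V" "V \<noteq> {}" "x \<in> MX"
  obtains V' r where "openin Z.mtopology V'" "V' \<noteq> {}" "V' \<subseteq> V" "r > 0" "away n V' x r"
proof -
  obtain V' N where V': "openin Z.mtopology V'" "V' \<noteq> {}" "V' \<subseteq> V" and
    N: "openin X.mtopology N" "x \<in> N" "(V' \<times> N) \<inter> F n = {}"
    using thinD[OF thin assms(1,2), of x] assms(3) by auto
  obtain r where r: "r > 0" "X.mball x r \<subseteq> N" using N by (auto simp: X.openin_mtopology)
  have "(z, y) \<notin> F n" if "z \<in> V'" "y \<in> MX" "dX y x < r" for z y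
  proof -
    have "y \<in> N" using that r(2) assms(3) X.commute[of x y] by auto
    then show ?thesis using N(3) that(1) by blast
  qed
  then have "away n V' x r" by (simp add: away_def)
  then show thesis using V' r(1) that by blast
qed

text \<open>A stage of the construction attaches to every node an open set and a point of \<open>B\<close> to which the image of this
open set comes arbitrarily close. This closeness has to survive along the zeros that follow the node,
which is why the open set of a left child is cut down by a ball around the point of \<open>B\<close> and by nothing else.\<close>

definition state :: "nat \<Rightarrow> (cantor \<Rightarrow> 'z set) \<times> (cantor \<Rightarrow> bool \<Rightarrow> 'a) \<Rightarrow> bool" where
  "state m \<sigma> \<longleftrightarrow> (\<forall>s\<in>node m. openin Z.mtopology (fst \<sigma> s) \<and> snd \<sigma> s \<in> B \<and> near (snd \<sigma> s) (fst \<sigma> s))"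

text \<open>The children of \<open>s\<close> have images close to \<open>b s\<close>. The right child is small and has its closure inside
\<open>W s\<close>; its image has positive distance from the image of the left child in each coordinate, which yields
injectivity; and it keeps away, with respect to \<open>F m\<close>, from the images of all other nodes of the new level.\<close>

definition splits :: "nat \<Rightarrow> (cantor \<Rightarrow> 'z set) \<Rightarrow> (cantor \<Rightarrow> bool \<Rightarrow> 'a) \<Rightarrow> (cantor \<Rightarrow> 'z set) \<Rightarrow> cantor \<Rightarrow> bool"
  where "splits m W b W' s \<longleftrightarrow>
    W' s \<subseteq> W s \<and> (\<forall>z\<in>W' s. \<forall>\<epsilon>. dX (b s \<epsilon>) (g \<epsilon> z) < (1/2) ^ m) \<and>
    W' (s(m := True)) \<subseteq> W s \<and> (\<forall>z\<in>W' (s(m := True)). \<forall>\<epsilon>. dX (b s \<epsilon>) (g \<epsilon> z) < (1/2) ^ m) \<and>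
    Z.mtopology closure_of (W' (s(m := True))) \<subseteq> W s \<and>
    (\<exists>a. W' (s(m := True)) \<subseteq> Z.mcball a ((1/2) ^ m)) \<and>
    (\<forall>\<epsilon>. \<exists>r>0. \<forall>z\<in>W' (s(m := True)). \<forall>z'\<in>W' s. r \<le> dX (g \<epsilon> z) (g \<epsilon> z')) \<and>
    (\<forall>t\<in>node (Suc m). t \<noteq> s(m := True) \<longrightarrow>
      (\<forall>\<eta>. \<exists>r>0. \<forall>z'\<in>W' t. away m (W' (s(m := True))) (g \<eta> z') r))"

text \<open>The right children of all nodes, chosen together. The last two conclusions keep a right child away from
the points that continue the nodes by zeros, and from the other right children.\<close>

lemma simultaneous_shrink:
  assumes st: "state m (W, b)"
  obtains V where "\<And>s. s \<in> node m \<Longrightarrow> openin Z.mtopology (V s)" "\<And>s. s \<in> node m \<Longrightarrow> V s \<noteq> {}"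
    "\<And>s. s \<in> node m \<Longrightarrow> V s \<subseteq> {z \<in> W s. \<forall>\<epsilon>. dX (b s \<epsilon>) (g \<epsilon> z) < (1/2) ^ m}"
    "\<And>s. s \<in> node m \<Longrightarrow> Z.mtopology closure_of V s \<subseteq> W s \<and> (\<exists>a. V s \<subseteq> Z.mcball a ((1/2) ^ m))"
    "\<And>s \<epsilon>. s \<in> node m \<Longrightarrow> \<exists>r>0. \<forall>z\<in>V s. r \<le> dX (b s \<epsilon>) (g \<epsilon> z)"
    "\<And>s u \<eta>. s \<in> node m \<Longrightarrow> u \<in> node m \<Longrightarrow> \<exists>r>0. away m (V s) (b u \<eta>) r"
    "\<And>s u \<eta>. s \<in> node m \<Longrightarrow> u \<in> node m \<Longrightarrow> s \<noteq> u \<Longrightarrow> \<exists>r>0. \<forall>z'\<in>V u. away m (V s) (g \<eta> z') r"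
proof -
  have W: "openin Z.mtopology (W s)" "b s \<in> B" "near (b s) (W s)" if "s \<in> node m" for s
    using st that by (auto simp: state_def)
  have bM: "b s \<epsilon> \<in> MX" if "s \<in> node m" for s \<epsilon> using B_space W(2) that by blast
  define ball where "ball r s = {z \<in> W s. \<forall>\<epsilon>. dX (b s \<epsilon>) (g \<epsilon> z) < r}" for r s
  have ball_open: "openin Z.mtopology (ball r s)" if "s \<in> node m" for r s
    unfolding ball_def using openin_pullback_ball W(1) bM that by blast
  have ball_near: "near (b s) (ball r s)" if "s \<in> node m" "r > 0" for r s
    unfolding ball_def using near_Int_ball W(3) that by blast
  let ?NO = "nonempty_opens Z.mtopology (node m)"
  have V0: "?NO (ball ((1/2) ^ m))"
    using ball_open near_nonempty[OF ball_near] unfolding nonempty_opens_def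
    by (meson half_gt_zero zero_less_one zero_less_power)
  define P1 where "P1 s V \<longleftrightarrow> Z.mtopology closure_of (V s) \<subseteq> W s \<and> (\<exists>a. V s \<subseteq> Z.mcball a ((1/2) ^ m))"
    for s and V :: "cantor \<Rightarrow> 'z set"
  define P2 where "P2 s \<epsilon> V \<longleftrightarrow> (\<exists>r>0. \<forall>z\<in>V s. r \<le> dX (b s \<epsilon>) (g \<epsilon> z))"
    for s \<epsilon> and V :: "cantor \<Rightarrow> 'z set"
  define P3 where "P3 s u \<eta> V \<longleftrightarrow> (\<exists>r>0. away m (V s) (b u \<eta>) r)"
    for s u \<eta> and V :: "cantor \<Rightarrow> 'z set"
  define P4 where "P4 s u \<eta> V \<longleftrightarrow> (\<exists>r>0. \<forall>z'\<in>V u. away m (V s) (g \<eta> z') r)"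
    for s u \<eta> and V :: "cantor \<Rightarrow> 'z set"
  define K1 where "K1 = P1 ` node m"
  define K2 where "K2 = (\<lambda>(s, \<epsilon>). P2 s \<epsilon>) ` (node m \<times> UNIV)"
  define K3 where "K3 = (\<lambda>(s, u, \<eta>). P3 s u \<eta>) ` (node m \<times> node m \<times> UNIV)"
  define K4 where "K4 = (\<lambda>(s, u, \<eta>). P4 s u \<eta>) ` {(s, u, \<eta>). s \<in> node m \<and> u \<in> node m \<and> s \<noteq> u}"
  have fin: "finite (K1 \<union> K2 \<union> K3 \<union> K4)"
  proof -
    have "finite {(s, u, \<eta> :: bool). s \<in> node m \<and> u \<in> node m \<and> s \<noteq> u}"
      by (rule finite_subset[of _ "node m \<times> node m \<times> UNIV"]) (auto simp: finite_node)
    then show ?thesis by (simp add: K1_def K2_def K3_def K4_def finite_node)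
  qed
  obtain V where V: "?NO V" "\<And>s. s \<in> node m \<Longrightarrow> V s \<subseteq> ball ((1/2) ^ m) s"
    "\<And>P. P \<in> K1 \<union> K2 \<union> K3 \<union> K4 \<Longrightarrow> P V"
  proof (rule finite_refinement[OF fin V0])
    fix P and V V' :: "cantor \<Rightarrow> 'z set"
    assume P: "P \<in> K1 \<union> K2 \<union> K3 \<union> K4" "P V" and sub: "\<And>i. i \<in> node m \<Longrightarrow> V' i \<subseteq> V i"
    consider s where "s \<in> node m" "P = P1 s" | s \<epsilon> where "s \<in> node m" "P = P2 s \<epsilon>"
      | s u \<eta> where "s \<in> node m" "u \<in> node m" "P = P3 s u \<eta>"
      | s u \<eta> where "s \<in> node m" "u \<in> node m" "P = P4 s u \<eta>"
      using P(1) by (auto simp: K1_def K2_def K3_def K4_def)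
    then show "P V'"
    proof cases
      case 1
      then show ?thesis using P(2) sub[of s] closure_of_mono[of "V' s" "V s" Z.mtopology]
        unfolding P1_def by blast
    next
      case 2
      then show ?thesis using P(2) sub[of s] unfolding P2_def by blast
    next
      case 3
      then show ?thesis using P(2) sub[of s] unfolding P3_def away_def by blast
    next
      case 4
      then show ?thesis using P(2) sub[of s] sub[of u] unfolding P4_def away_def by blast
    qed
  next
    fix P V assume P: "P \<in> K1 \<union> K2 \<union> K3 \<union> K4" and V: "?NO V"
      and sub: "\<And>i. i \<in> node m \<Longrightarrow> V i \<subseteq> ball ((1/2) ^ m) i"
    consider s where "s \<in> node m" "P = P1 s" | s \<epsilon> where "s \<in> node m" "P = P2 s \<epsilon>"
      | s u \<eta> where "s \<in> node m" "u \<in> node m" "P = P3 s u \<eta>"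
      | s u \<eta> where "s \<in> node m" "u \<in> node m" "s \<noteq> u" "P = P4 s u \<eta>"
      using P(1) by (auto simp: K1_def K2_def K3_def K4_def)
    then show "\<exists>V'. ?NO V' \<and> (\<forall>i\<in>node m. V' i \<subseteq> V i) \<and> P V'"
    proof cases
      case 1
      have "\<exists>V'. ?NO V' \<and> (\<forall>i\<in>node m. V' i \<subseteq> V i) \<and>
        (Z.mtopology closure_of (V' s) \<subseteq> W s \<and> (\<exists>a. V' s \<subseteq> Z.mcball a ((1/2) ^ m)))"
      proof (rule dense_single_coordinate[OF V 1(1), where Q = "\<lambda>U. Z.mtopology closure_of U \<subseteq> W s
            \<and> (\<exists>a. U \<subseteq> Z.mcball a ((1/2) ^ m))"])
        fix U assume U: "openin Z.mtopology U" "U \<noteq> {}" "U \<subseteq> V s"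
        then have UW: "U \<subseteq> W s" using sub[OF 1(1)] by (auto simp: ball_def)
        obtain U' where "openin Z.mtopology U'" "U' \<noteq> {}" "U' \<subseteq> U" "Z.mtopology closure_of U' \<subseteq> W s"
          "\<exists>a. U' \<subseteq> Z.mcball a ((1/2) ^ m)"
          by (rule Z.shrink_small_open[OF U(1,2) UW, of "(1/2) ^ m"]) simp
        then show "\<exists>U'. openin Z.mtopology U' \<and> U' \<noteq> {} \<and> U' \<subseteq> U \<and>
            (Z.mtopology closure_of U' \<subseteq> W s \<and> (\<exists>a. U' \<subseteq> Z.mcball a ((1/2) ^ m)))"
          by (intro exI[of _ U'] conjI)
      qed
      then show ?thesis by (simp add: 1(2) P1_def)
    next
      case 2
      have "\<exists>V'. ?NO V' \<and> (\<forall>i\<in>node m. V' i \<subseteq> V i) \<and> (\<exists>r>0. \<forall>z\<in>V' s. r \<le> dX (b s \<epsilon>) (g \<epsilon> z))"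
        by (rule dense_single_coordinate[OF V 2(1), where Q = "\<lambda>U. \<exists>r>0. \<forall>z\<in>U. r \<le> dX (b s \<epsilon>) (g \<epsilon> z)"])
          (use shrink_off_point[OF _ _ bM[OF 2(1)]] in simp)
      then show ?thesis by (simp add: 2(2) P2_def)
    next
      case 3
      have "\<exists>V'. ?NO V' \<and> (\<forall>i\<in>node m. V' i \<subseteq> V i) \<and> (\<exists>r>0. away m (V' s) (b u \<eta>) r)"
        by (rule dense_single_coordinate[OF V 3(1), where Q = "\<lambda>U. \<exists>r>0. away m U (b u \<eta>) r"])
          (use shrink_thin[OF _ _ bM[OF 3(2)]] in metis)
      then show ?thesis by (simp add: 3(3) P3_def)
    next
      case 4
      have Vo: "openin Z.mtopology (V s)" "V s \<noteq> {}" "openin Z.mtopology (V u)" "V u \<noteq> {}"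
        using V 4 by (auto simp: nonempty_opens_def)
      obtain z where z: "z \<in> V u" using Vo by auto
      have gz: "g \<eta> z \<in> MX" using z Vo g_in openin_sub by blast
      obtain U r where U: "openin Z.mtopology U" "U \<noteq> {}" "U \<subseteq> V s" "r > 0" "away m U (g \<eta> z) r"
        using shrink_thin[OF Vo(1,2) gz] by metis
      define U' where "U' = {w \<in> V u. g \<eta> w \<in> X.mball (g \<eta> z) (r / 2)}"
      have U': "openin Z.mtopology U'" "z \<in> U'"
        unfolding U'_def by (rule openin_pullback[OF Vo(3) X.openin_mball]) (use z gz U(4) in simp)
      have "away m U (g \<eta> z') (r / 2)" if "z' \<in> U'" for z'
        unfolding away_def
      proof (intro ballI impI)
        fix w y assume w: "w \<in> U" "y \<in> MX" "dX y (g \<eta> z') < r / 2"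
        have "dX y (g \<eta> z) \<le> dX y (g \<eta> z') + dX (g \<eta> z') (g \<eta> z)"
          using that w gz by (intro X.triangle) (auto simp: U'_def)
        moreover have "dX (g \<eta> z') (g \<eta> z) < r / 2" using that X.commute by (auto simp: U'_def)
        ultimately have "dX y (g \<eta> z) < r" using w by simp
        then show "(w, y) \<notin> F m" using U(5) w unfolding away_def by blast
      qed
      then have "P4 s u \<eta> (V(s := U, u := U'))"
        unfolding P4_def using U(4) 4(3) by (intro exI[of _ "r/2"]) auto
      moreover have "?NO (V(s := U, u := U'))" using V U U' unfolding nonempty_opens_def by auto
      moreover have "\<forall>i\<in>node m. (V(s := U, u := U')) i \<subseteq> V i" using U by (auto simp: U'_def)
      ultimately show ?thesis using 4(4) by blast
    qed
  qed blast
  have P1: "P1 s V" and P2: "P2 s \<epsilon> V" if "s \<in> node m" for s \<epsilon>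
    using V(3) that by (auto simp: K1_def K2_def)
  have P3: "P3 s u \<eta> V" if "s \<in> node m" "u \<in> node m" for s u \<eta>
    using V(3) that by (force simp: K3_def)
  have P4: "P4 s u \<eta> V" if "s \<in> node m" "u \<in> node m" "s \<noteq> u" for s u \<eta>
  proof -
    have "P4 s u \<eta> \<in> K4" using that by (force simp: K4_def)
    then show ?thesis using V(3) by blast
  qed
  show thesis
  proof (rule that[of V])
    show "openin Z.mtopology (V s)" "V s \<noteq> {}" if "s \<in> node m" for s
      using V(1) that by (auto simp: nonempty_opens_def)
    show "V s \<subseteq> {z \<in> W s. \<forall>\<epsilon>. dX (b s \<epsilon>) (g \<epsilon> z) < (1/2) ^ m}" if "s \<in> node m" for s
      using V(2)[OF that] by (simp only: ball_def)
    show "Z.mtopology closure_of V s \<subseteq> W s \<and> (\<exists>a. V s \<subseteq> Z.mcball a ((1/2) ^ m))" if "s \<in> node m" for s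
      using P1[OF that] by (simp only: P1_def)
    show "\<exists>r>0. \<forall>z\<in>V s. r \<le> dX (b s \<epsilon>) (g \<epsilon> z)" if "s \<in> node m" for s \<epsilon>
      using P2[OF that] by (simp only: P2_def)
    show "\<exists>r>0. away m (V s) (b u \<eta>) r" if "s \<in> node m" "u \<in> node m" for s u \<eta>
      using P3[OF that] by (simp only: P3_def)
    show "\<exists>r>0. \<forall>z'\<in>V u. away m (V s) (g \<eta> z') r" if "s \<in> node m" "u \<in> node m" "s \<noteq> u" for s u \<eta>
      using P4[OF that] by (simp only: P4_def)
  qed
qed

lemma extend:
  assumes st: "state m (W, b)"
  obtains W' b' where "state (Suc m) (W', b')" "\<And>s. s \<in> node m \<Longrightarrow> b' s = b s"
    "\<And>s. s \<in> node m \<Longrightarrow> splits m W b W' s"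
proof -
  have W: "openin Z.mtopology (W s)" "b s \<in> B" "near (b s) (W s)" if "s \<in> node m" for s
    using st that by (auto simp: state_def)
  have bM: "b s \<epsilon> \<in> MX" if "s \<in> node m" for s \<epsilon> using B_space W(2) that by blast
  define ball where "ball r s = {z \<in> W s. \<forall>\<epsilon>. dX (b s \<epsilon>) (g \<epsilon> z) < r}" for r s
  have ball_open: "openin Z.mtopology (ball r s)" if "s \<in> node m" for r s
    unfolding ball_def using openin_pullback_ball W(1) bM that by blast
  have ball_near: "near (b s) (ball r s)" if "s \<in> node m" "r > 0" for r s
    unfolding ball_def using near_Int_ball W(3) that by blast
  obtain V where V: "\<And>s. s \<in> node m \<Longrightarrow> openin Z.mtopology (V s)" "\<And>s. s \<in> node m \<Longrightarrow> V s \<noteq> {}"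
    "\<And>s. s \<in> node m \<Longrightarrow> V s \<subseteq> {z \<in> W s. \<forall>\<epsilon>. dX (b s \<epsilon>) (g \<epsilon> z) < (1/2) ^ m}"
    and V_small: "\<And>s. s \<in> node m \<Longrightarrow>
      Z.mtopology closure_of V s \<subseteq> W s \<and> (\<exists>a. V s \<subseteq> Z.mcball a ((1/2) ^ m))"
    and V_off: "\<And>s \<epsilon>. s \<in> node m \<Longrightarrow> \<exists>r>0. \<forall>z\<in>V s. r \<le> dX (b s \<epsilon>) (g \<epsilon> z)"
    and V_away: "\<And>s u \<eta>. s \<in> node m \<Longrightarrow> u \<in> node m \<Longrightarrow> \<exists>r>0. away m (V s) (b u \<eta>) r"
    and V_apart: "\<And>s u \<eta>. s \<in> node m \<Longrightarrow> u \<in> node m \<Longrightarrow> s \<noteq> u \<Longrightarrow>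
      \<exists>r>0. \<forall>z'\<in>V u. away m (V s) (g \<eta> z') r"
    by (rule simultaneous_shrink[OF st], rule that) assumption+
  \<comment> \<open>The node \<open>s\<close> keeps the part of \<open>W s\<close> above a small ball around \<open>b s\<close>; finitely many requirements
     leave a common radius for all nodes.\<close>
  define ok where "ok r \<longleftrightarrow> r \<le> (1/2) ^ m \<and>
     (\<forall>s\<in>node m. \<forall>\<epsilon>. \<forall>z\<in>V s. 2 * r \<le> dX (b s \<epsilon>) (g \<epsilon> z)) \<and>
     (\<forall>s\<in>node m. \<forall>u\<in>node m. \<forall>\<eta>. away m (V s) (b u \<eta>) (2 * r))" for r :: real
  have "\<exists>r>0. ok r"
  proof -
    have ev: "\<forall>\<^sub>F r in at_right (0::real). 2 * r \<le> q" if "q > 0" for q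
      unfolding eventually_at_right_field using that by (intro exI[of _ "q / 2"]) auto
    have 1: "\<forall>\<^sub>F r in at_right (0::real). r \<le> (1/2) ^ m"
      using ev[of "2 * (1/2) ^ m"] by simp
    have 2: "\<forall>\<^sub>F r in at_right (0::real). \<forall>s\<in>node m. \<forall>\<epsilon>\<in>UNIV. \<forall>z\<in>V s. 2 * r \<le> dX (b s \<epsilon>) (g \<epsilon> z)"
    proof (rule eventually_ball_finite[OF finite_node], rule ballI,
        rule eventually_ball_finite[OF finite], rule ballI)
      fix s \<epsilon> assume s: "s \<in> node m"
      obtain q where q: "q > 0" "\<forall>z\<in>V s. q \<le> dX (b s \<epsilon>) (g \<epsilon> z)" using V_off[OF s] by blast
      show "\<forall>\<^sub>F r in at_right (0::real). \<forall>z\<in>V s. 2 * r \<le> dX (b s \<epsilon>) (g \<epsilon> z)"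
        by (rule eventually_mono[OF ev[OF q(1)]]) (use q(2) in force)
    qed
    have 3: "\<forall>\<^sub>F r in at_right (0::real). \<forall>s\<in>node m. \<forall>u\<in>node m. \<forall>\<eta>\<in>UNIV. away m (V s) (b u \<eta>) (2 * r)"
    proof (rule eventually_ball_finite[OF finite_node], rule ballI,
        rule eventually_ball_finite[OF finite_node], rule ballI,
        rule eventually_ball_finite[OF finite], rule ballI)
      fix s u \<eta> assume s: "s \<in> node m" "u \<in> node m"
      obtain q where q: "q > 0" "away m (V s) (b u \<eta>) q" using V_away[OF s] by blast
      show "\<forall>\<^sub>F r in at_right (0::real). away m (V s) (b u \<eta>) (2 * r)"
        by (rule eventually_mono[OF ev[OF q(1)]]) (use q(2) in \<open>auto simp: away_def\<close>)
    qed
    have "\<forall>\<^sub>F r in at_right (0::real). ok r \<and> r > 0"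
      using 1 2 3 eventually_at_right_less[of 0] unfolding ok_def
      by eventually_elim simp
    then show ?thesis
      using eventually_happens'[OF trivial_limit_at_right_real] by fast
  qed
  then obtain \<rho> where \<rho>: "\<rho> > 0" "ok \<rho>" by blast
  have "\<exists>c\<in>B. near c (V s)" if "s \<in> node m" for s
    using adherent[OF V(1,2)[OF that]] unfolding near_def .
  then obtain c where c: "\<And>s. s \<in> node m \<Longrightarrow> c s \<in> B \<and> near (c s) (V s)" by metis
  define W' where "W' t = (if t m then V (t(m := False)) else ball \<rho> t)" for t
  define b' where "b' t = (if t m then c (t(m := False)) else b t)" for t
  have upd_cancel: "s(m := False) = s" if "s \<in> node m" for s
    using node_upd(3)[OF that] by (auto simp: fun_eq_iff)
  have W'0: "W' s = ball \<rho> s" "b' s = b s" if "s \<in> node m" for s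
    using node_upd(3)[OF that] by (simp_all add: W'_def b'_def)
  have W'1: "W' (s(m := True)) = V s" "b' (s(m := True)) = c s" if "s \<in> node m" for s
    by (simp_all add: W'_def b'_def upd_cancel[OF that])
  show thesis
  proof
    show "state (Suc m) (W', b')"
      unfolding state_def fst_conv snd_conv
    proof
      fix t assume "t \<in> node (Suc m)"
      then show "openin Z.mtopology (W' t) \<and> b' t \<in> B \<and> near (b' t) (W' t)"
      proof (cases rule: node_SucE)
        case 1
        then show ?thesis using W'0 ball_open ball_near \<rho>(1) W(2) by simp
      next
        case (2 s)
        then show ?thesis using W'1[OF 2(1)] c V(1) by simp
      qed
    qed
    show "b' s = b s" if "s \<in> node m" for s using W'0 that by simp
    fix s assume s: "s \<in> node m"
    have small: "ball \<rho> s \<subseteq> ball ((1/2) ^ m) s"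
    proof -
      have "\<rho> \<le> (1/2) ^ m" using \<rho>(2) by (simp add: ok_def)
      then show ?thesis by (auto simp: ball_def intro: less_le_trans)
    qed
    have sep: "\<exists>r>0. \<forall>z\<in>V s. \<forall>z'\<in>ball \<rho> s. r \<le> dX (g \<epsilon> z) (g \<epsilon> z')" for \<epsilon>
    proof (intro exI[of _ \<rho>] conjI ballI \<rho>(1))
      fix z z' assume z: "z \<in> V s" "z' \<in> ball \<rho> s"
      have M: "g \<epsilon> z \<in> MX" "g \<epsilon> z' \<in> MX"
        using z g_in openin_sub[OF V(1)[OF s]] openin_sub[OF ball_open[OF s]] by blast+
      have "2 * \<rho> \<le> dX (b s \<epsilon>) (g \<epsilon> z)" using \<rho>(2) s z by (auto simp: ok_def)
      also have "\<dots> \<le> dX (b s \<epsilon>) (g \<epsilon> z') + dX (g \<epsilon> z') (g \<epsilon> z)"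
        using M bM[OF s] by (intro X.triangle)
      also have "dX (b s \<epsilon>) (g \<epsilon> z') < \<rho>" using z(2) by (simp add: ball_def)
      finally show "\<rho> \<le> dX (g \<epsilon> z) (g \<epsilon> z')" using X.commute[of "g \<epsilon> z"] by simp
    qed
    have avoid: "\<exists>r>0. \<forall>z'\<in>W' t. away m (V s) (g \<eta> z') r"
      if t: "t \<in> node (Suc m)" "t \<noteq> s(m := True)" for t \<eta>
      using t(1)
    proof (cases rule: node_SucE)
      case 1
      show ?thesis unfolding W'0[OF 1(1)]
      proof (intro exI[of _ \<rho>] conjI ballI \<rho>(1))
        fix z' assume z': "z' \<in> ball \<rho> t"
        have M: "g \<eta> z' \<in> MX" using z' ball_open[OF 1(1)] g_in openin_sub by blast
        show "away m (V s) (g \<eta> z') \<rho>" unfolding away_def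
        proof (intro ballI impI)
          fix z y assume z: "z \<in> V s" "y \<in> MX" "dX y (g \<eta> z') < \<rho>"
          have "dX y (b t \<eta>) \<le> dX y (g \<eta> z') + dX (g \<eta> z') (b t \<eta>)"
            using z M bM[OF 1(1)] by (intro X.triangle)
          moreover have "dX (g \<eta> z') (b t \<eta>) < \<rho>"
            using z' X.commute[of "g \<eta> z'" "b t \<eta>"] by (simp add: ball_def)
          ultimately have "dX y (b t \<eta>) < 2 * \<rho>" using z by simp
          moreover have "away m (V s) (b t \<eta>) (2 * \<rho>)" using \<rho>(2) s 1(1) by (auto simp: ok_def)
          ultimately show "(z, y) \<notin> F m" using z unfolding away_def by blast
        qed
      qed
    next
      case (2 u)
      then have "s \<noteq> u" using t(2) by blast
      then show ?thesis using V_apart[OF s 2(1)] W'1(1)[OF 2(1)] 2(2) by simp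
    qed
    have "ball r s \<subseteq> W s" for r by (auto simp: ball_def)
    moreover have "\<forall>z\<in>ball ((1/2) ^ m) s. \<forall>\<epsilon>. dX (b s \<epsilon>) (g \<epsilon> z) < (1/2) ^ m"
      by (auto simp: ball_def)
    ultimately show "splits m W b W' s"
      unfolding splits_def W'0[OF s] W'1[OF s]
      using small V(3)[OF s] V_small[OF s] sep avoid
      by (intro conjI ballI allI impI) blast+
  qed
qed

lemma scheme:
  obtains W b where "\<And>n. state n (W n, b n)" "\<And>n s. s \<in> node n \<Longrightarrow> b (Suc n) s = b n s"
    "\<And>n s. s \<in> node n \<Longrightarrow> splits n (W n) (b n) (W (Suc n)) s"
proof -
  let ?Q = "\<lambda>n \<sigma> \<sigma>'. \<forall>s\<in>node n. snd \<sigma>' s = snd \<sigma> s \<and> splits n (fst \<sigma>) (snd \<sigma>) (fst \<sigma>') s"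
  have "\<exists>\<sigma>. \<forall>n. state n (\<sigma> n) \<and> ?Q n (\<sigma> n) (\<sigma> (Suc n))"
  proof (rule dependent_nat_choice)
    obtain c where "c \<in> B" "near c MZ"
      using adherent[of MZ] nonempty openin_topspace[of Z.mtopology] unfolding near_def by auto
    then have "state 0 (\<lambda>_. MZ, \<lambda>_. c)"
      using openin_topspace[of Z.mtopology] by (simp add: state_def)
    then show "\<exists>\<sigma>. state 0 \<sigma>" by blast
  next
    fix \<sigma> n assume "state n \<sigma>"
    then have st: "state n (fst \<sigma>, snd \<sigma>)" by simp
    obtain W' b' where W': "state (Suc n) (W', b')" "\<And>s. s \<in> node n \<Longrightarrow> b' s = snd \<sigma> s"
      "\<And>s. s \<in> node n \<Longrightarrow> splits n (fst \<sigma>) (snd \<sigma>) W' s"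
      using extend[OF st] by blast
    show "\<exists>\<sigma>'. state (Suc n) \<sigma>' \<and> ?Q n \<sigma> \<sigma>'"
      by (intro exI[of _ "(W', b')"]) (simp add: W')
  qed
  then obtain \<sigma> where \<sigma>: "\<And>n. state n (\<sigma> n)" "\<And>n. ?Q n (\<sigma> n) (\<sigma> (Suc n))" by blast
  show thesis
    by (rule that[of "\<lambda>n. fst (\<sigma> n)" "\<lambda>n. snd (\<sigma> n)"]) (use \<sigma> in auto)
qed

text \<open>The value at a sequence is adherent to the images of all open sets along it, and these images become small, so the
map is continuous. If \<open>\<alpha>\<close> is in \<open>P\<^sub>\<infinity>\<close> and differs from \<open>\<beta>\<close>, then at every late digit 1 of \<open>\<alpha>\<close> the new node of
\<open>\<alpha>\<close> was kept away from the node of \<open>\<beta>\<close> with respect to a set that contains \<open>F n\<close>.\<close>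

lemma embedding:
  obtains f where "\<And>\<epsilon>. continuous_map euclidean X.mtopology (f \<epsilon>)" "\<And>\<epsilon>. inj (f \<epsilon>)"
    "\<And>\<alpha>. \<alpha> \<in> P_fin \<Longrightarrow> (\<lambda>\<epsilon>. f \<epsilon> \<alpha>) \<in> B"
    "\<And>\<alpha>. \<alpha> \<in> P_inf \<Longrightarrow> \<exists>z\<in>MZ. (\<forall>\<epsilon>. f \<epsilon> \<alpha> = g \<epsilon> z) \<and> (\<forall>\<beta> \<eta> n. \<beta> \<noteq> \<alpha> \<longrightarrow> (z, f \<eta> \<beta>) \<notin> F n)"
proof -
  obtain W b where st: "\<And>n. state n (W n, b n)" and bS: "\<And>n s. s \<in> node n \<Longrightarrow> b (Suc n) s = b n s"
    and sp: "\<And>n s. s \<in> node n \<Longrightarrow> splits n (W n) (b n) (W (Suc n)) s"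
    by (rule scheme, rule that) assumption+
  define w where "w n \<alpha> = W n (trunc n \<alpha>)" for n \<alpha>
  define c where "c n \<alpha> = b n (trunc n \<alpha>)" for n \<alpha>
  have w: "openin Z.mtopology (w n \<alpha>)" "c n \<alpha> \<in> B" "near (c n \<alpha>) (w n \<alpha>)" for n \<alpha>
    using st[of n] trunc_node by (auto simp: state_def w_def c_def)
  have spl: "splits n (W n) (b n) (W (Suc n)) (trunc n \<alpha>)" for n \<alpha>
    using sp trunc_node by blast
  have wS: "w (Suc n) \<alpha> \<subseteq> w n \<alpha>" for n \<alpha>
    using spl[of n \<alpha>] unfolding splits_def w_def trunc_Suc by simp
  have w_mono: "w n \<alpha> \<subseteq> w m \<alpha>" if "m \<le> n" for m n \<alpha>
    using lift_Suc_antimono_le[of "\<lambda>n. w n \<alpha>"] wS that by blast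
  have w_close: "dX (c n \<alpha> \<epsilon>) (g \<epsilon> z) < (1/2) ^ n" if "z \<in> w (Suc n) \<alpha>" for n \<alpha> \<epsilon> z
    using spl[of n \<alpha>] that unfolding splits_def w_def c_def trunc_Suc by (simp split: if_splits)
  have w_closure: "Z.mtopology closure_of (w (Suc n) \<alpha>) \<subseteq> w n \<alpha>"
    "\<exists>a. w (Suc n) \<alpha> \<subseteq> Z.mcball a ((1/2) ^ n)" if "\<alpha> n" for n \<alpha>
    using spl[of n \<alpha>] that unfolding splits_def w_def trunc_Suc by simp_all
  have stable: "b m s = b n s" if "s \<in> node n" "n \<le> m" for m n s
    using that(2)
  proof (induction m rule: dec_induct)
    case (step k)
    have "s \<in> node k" using that(1) step(1) by (auto simp: node_def)
    then show ?case using bS step by simp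
  qed simp
  have "\<exists>z. \<forall>n. z \<in> w n \<alpha>" if \<alpha>: "\<alpha> \<in> P_inf" for \<alpha>
  proof -
    obtain l where "\<And>n. l \<in> w n \<alpha>"
    proof (rule Z.nested_common_point[OF complete, of "\<lambda>n. w n \<alpha>"])
      show "w n \<alpha> \<noteq> {}" for n by (rule near_nonempty[OF w(3)])
      show "w n \<alpha> \<subseteq> MZ" for n using openin_subset[OF w(1)] by simp
      show "decseq (\<lambda>n. w n \<alpha>)" unfolding decseq_Suc_iff using wS by simp
      fix n
      obtain m where "m \<ge> n" "\<alpha> m" using \<alpha> P_inf_iff by blast
      then show "\<exists>m\<ge>n. Z.mtopology closure_of w (Suc m) \<alpha> \<subseteq> w m \<alpha> \<and>
          (\<exists>a. w (Suc m) \<alpha> \<subseteq> Z.mcball a ((1/2) ^ m))"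
        using w_closure[of \<alpha> m] by (intro exI[of _ m] conjI)
    qed blast
    then show ?thesis by blast
  qed
  then obtain z where z: "\<And>\<alpha> n. \<alpha> \<in> P_inf \<Longrightarrow> z \<alpha> \<in> w n \<alpha>" by metis
  have "\<exists>k. \<alpha> \<in> node k" if "\<alpha> \<notin> P_inf" for \<alpha>
    using that P_fin_iff by (auto simp: P_fin_def)
  then obtain k where k: "\<And>\<alpha>. \<alpha> \<notin> P_inf \<Longrightarrow> \<alpha> \<in> node (k \<alpha>)" by metis
  define f where "f \<epsilon> \<alpha> = (if \<alpha> \<in> P_inf then g \<epsilon> (z \<alpha>) else b (k \<alpha>) \<alpha> \<epsilon>)" for \<epsilon> \<alpha>
  have fM: "f \<epsilon> \<alpha> \<in> MX" for \<epsilon> \<alpha>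
    using z[of \<alpha> 0] openin_sub[OF w(1)] g_in B_space k[of \<alpha>] st[of "k \<alpha>"]
    by (auto simp: f_def state_def)
  have f_near: "near (\<lambda>\<epsilon>. f \<epsilon> \<alpha>) (w n \<alpha>)" for \<alpha> n
  proof (cases "\<alpha> \<in> P_inf")
    case True
    have "g \<epsilon> (z \<alpha>) \<in> MX" for \<epsilon> using fM[of \<epsilon> \<alpha>] True by (simp add: f_def)
    then show ?thesis unfolding near_def using z[OF True, of n] True
      by (intro allI impI bexI[of _ "z \<alpha>"]) (auto simp: f_def)
  next
    case False
    define m where "m = max n (k \<alpha>)"
    have m: "n \<le> m" "k \<alpha> \<le> m" by (auto simp: m_def)
    have "c m \<alpha> = b (k \<alpha>) \<alpha>"
      using trunc_of_node[OF k[OF False] m(2)] stable[OF k[OF False] m(2)] by (simp add: c_def)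
    then have "(\<lambda>\<epsilon>. f \<epsilon> \<alpha>) = c m \<alpha>" using False by (auto simp: f_def)
    then show ?thesis using w(3)[of m \<alpha>] w_mono[OF m(1)] near_mono by metis
  qed
  have f_close: "dX (c n \<alpha> \<epsilon>) (f \<epsilon> \<alpha>) < 2 * (1/2) ^ n" for n \<alpha> \<epsilon>
  proof -
    have "(1/2 :: real) ^ n > 0" by simp
    then obtain y where y: "y \<in> w (Suc n) \<alpha>" "dX (f \<epsilon> \<alpha>) (g \<epsilon> y) < (1/2) ^ n"
      using f_near[of \<alpha> "Suc n"] unfolding near_def by blast
    have "dX (c n \<alpha> \<epsilon>) (f \<epsilon> \<alpha>) \<le> dX (c n \<alpha> \<epsilon>) (g \<epsilon> y) + dX (g \<epsilon> y) (f \<epsilon> \<alpha>)"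
      using w(2) B_space fM g_in openin_sub[OF w(1) y(1)] by (intro X.triangle) auto
    then show ?thesis using w_close[OF y(1), of \<epsilon>] y(2) X.commute[of "f \<epsilon> \<alpha>" "g \<epsilon> y"] by simp
  qed
  show thesis
  proof
    show "continuous_map euclidean X.mtopology (f \<epsilon>)" for \<epsilon>
      unfolding X.continuous_map_to_metric
    proof (intro ballI allI impI)
      fix \<alpha> :: cantor and e :: real assume e: "e > 0"
      obtain n where n: "(1/2) ^ n < e / 4" using real_arch_pow_inv[of "e/4" "1/2"] e by auto
      show "\<exists>U. openin euclidean U \<and> \<alpha> \<in> U \<and> (\<forall>\<beta>\<in>U. f \<epsilon> \<beta> \<in> X.mball (f \<epsilon> \<alpha>) e)"
      proof (intro exI conjI ballI)
        show "openin euclidean {\<beta>. trunc n \<beta> = trunc n \<alpha>}" using open_trunc_eq by simp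
        fix \<beta> assume "\<beta> \<in> {\<beta>. trunc n \<beta> = trunc n \<alpha>}"
        then have "c n \<beta> = c n \<alpha>" by (simp add: c_def)
        then have "dX (c n \<alpha> \<epsilon>) (f \<epsilon> \<beta>) < 2 * (1/2) ^ n" using f_close[of n \<beta> \<epsilon>] by simp
        moreover have "dX (f \<epsilon> \<alpha>) (f \<epsilon> \<beta>) \<le> dX (f \<epsilon> \<alpha>) (c n \<alpha> \<epsilon>) + dX (c n \<alpha> \<epsilon>) (f \<epsilon> \<beta>)"
          using fM w(2) B_space by (intro X.triangle) auto
        ultimately show "f \<epsilon> \<beta> \<in> X.mball (f \<epsilon> \<alpha>) e"
          using f_close[of n \<alpha> \<epsilon>] n fM X.commute[of "f \<epsilon> \<alpha>" "c n \<alpha> \<epsilon>"] by simp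
      qed simp
    qed
    show "inj (f \<epsilon>)" for \<epsilon>
    proof -
      have ne: "f \<epsilon> \<alpha> \<noteq> f \<epsilon> \<beta>" if ab: "\<alpha> n" "\<not> \<beta> n" "trunc n \<alpha> = trunc n \<beta>" for \<alpha> \<beta> n
      proof
        assume eq: "f \<epsilon> \<alpha> = f \<epsilon> \<beta>"
        obtain r where r: "r > 0" "\<forall>x\<in>w (Suc n) \<alpha>. \<forall>y\<in>w (Suc n) \<beta>. r \<le> dX (g \<epsilon> x) (g \<epsilon> y)"
        proof -
          have "w (Suc n) \<alpha> = W (Suc n) ((trunc n \<alpha>)(n := True))"
            "w (Suc n) \<beta> = W (Suc n) (trunc n \<alpha>)"
            using ab by (simp_all add: w_def trunc_Suc)
          then have "\<exists>r>0. \<forall>x\<in>w (Suc n) \<alpha>. \<forall>y\<in>w (Suc n) \<beta>. r \<le> dX (g \<epsilon> x) (g \<epsilon> y)"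
            using spl[of n \<alpha>] unfolding splits_def by simp
          then show thesis using that by blast
        qed
        have "r / 2 > 0" using r by simp
        then obtain x y where xy: "x \<in> w (Suc n) \<alpha>" "y \<in> w (Suc n) \<beta>"
          "dX (f \<epsilon> \<alpha>) (g \<epsilon> x) < r / 2" "dX (f \<epsilon> \<beta>) (g \<epsilon> y) < r / 2"
          using f_near[of \<alpha> "Suc n"] f_near[of \<beta> "Suc n"] unfolding near_def by blast
        have "dX (g \<epsilon> x) (g \<epsilon> y) \<le> dX (g \<epsilon> x) (f \<epsilon> \<alpha>) + dX (f \<epsilon> \<alpha>) (g \<epsilon> y)"
          using fM g_in openin_sub[OF w(1)] xy by (intro X.triangle) auto
        then show False
          using r(2) xy eq X.commute[of "g \<epsilon> x" "f \<epsilon> \<alpha>"] by fastforce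
      qed
      show ?thesis
      proof (rule injI, rule ccontr)
        fix \<alpha> \<beta> assume eq: "f \<epsilon> \<alpha> = f \<epsilon> \<beta>" and "\<alpha> \<noteq> \<beta>"
        then have ex: "\<exists>n. \<alpha> n \<noteq> \<beta> n" by auto
        define n where "n = (LEAST n. \<alpha> n \<noteq> \<beta> n)"
        have n: "\<alpha> n \<noteq> \<beta> n" unfolding n_def using ex by (rule LeastI_ex)
        have "trunc n \<alpha> = trunc n \<beta>"
          unfolding trunc_eq_iff n_def using not_less_Least by blast
        then show False using ne[of \<alpha> n \<beta>] ne[of \<beta> n \<alpha>] n eq by (cases "\<alpha> n") auto
      qed
    qed
    show "(\<lambda>\<epsilon>. f \<epsilon> \<alpha>) \<in> B" if "\<alpha> \<in> P_fin" for \<alpha>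
    proof -
      have "\<alpha> \<notin> P_inf" using that by (simp add: P_fin_def)
      then show ?thesis using k[of \<alpha>] st[of "k \<alpha>"] by (simp add: f_def state_def)
    qed
    show "\<exists>x\<in>MZ. (\<forall>\<epsilon>. f \<epsilon> \<alpha> = g \<epsilon> x) \<and> (\<forall>\<beta> \<eta> n. \<beta> \<noteq> \<alpha> \<longrightarrow> (x, f \<eta> \<beta>) \<notin> F n)" if \<alpha>: "\<alpha> \<in> P_inf" for \<alpha>
    proof (intro bexI[of _ "z \<alpha>"] conjI allI impI)
      show "z \<alpha> \<in> MZ" using z[OF \<alpha>, of 0] openin_sub[OF w(1)] by blast
      show "f \<epsilon> \<alpha> = g \<epsilon> (z \<alpha>)" for \<epsilon> using \<alpha> by (simp add: f_def)
      fix \<beta> \<eta> n assume "\<beta> \<noteq> \<alpha>"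
      then obtain j where j: "\<beta> j \<noteq> \<alpha> j" by auto
      \<comment> \<open>A digit 1 of \<open>\<alpha>\<close> after the sequences have split and late enough for \<open>F n \<subseteq> F m\<close>.\<close>
      obtain m where m: "m \<ge> max n j" "\<alpha> m" using \<alpha> P_inf_iff by blast
      have "trunc (Suc m) \<beta> \<noteq> trunc (Suc m) \<alpha>" using j m(1) unfolding trunc_eq_iff by (auto intro!: exI[of _ j])
      then obtain r where r: "r > 0" "\<forall>y\<in>w (Suc m) \<beta>. away m (w (Suc m) \<alpha>) (g \<eta> y) r"
      proof -
        have "trunc (Suc m) \<alpha> = (trunc m \<alpha>)(m := True)" using m(2) by (simp add: trunc_Suc)
        then have "\<exists>r>0. \<forall>y\<in>w (Suc m) \<beta>. away m (w (Suc m) \<alpha>) (g \<eta> y) r"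
          using spl[of m \<alpha>] \<open>trunc (Suc m) \<beta> \<noteq> trunc (Suc m) \<alpha>\<close> trunc_node[of "Suc m" \<beta>]
          unfolding splits_def w_def by simp
        then show thesis using that by blast
      qed
      obtain y where "y \<in> w (Suc m) \<beta>" "dX (f \<eta> \<beta>) (g \<eta> y) < r"
        using f_near[of \<beta> "Suc m"] r(1) unfolding near_def by blast
      then have "(z \<alpha>, f \<eta> \<beta>) \<notin> F m"
        using r(2) z[OF \<alpha>] fM unfolding away_def by blast
      then show "(z \<alpha>, f \<eta> \<beta>) \<notin> F n" using mono m(1) by (auto simp: incseq_def)
    qed
  qed
qed

end

section \<open>The class of the set of infinite sequences\<close>

lemma fsigma_in_preimage:
  assumes "continuous_map X Y f" "fsigma_in Y S"
  shows "fsigma_in X {x \<in> topspace X. f x \<in> S}"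
proof -
  obtain \<U> where U: "countable \<U>" "\<U> \<subseteq> Collect (closedin Y)" "\<Union>\<U> = S"
    using assms(2) unfolding fsigma_in_def union_of_def by (elim exE conjE)
  have "fsigma_in X (\<Union>((\<lambda>C. {x \<in> topspace X. f x \<in> C}) ` \<U>))"
  proof (rule fsigma_in_Union)
    show "countable ((\<lambda>C. {x \<in> topspace X. f x \<in> C}) ` \<U>)" using U(1) by simp
    fix D assume "D \<in> (\<lambda>C. {x \<in> topspace X. f x \<in> C}) ` \<U>"
    then show "fsigma_in X D"
      using U(2) closedin_continuous_map_preimage[OF assms(1)] closed_imp_fsigma_in by auto
  qed
  moreover have "\<Union>((\<lambda>C. {x \<in> topspace X. f x \<in> C}) ` \<U>) = {x \<in> topspace X. f x \<in> S}"
    using U(3) by auto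
  ultimately show ?thesis by simp
qed

lemma gdelta_in_preimage:
  assumes "continuous_map X Y f" "gdelta_in Y S"
  shows "gdelta_in X {x \<in> topspace X. f x \<in> S}"
proof -
  have "fsigma_in X {x \<in> topspace X. f x \<in> topspace Y - S}"
    using assms by (intro fsigma_in_preimage) (auto simp: gdelta_in_fsigma_in)
  moreover have "{x \<in> topspace X. f x \<in> topspace Y - S} = topspace X - {x \<in> topspace X. f x \<in> S}"
    using continuous_map_image_subset_topspace[OF assms(1)] by auto
  ultimately show ?thesis by (auto simp: gdelta_in_fsigma_in)
qed

lemma in_class_preimage:
  "continuous_map X Y f \<Longrightarrow> in_class \<Gamma> Y S \<Longrightarrow> in_class \<Gamma> X {x \<in> topspace X. f x \<in> S}"
  by (cases \<Gamma>) (simp_all add: fsigma_in_preimage gdelta_in_preimage)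

lemma polish_space_cantor: "polish_space (euclidean :: cantor topology)"
proof -
  have "(euclidean :: bool topology) = discrete_topology UNIV"
    by (simp add: topology_eq open_discrete)
  then have "polish_space (euclidean :: bool topology)"
    by (simp add: polish_space_iff second_countable_discrete_topology completely_metrizable_space_discrete_topology)
  then have "polish_space (product_topology (\<lambda>_. euclidean :: bool topology) (UNIV :: nat set))"
    by (rule polish_space_product_topology)
  then show ?thesis by (simp add: euclidean_product_topology)
qed

lemma open_meets_P_fin_and_P_inf:
  assumes "open U" "U \<noteq> {}"
  shows "U \<inter> P_fin \<noteq> {}" "U \<inter> P_inf \<noteq> {}"
proof -
  obtain \<alpha> where "\<alpha> \<in> U" using assms(2) by auto
  then obtain A where A: "\<alpha> \<in> PiE UNIV A" "\<And>i. open (A i)" "finite {i. A i \<noteq> UNIV}" "PiE UNIV A \<subseteq> U"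
    using product_topology_open_contains_basis[of "\<lambda>_. euclidean :: bool topology" UNIV U \<alpha>] assms(1)
    by (auto simp: euclidean_product_topology)
  obtain N where N: "\<forall>i\<in>{i. A i \<noteq> UNIV}. i < N" using A(3) finite_nat_set_iff_bounded by blast
  have in_U: "\<beta> \<in> U" if "\<forall>i<N. \<beta> i = \<alpha> i" for \<beta>
  proof -
    have "\<beta> i \<in> A i" for i using that N A(1) by (cases "i < N") (auto simp: PiE_iff)
    then show ?thesis using A(4) by (auto simp: PiE_iff)
  qed
  have "trunc N \<alpha> \<in> U" using in_U by (simp add: trunc_def)
  moreover have "trunc N \<alpha> \<in> P_fin" using trunc_node P_fin_iff by blast
  ultimately show "U \<inter> P_fin \<noteq> {}" by blast
  define \<beta> where "\<beta> i = (if i < N then \<alpha> i else True)" for i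
  have "\<beta> \<in> U" by (rule in_U) (simp add: \<beta>_def)
  moreover have "\<beta> \<in> P_inf" unfolding P_inf_iff
  proof
    show "\<exists>m\<ge>n. \<beta> m" for n by (intro exI[of _ "max n N"]) (simp add: \<beta>_def)
  qed
  ultimately show "U \<inter> P_inf \<noteq> {}" by blast
qed

lemma countable_P_fin: "countable P_fin"
proof -
  have "countable (\<Union>n. node n)" using countable_finite[OF finite_node] by (intro countable_UN) auto
  moreover have "P_fin = (\<Union>n. node n)" using P_fin_iff by auto
  ultimately show ?thesis by simp
qed

text \<open>Otherwise the Cantor space would be a countable union of closed sets with empty interior: the closed sets that make
up \<open>P\<^sub>\<infinity>\<close> do not meet the dense set \<open>P\<^sub>f\<close>, and the points of \<open>P\<^sub>f\<close> are not isolated, as \<open>P\<^sub>\<infinity>\<close> is dense.\<close>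

lemma not_fsigma_P_inf: "\<not> fsigma_in (euclidean :: cantor topology) P_inf"
proof
  let ?T = "euclidean :: cantor topology"
  assume "fsigma_in ?T P_inf"
  then obtain \<U> where U: "countable \<U>" "\<U> \<subseteq> Collect (closedin ?T)" "\<Union>\<U> = P_inf"
    unfolding fsigma_in_def union_of_def by (elim exE conjE)
  let ?G = "\<U> \<union> (\<lambda>s. {s}) ` P_fin"
  have "?T interior_of \<Union>?G = {}"
  proof (rule Baire_category_alt)
    show "completely_metrizable_space ?T \<or> locally_compact_space ?T \<and> regular_space ?T"
      using polish_space_cantor by (simp add: polish_space_iff)
    show "countable ?G" using U(1) countable_P_fin by simp
    fix D assume D: "D \<in> ?G"
    have int: "open (?T interior_of D)" using openin_interior_of[of ?T D] by simp
    have sub: "?T interior_of D \<subseteq> D" by (rule interior_of_subset)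
    show "closedin ?T D \<and> ?T interior_of D = {}"
    proof (cases "D \<in> \<U>")
      case True
      then have "D \<inter> P_fin = {}" using U(3) by (auto simp: P_fin_def)
      then show ?thesis using open_meets_P_fin_and_P_inf(1)[OF int] sub True U(2) by blast
    next
      case False
      then obtain s where s: "s \<in> P_fin" "D = {s}" using D by blast
      then have "D \<inter> P_inf = {}" by (simp add: P_fin_def)
      moreover have "closedin ?T D"
      proof -
        have "t1_space ?T"
          using polish_space_cantor completely_metrizable_imp_metrizable_space
            metrizable_imp_Hausdorff_space Hausdorff_imp_t1_space unfolding polish_space_iff by blast
        then show ?thesis using closedin_t1_singleton[of ?T s] s(2) by simp
      qed
      ultimately show ?thesis using open_meets_P_fin_and_P_inf(2)[OF int] sub by blast
    qed
  qed
  moreover have "\<Union>?G = UNIV" using U(3) by (auto simp: P_fin_def)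
  ultimately show False by simp
qed

lemma good_not_in_class: "good \<Gamma> C \<Longrightarrow> \<not> in_class \<Gamma> (euclidean :: cantor topology) C"
  using not_fsigma_P_inf
  by (cases \<Gamma>) (simp_all add: gdelta_in_fsigma_in P_fin_def Compl_eq_Diff_UNIV double_diff)

section \<open>Separation by F-sigma sets\<close>

definition fsigma_separable :: "'b topology \<Rightarrow> 'b set \<Rightarrow> 'b set \<Rightarrow> bool" where
  "fsigma_separable T A B \<longleftrightarrow> (\<exists>F. fsigma_in T F \<and> A \<subseteq> F \<and> F \<inter> B = {})"

lemma fsigma_separableI: "fsigma_in T F \<Longrightarrow> A \<subseteq> F \<Longrightarrow> F \<inter> B = {} \<Longrightarrow> fsigma_separable T A B"
  by (auto simp: fsigma_separable_def)

lemma fsigma_separable_subset: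
  "fsigma_separable T A B \<Longrightarrow> A' \<subseteq> A \<Longrightarrow> fsigma_separable T A' B"
  unfolding fsigma_separable_def by (elim exE conjE, rule exI, intro conjI, assumption) auto

lemma fsigma_separable_Union:
  assumes "countable \<A>" "\<And>A. A \<in> \<A> \<Longrightarrow> fsigma_separable T A B"
  shows "fsigma_separable T (\<Union>\<A>) B"
proof -
  have "\<forall>A\<in>\<A>. \<exists>F. fsigma_in T F \<and> A \<subseteq> F \<and> F \<inter> B = {}"
    using assms(2) by (simp add: fsigma_separable_def)
  then obtain F where F: "\<forall>A\<in>\<A>. fsigma_in T (F A) \<and> A \<subseteq> F A \<and> F A \<inter> B = {}" by metis
  show ?thesis
  proof (rule fsigma_separableI)
    show "fsigma_in T (\<Union>(F ` \<A>))" using assms(1) F by (intro fsigma_in_Union) auto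
    show "\<Union>\<A> \<subseteq> \<Union>(F ` \<A>)" using F by (intro Union_least) blast
    show "\<Union>(F ` \<A>) \<inter> B = {}" using F by blast
  qed
qed

text \<open>A countable union on this side would fail, as intersections of countably many F-sigma sets need not be
F-sigma.\<close>

lemma fsigma_separable_finite_Union_right:
  assumes "finite I" "A \<subseteq> topspace T" "\<And>i. i \<in> I \<Longrightarrow> fsigma_separable T A (B i)"
  shows "fsigma_separable T A (\<Union>i\<in>I. B i)"
  using assms(1,3)
proof (induction I rule: finite_induct)
  case empty
  then show ?case by (intro fsigma_separableI[OF fsigma_in_topspace assms(2)]) simp
next
  case (insert i I)
  have "fsigma_separable T A (\<Union>i\<in>I. B i)" using insert by simp
  then obtain F where F: "fsigma_in T F" "A \<subseteq> F" "F \<inter> (\<Union>i\<in>I. B i) = {}"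
    unfolding fsigma_separable_def by blast
  have "fsigma_separable T A (B i)" using insert.prems by simp
  then obtain G where G: "fsigma_in T G" "A \<subseteq> G" "G \<inter> B i = {}"
    unfolding fsigma_separable_def by blast
  show ?case
    by (rule fsigma_separableI[OF fsigma_in_Int[OF F(1) G(1)]]) (use F G in auto)
qed

lemma fsigma_sections_separable:
  assumes X: "Hausdorff_space X" and A: "A \<subseteq> topspace X \<times> topspace X" "A \<inter> B = {}"
    and sec: "\<And>x. x \<in> topspace X \<Longrightarrow> fsigma_in X {y. (x, y) \<in> A}"
      "\<And>y. y \<in> topspace X \<Longrightarrow> fsigma_in X {x. (x, y) \<in> A}"
  shows "fsigma_separable (prod_topology X X) {p \<in> A. fst p = x} B"
    and "fsigma_separable (prod_topology X X) {p \<in> A. snd p = x} B"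
proof -
  let ?XX = "prod_topology X X"
  have pre: "fsigma_in ?XX {p \<in> topspace ?XX. fst p \<in> F}" "fsigma_in ?XX {p \<in> topspace ?XX. snd p \<in> F}"
    if "fsigma_in X F" for F
    using fsigma_in_preimage[OF continuous_map_fst that] fsigma_in_preimage[OF continuous_map_snd that] by auto
  have sing: "fsigma_in X {x}" if "x \<in> topspace X" for x
    using that closedin_t1_singleton[OF Hausdorff_imp_t1_space[OF X]] closed_imp_fsigma_in by blast
  show "fsigma_separable ?XX {p \<in> A. fst p = x} B"
  proof (cases "x \<in> topspace X")
    case True
    have "fsigma_in ?XX ({p \<in> topspace ?XX. fst p \<in> {x}} \<inter> {p \<in> topspace ?XX. snd p \<in> {y. (x, y) \<in> A}})"
      by (rule fsigma_in_Int[OF pre(1)[OF sing[OF True]] pre(2)[OF sec(1)[OF True]]])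
    then show ?thesis by (rule fsigma_separableI) (use A in auto)
  next
    case False
    then show ?thesis by (intro fsigma_separableI[OF fsigma_in_empty]) (use A in auto)
  qed
  show "fsigma_separable ?XX {p \<in> A. snd p = x} B"
  proof (cases "x \<in> topspace X")
    case True
    have "fsigma_in ?XX ({p \<in> topspace ?XX. snd p \<in> {x}} \<inter> {p \<in> topspace ?XX. fst p \<in> {y. (y, x) \<in> A}})"
      by (rule fsigma_in_Int[OF pre(2)[OF sing[OF True]] pre(1)[OF sec(2)[OF True]]])
    then show ?thesis by (rule fsigma_separableI) (use A in auto)
  next
    case False
    then show ?thesis by (intro fsigma_separableI[OF fsigma_in_empty]) (use A in auto)
  qed
qed

section \<open>Embedding a pair of inseparable sets\<close>

text \<open>The closed set \<open>D\<close> confines the values: on \<open>P\<^sub>f\<close> they are limits of points of \<open>D\<close>. It will be the diagonal or a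
product of two disjoint balls.\<close>

lemma cantor_embedding:
  fixes Z :: "'z topology" and X :: "'a topology"
  assumes X: "metrizable_space X" and Z: "polish_space Z" "topspace Z \<noteq> {}"
    and h: "\<And>\<epsilon> :: bool. continuous_map Z X (h \<epsilon>)"
    and D: "closedin (prod_topology X X) D" "\<And>z. z \<in> topspace Z \<Longrightarrow> (h False z, h True z) \<in> D"
    and B: "B \<subseteq> topspace X \<times> topspace X"
    and inseparable: "\<And>V. openin Z V \<Longrightarrow> V \<noteq> {} \<Longrightarrow>
      \<not> fsigma_separable (prod_topology X X) ((\<lambda>z. (h False z, h True z)) ` V) B"
    and nonconst: "\<And>V x \<epsilon>. openin Z V \<Longrightarrow> V \<noteq> {} \<Longrightarrow> \<exists>z\<in>V. h \<epsilon> z \<noteq> x"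
    and S: "analytic_set_in (prod_topology X X) S" "\<And>x. countable {y. (x, y) \<in> S}" "sym S"
  obtains f where "\<And>\<epsilon>. continuous_map euclidean X (f \<epsilon>)" "\<And>\<epsilon>. inj (f \<epsilon>)"
    "\<And>\<alpha>. \<alpha> \<in> P_fin \<Longrightarrow> (f False \<alpha>, f True \<alpha>) \<in> B \<inter> D"
    "\<And>\<alpha>. \<alpha> \<in> P_inf \<Longrightarrow> \<exists>z\<in>topspace Z. \<forall>\<epsilon>. f \<epsilon> \<alpha> = h \<epsilon> z"
    "\<And>\<alpha> \<beta> \<epsilon> \<eta>. \<alpha> \<noteq> \<beta> \<Longrightarrow> (f \<epsilon> \<alpha>, f \<eta> \<beta>) \<in> S \<Longrightarrow> \<alpha> \<in> P_fin \<and> \<beta> \<in> P_fin"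
proof -
  let ?T = "\<lambda>\<epsilon>. {(z, y). z \<in> topspace Z \<and> (h \<epsilon> z, y) \<in> S}"
  have S': "countable {x. (x, y) \<in> S}" for y
  proof -
    have "{x. (x, y) \<in> S} = {x. (y, x) \<in> S}" using S(3) by (auto dest: symD)
    then show ?thesis using S(2) by simp
  qed
  have "thin_covered Z X (?T \<epsilon>)" for \<epsilon>
    by (rule thin_covered_relation[OF X Z(1) h S(1,2) S' nonconst])
  then have T: "thin_covered Z X (\<Union>(range ?T))" by (intro thin_covered_Union) auto
  obtain F where F: "incseq F" "\<And>n. thin Z X (F n)" "\<Union>(range ?T) \<subseteq> (\<Union>n. F n)"
    by (rule thin_covered_incseq[OF T], rule that) assumption+
  obtain MZ dZ where MZ: "Metric_space MZ dZ" "Metric_space.mcomplete MZ dZ" "Z = Metric_space.mtopology MZ dZ"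
    using Z(1) unfolding polish_space_iff completely_metrizable_space_def by blast
  obtain MX dX where MX: "Metric_space MX dX" "X = Metric_space.mtopology MX dX"
    using X unfolding metrizable_space_def by blast
  have top: "topspace Z = MZ" "topspace X = MX"
    using MZ MX by (simp_all add: Metric_space.topspace_mtopology)
  define B' where "B' = {b :: bool \<Rightarrow> 'a. (b False, b True) \<in> B \<inter> D}"
  have B'X: "b \<epsilon> \<in> topspace X" if "b \<in> B'" for b \<epsilon>
    using that B by (cases \<epsilon>) (auto simp: B'_def)
  have adherent: "\<exists>b\<in>B'. \<forall>r>0. \<exists>z\<in>V. \<forall>\<epsilon>. dX (b \<epsilon>) (h \<epsilon> z) < r" if V: "openin Z V" "V \<noteq> {}" for V
  proof -
    let ?I = "(\<lambda>z. (h False z, h True z)) ` V"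
    let ?K = "prod_topology X X closure_of ?I"
    have VZ: "V \<subseteq> topspace Z" using openin_subset[OF V(1)] .
    have hX: "h \<epsilon> z \<in> topspace X" if "z \<in> V" for \<epsilon> z
      using continuous_map_image_subset_topspace[OF h[of \<epsilon>]] VZ that by auto
    have "?I \<subseteq> ?K" using hX by (intro closure_of_subset) auto
    then have "?K \<inter> B \<noteq> {}"
      using inseparable[OF V] fsigma_separableI[OF closed_imp_fsigma_in[OF closedin_closure_of]] by blast
    then obtain x y where xy: "(x, y) \<in> ?K" "(x, y) \<in> B" by auto
    have "?K \<subseteq> D" by (rule closure_of_minimal[OF _ D(1)]) (use D(2) VZ in auto)
    then have b: "case_bool y x \<in> B'" using xy by (auto simp: B'_def)
    have "\<exists>z\<in>V. \<forall>\<epsilon>. dX (case_bool y x \<epsilon>) (h \<epsilon> z) < r" if r: "r > 0" for r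
    proof -
      let ?N = "Metric_space.mball MX dX x r \<times> Metric_space.mball MX dX y r"
      have o: "openin (prod_topology X X) ?N"
        using Metric_space.openin_mball[OF MX(1)] MX(2) by (simp add: openin_prod_Times_iff)
      have "x \<in> MX" "y \<in> MX" using xy(2) B top(2) by auto
      then have c: "(x, y) \<in> ?N"
        using r by (simp add: Metric_space.centre_in_mball_iff[OF MX(1)])
      have "\<forall>T. (x, y) \<in> T \<and> openin (prod_topology X X) T \<longrightarrow> (\<exists>p. p \<in> ?I \<and> p \<in> T)"
        using xy(1) unfolding in_closure_of by (elim conjE)
      from this[THEN spec, of ?N, THEN mp, OF conjI[OF c o]]
      obtain p where p: "p \<in> ?I" "p \<in> ?N" by (elim exE conjE)
      from p(1) obtain z where pz: "p = (h False z, h True z)" "z \<in> V" by (rule imageE)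
      have z: "z \<in> V" "h False z \<in> Metric_space.mball MX dX x r" "h True z \<in> Metric_space.mball MX dX y r"
        using p(2) pz by simp_all
      have "dX (case_bool y x \<epsilon>) (h \<epsilon> z) < r" for \<epsilon>
        using z(2,3) by (cases \<epsilon>) (simp_all add: Metric_space.in_mball[OF MX(1)])
      then show ?thesis using z(1) by blast
    qed
    then show ?thesis using b by blast
  qed
  interpret cantor_scheme MZ dZ MX dX h B' F
  proof (intro cantor_scheme.intro cantor_scheme_axioms.intro MZ(1,2) MX(1) F(1))
    show "MZ \<noteq> {}" using Z(2) top by simp
    show "continuous_map (Metric_space.mtopology MZ dZ) (Metric_space.mtopology MX dX) (h \<epsilon>)" for \<epsilon>
      using h MZ(3) MX(2) by simp
    show "b \<epsilon> \<in> MX" if "b \<in> B'" for b \<epsilon> using B'X[OF that] top by simp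
    show "\<exists>b\<in>B'. \<forall>r>0. \<exists>z\<in>V. \<forall>\<epsilon>. dX (b \<epsilon>) (h \<epsilon> z) < r"
      if "openin (Metric_space.mtopology MZ dZ) V" "V \<noteq> {}" for V
      using adherent that MZ(3) by simp
    show "\<exists>z\<in>V. h \<epsilon> z \<noteq> x" if "openin (Metric_space.mtopology MZ dZ) V" "V \<noteq> {}" for V \<epsilon> x
      using nonconst that MZ(3) by simp
    show "thin (Metric_space.mtopology MZ dZ) (Metric_space.mtopology MX dX) (F n)" for n
      using F(2) MZ(3) MX(2) by simp
  qed
  obtain f where f: "\<And>\<epsilon>. continuous_map euclidean (Metric_space.mtopology MX dX) (f \<epsilon>)" "\<And>\<epsilon>. inj (f \<epsilon>)"
    "\<And>\<alpha>. \<alpha> \<in> P_fin \<Longrightarrow> (\<lambda>\<epsilon>. f \<epsilon> \<alpha>) \<in> B'"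
    "\<And>\<alpha>. \<alpha> \<in> P_inf \<Longrightarrow> \<exists>z\<in>MZ. (\<forall>\<epsilon>. f \<epsilon> \<alpha> = h \<epsilon> z) \<and> (\<forall>\<beta> \<eta> n. \<beta> \<noteq> \<alpha> \<longrightarrow> (z, f \<eta> \<beta>) \<notin> F n)"
    by (rule embedding, rule that) assumption+
  have sep: "(f \<epsilon> \<alpha>, f \<eta> \<beta>) \<notin> S" if ab: "\<alpha> \<in> P_inf" "\<beta> \<noteq> \<alpha>" for \<alpha> \<beta> \<epsilon> \<eta>
  proof
    assume *: "(f \<epsilon> \<alpha>, f \<eta> \<beta>) \<in> S"
    obtain z where z: "z \<in> MZ" "\<forall>\<epsilon>. f \<epsilon> \<alpha> = h \<epsilon> z" "\<forall>\<beta> \<eta> n. \<beta> \<noteq> \<alpha> \<longrightarrow> (z, f \<eta> \<beta>) \<notin> F n"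
      using f(4)[OF ab(1)] by blast
    have "(z, f \<eta> \<beta>) \<in> ?T \<epsilon>" using z(1,2) * top by simp
    then have "(z, f \<eta> \<beta>) \<in> (\<Union>n. F n)" using F(3) by blast
    then show False using z(3) ab(2) by blast
  qed
  show thesis
  proof
    show "continuous_map euclidean X (f \<epsilon>)" for \<epsilon> using f(1) MX(2) by simp
    show "inj (f \<epsilon>)" for \<epsilon> by (rule f(2))
    show "(f False \<alpha>, f True \<alpha>) \<in> B \<inter> D" if "\<alpha> \<in> P_fin" for \<alpha> using f(3)[OF that] by (simp add: B'_def)
    show "\<exists>z\<in>topspace Z. \<forall>\<epsilon>. f \<epsilon> \<alpha> = h \<epsilon> z" if "\<alpha> \<in> P_inf" for \<alpha> using f(4)[OF that] top by blast
    fix \<alpha> \<beta> \<epsilon> \<eta> assume ab: "\<alpha> \<noteq> \<beta>" "(f \<epsilon> \<alpha>, f \<eta> \<beta>) \<in> S"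
    then have "(f \<eta> \<beta>, f \<epsilon> \<alpha>) \<in> S" using S(3) by (simp add: symD)
    then show "\<alpha> \<in> P_fin \<and> \<beta> \<in> P_fin" using sep ab by (auto simp: P_fin_def)
  qed
qed

text \<open>Inseparability forces the fibres of both coordinates to have empty interior, since the
sections of \<open>A\<close> are separable from \<open>B\<close>.\<close>

lemma pair_embedding:
  fixes X :: "'a topology"
  assumes X: "metrizable_space X"
    and A: "analytic_set_in (prod_topology X X) A" and B: "B \<subseteq> topspace X \<times> topspace X"
    and inseparable: "\<not> fsigma_separable (prod_topology X X) A B"
    and sections: "\<And>x. fsigma_separable (prod_topology X X) {p \<in> A. fst p = x} B"
      "\<And>x. fsigma_separable (prod_topology X X) {p \<in> A. snd p = x} B"
    and S: "analytic_set_in (prod_topology X X) S" "\<And>x. countable {y. (x, y) \<in> S}" "sym S"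
  obtains f where "\<And>\<epsilon> :: bool. continuous_map euclidean X (f \<epsilon>)" "\<And>\<epsilon>. inj (f \<epsilon>)"
    "\<And>\<alpha>. \<alpha> \<in> P_fin \<Longrightarrow> (f False \<alpha>, f True \<alpha>) \<in> B"
    "\<And>\<alpha>. \<alpha> \<in> P_inf \<Longrightarrow> (f False \<alpha>, f True \<alpha>) \<in> A"
    "\<And>\<alpha> \<beta> \<epsilon> \<eta>. \<alpha> \<noteq> \<beta> \<Longrightarrow> (f \<epsilon> \<alpha>, f \<eta> \<beta>) \<in> S \<Longrightarrow> \<alpha> \<in> P_fin \<and> \<beta> \<in> P_fin"
    "f False = f True \<or> (\<forall>\<alpha> \<beta>. f False \<alpha> \<noteq> f True \<beta>)"
proof -
  note conclude = that
  let ?XX = "prod_topology X X"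
  have Haus: "Hausdorff_space X" using X by (rule metrizable_imp_Hausdorff_space)
  obtain Z :: "(nat \<Rightarrow> real) topology" and g where
    Z: "polish_space Z" "continuous_map Z ?XX g" "g ` topspace Z = A"
    using A by (auto simp: analytic_set_in_def)
  have sc: "second_countable Z" using Z(1) by (simp add: polish_space_iff)
  have "\<exists>C. closedin Z C \<and> C \<noteq> {} \<and> (\<forall>V. openin (subtopology Z C) V \<and> V \<noteq> {} \<longrightarrow>
      \<not> fsigma_separable ?XX (g ` V) B)"
  proof (rule exists_closed_nowhere_small_image[OF sc])
    show "\<not> fsigma_separable ?XX (g ` topspace Z) B" using inseparable Z(3) by simp
  qed (fact fsigma_separable_subset fsigma_separable_Union)+
  then obtain C where C: "closedin Z C" "C \<noteq> {}"
    "\<forall>V. openin (subtopology Z C) V \<and> V \<noteq> {} \<longrightarrow> \<not> fsigma_separable ?XX (g ` V) B"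
    by (elim exE conjE)
  define Z' where "Z' = subtopology Z C"
  have topZ': "topspace Z' = C" using closedin_subset[OF C(1)] by (auto simp: Z'_def)
  have pZ': "polish_space Z'" unfolding Z'_def by (rule polish_space_closedin[OF Z(1) C(1)])
  have gZ': "continuous_map Z' ?XX g" unfolding Z'_def by (rule continuous_map_from_subtopology[OF Z(2)])
  have gA: "g z \<in> A" if "z \<in> C" for z using that closedin_subset[OF C(1)] Z(3) by auto
  define h where "h \<epsilon> z = (if \<epsilon> then snd (g z) else fst (g z))" for \<epsilon> z
  have hg: "(h False z, h True z) = g z" for z by (simp add: h_def)
  have main: thesis
    if W: "openin Z' W" "W \<noteq> {}" and D: "closedin ?XX D" "g ` W \<subseteq> D"
      and D_cases: "D \<subseteq> Id \<or> (\<exists>K K'. D \<subseteq> K \<times> K' \<and> K \<inter> K' = {})" for W D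
  proof -
    have WC: "W \<subseteq> C" using openin_subset[OF W(1)] topZ' by simp
    let ?Z = "subtopology Z' W"
    have topW: "topspace ?Z = W" using WC topZ' by auto
    have open_W: "openin Z' V" if "openin ?Z V" for V
      using that W(1) by (simp add: openin_open_subtopology)
    have gW: "continuous_map ?Z ?XX g" by (rule continuous_map_from_subtopology[OF gZ'])
    have pW: "polish_space ?Z" by (rule polish_space_openin[OF pZ' W(1)])
    have neW: "topspace ?Z \<noteq> {}" using topW W(2) by simp
    have hc: "continuous_map ?Z X (h \<epsilon>)" for \<epsilon>
      using continuous_map_compose[OF gW continuous_map_fst] continuous_map_compose[OF gW continuous_map_snd]
      by (cases \<epsilon>) (simp_all add: h_def[abs_def] o_def)
    have insep: "\<not> fsigma_separable ?XX (g ` V) B" if "openin ?Z V" "V \<noteq> {}" for V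
      using C(3) open_W[OF that(1)] that(2) by (simp add: Z'_def)
    have nonconst: "\<exists>z\<in>V. h \<epsilon> z \<noteq> x" if V: "openin ?Z V" "V \<noteq> {}" for V x \<epsilon>
    proof (rule ccontr)
      assume "\<not> ?thesis"
      then have const: "\<forall>z\<in>V. h \<epsilon> z = x" by blast
      have VC: "V \<subseteq> C" using openin_subset[OF V(1)] topW WC by auto
      have "g ` V \<subseteq> {p \<in> A. fst p = x} \<or> g ` V \<subseteq> {p \<in> A. snd p = x}"
        using const VC gA by (cases \<epsilon>) (auto simp: h_def)
      then have "fsigma_separable ?XX (g ` V) B"
        using fsigma_separable_subset sections by blast
      then show False using insep[OF V] by simp
    qed
    have hD: "(h False z, h True z) \<in> D" if "z \<in> topspace ?Z" for z
      using that D(2) topW hg by auto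
    have insep': "\<not> fsigma_separable ?XX ((\<lambda>z. (h False z, h True z)) ` V) B" if "openin ?Z V" "V \<noteq> {}" for V
      using insep[OF that] hg by simp
    obtain f where f: "\<And>\<epsilon>. continuous_map euclidean X (f \<epsilon>)" "\<And>\<epsilon>. inj (f \<epsilon>)"
      "\<And>\<alpha>. \<alpha> \<in> P_fin \<Longrightarrow> (f False \<alpha>, f True \<alpha>) \<in> B \<inter> D"
      "\<And>\<alpha>. \<alpha> \<in> P_inf \<Longrightarrow> \<exists>z\<in>topspace ?Z. \<forall>\<epsilon>. f \<epsilon> \<alpha> = h \<epsilon> z"
      "\<And>\<alpha> \<beta> \<epsilon> \<eta>. \<alpha> \<noteq> \<beta> \<Longrightarrow> (f \<epsilon> \<alpha>, f \<eta> \<beta>) \<in> S \<Longrightarrow> \<alpha> \<in> P_fin \<and> \<beta> \<in> P_fin"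
      by (rule cantor_embedding[OF X pW neW hc D(1) hD B insep' nonconst S], assumption+, rule that) assumption+
    have inf: "(f False \<alpha>, f True \<alpha>) \<in> A \<inter> D" if "\<alpha> \<in> P_inf" for \<alpha>
    proof -
      obtain z where "z \<in> W" "\<forall>\<epsilon>. f \<epsilon> \<alpha> = h \<epsilon> z" using f(4)[OF \<open>\<alpha> \<in> P_inf\<close>] topW by blast
      then have "(f False \<alpha>, f True \<alpha>) = g z" "z \<in> W" using hg by auto
      then show ?thesis using D(2) gA WC by auto
    qed
    have inD: "(f False \<alpha>, f True \<alpha>) \<in> D" for \<alpha>
      using f(3)[of \<alpha>] inf[of \<alpha>] by (cases "\<alpha> \<in> P_inf") (auto simp: P_fin_def)
    show thesis
    proof (rule conclude[of f])
      show "f False = f True \<or> (\<forall>\<alpha> \<beta>. f False \<alpha> \<noteq> f True \<beta>)"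
        using D_cases
      proof
        assume "D \<subseteq> Id"
        then have "f False \<alpha> = f True \<alpha>" for \<alpha> using inD[of \<alpha>] by auto
        then show ?thesis by blast
      next
        assume "\<exists>K K'. D \<subseteq> K \<times> K' \<and> K \<inter> K' = {}"
        then obtain K K' where K: "D \<subseteq> K \<times> K'" "K \<inter> K' = {}" by blast
        have "f False \<alpha> \<in> K" "f True \<alpha> \<in> K'" for \<alpha> using inD[of \<alpha>] K(1) by auto
        then have "f False \<alpha> \<noteq> f True \<beta>" for \<alpha> \<beta> using K(2) by (metis IntI empty_iff)
        then show ?thesis by blast
      qed
      show "continuous_map euclidean X (f \<epsilon>)" for \<epsilon> by (rule f(1))
      show "inj (f \<epsilon>)" for \<epsilon> by (rule f(2))
      show "(f False \<alpha>, f True \<alpha>) \<in> B" if "\<alpha> \<in> P_fin" for \<alpha> using f(3)[OF that] by simp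
      show "(f False \<alpha>, f True \<alpha>) \<in> A" if "\<alpha> \<in> P_inf" for \<alpha> using inf[OF that] by simp
      show "\<alpha> \<in> P_fin \<and> \<beta> \<in> P_fin" if "\<alpha> \<noteq> \<beta>" "(f \<epsilon> \<alpha>, f \<eta> \<beta>) \<in> S" for \<alpha> \<beta> \<epsilon> \<eta>
        using that by (rule f(5))
    qed
  qed
  show thesis
  proof (cases "\<forall>z\<in>C. fst (g z) = snd (g z)")
    case True
    have gX: "g ` C \<subseteq> topspace ?XX"
      using continuous_map_image_subset_topspace[OF gZ'] topZ' by simp
    show thesis
    proof (rule main[of C "(\<lambda>x. (x, x)) ` topspace X"])
      show "closedin ?XX ((\<lambda>x. (x, x)) ` topspace X)"
        using Haus by (simp add: Hausdorff_space_closedin_diagonal)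
      show "g ` C \<subseteq> (\<lambda>x. (x, x)) ` topspace X"
      proof
        fix p assume p: "p \<in> g ` C"
        then have "p = (fst p, fst p)" "fst p \<in> topspace X" using True gX by (auto simp: prod_eq_iff)
        then show "p \<in> (\<lambda>x. (x, x)) ` topspace X" by (rule image_eqI)
      qed
      show "openin Z' C" using openin_topspace[of Z'] topZ' by simp
      show "C \<noteq> {}" by (rule C(2))
      show "(\<lambda>x. (x, x)) ` topspace X \<subseteq> Id \<or>
          (\<exists>K K'. (\<lambda>x. (x, x)) ` topspace X \<subseteq> K \<times> K' \<and> K \<inter> K' = {})"
        by (rule disjI1) auto
    qed
  next
    case False
    then obtain z where z: "z \<in> C" "fst (g z) \<noteq> snd (g z)" by blast
    obtain M d where M: "Metric_space M d" and Xd: "X = Metric_space.mtopology M d"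
      using X unfolding metrizable_space_def by blast
    interpret Metric_space M d by (rule M)
    define x y where "x = fst (g z)" and "y = snd (g z)"
    have "g z \<in> topspace ?XX"
      using continuous_map_image_subset_topspace[OF gZ'] topZ' z(1) by blast
    then have xy: "x \<in> M" "y \<in> M" "x \<noteq> y" using z(2) by (auto simp: x_def y_def Xd mem_Times_iff)
    \<comment> \<open>A third, so that even the closed balls of this radius are disjoint.\<close>
    define r where "r = d x y / 3"
    have r: "r > 0" using xy by (simp add: r_def)
    let ?N = "mball x r \<times> mball y r" and ?K = "mcball x r \<times> mcball y r"
    let ?W = "{w \<in> topspace Z'. g w \<in> ?N}"
    show thesis
    proof (rule main[of ?W ?K])
      have "openin ?XX ?N" by (simp add: openin_prod_Times_iff Xd)
      then show "openin Z' ?W" by (rule openin_continuous_map_preimage[OF gZ'])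
      have "g z \<in> ?N" using xy r by (simp add: x_def y_def mem_Times_iff)
      then have "z \<in> ?W" using z(1) topZ' by simp
      then show "?W \<noteq> {}" by (metis emptyE)
      show "closedin ?XX ?K" by (simp add: closedin_prod_Times_iff Xd)
      have "?N \<subseteq> ?K" by auto
      moreover have "g ` ?W \<subseteq> ?N" by (rule image_subsetI) (simp only: mem_Collect_eq)
      ultimately show "g ` ?W \<subseteq> ?K" by (rule order_trans[rotated])
      have "mcball x r \<inter> mcball y r = {}"
      proof (rule ccontr)
        assume "mcball x r \<inter> mcball y r \<noteq> {}"
        then obtain w where w: "w \<in> M" "d x w \<le> r" "d y w \<le> r" by auto
        have "d x y \<le> d x w + d w y" using xy w by (intro triangle)
        then show False using w commute[of w y] r by (simp add: r_def)
      qed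
      then show "?K \<subseteq> Id \<or> (\<exists>K K'. ?K \<subseteq> K \<times> K' \<and> K \<inter> K' = {})"
        by (intro disjI2 exI[of _ "mcball x r"] exI[of _ "mcball y r"]) simp
    qed
  qed
qed

section \<open>Patterns of membership\<close>

definition coord :: "'a \<times> 'a \<Rightarrow> bool \<Rightarrow> 'a" where
  "coord p \<epsilon> = (if \<epsilon> then snd p else fst p)"

text \<open>For a point \<open>(f False \<alpha>, f True \<alpha>)\<close> of the square, the pattern tells to which of the four sets \<open>E \<epsilon> \<eta>\<close> the
sequence \<open>\<alpha>\<close> belongs.\<close>

definition pattern :: "('a \<times> 'a) set \<Rightarrow> 'a \<times> 'a \<Rightarrow> bool \<Rightarrow> bool \<Rightarrow> bool" where
  "pattern R p \<epsilon> \<eta> \<longleftrightarrow> (coord p \<epsilon>, coord p \<eta>) \<in> R"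

lemma borel_pattern:
  assumes R: "borel_set_in (prod_topology X X) R" and A: "borel_set_in (prod_topology X X) A"
  shows "borel_set_in (prod_topology X X) {p \<in> A. pattern R p = \<tau>}"
proof -
  let ?XX = "prod_topology X X"
  interpret sigma_algebra "topspace ?XX" "{A. borel_set_in ?XX A}" by (rule borel_set_in_sigma_algebra)
  define P where "P \<epsilon> \<eta> = {p \<in> topspace ?XX. pattern R p \<epsilon> \<eta> = \<tau> \<epsilon> \<eta>}" for \<epsilon> \<eta>
  have "borel_set_in ?XX (P \<epsilon> \<eta>)" for \<epsilon> \<eta>
  proof -
    have c: "continuous_map ?XX X (\<lambda>p. coord p \<epsilon>)" for \<epsilon>
      by (cases \<epsilon>) (simp_all add: coord_def continuous_map_fst continuous_map_snd)
    have 1: "{p \<in> topspace ?XX. pattern R p \<epsilon> \<eta>} \<in> {A. borel_set_in ?XX A}"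
      using borel_set_in_preimage[OF continuous_map_pairedI[OF c c] R] by (simp add: pattern_def)
    show ?thesis
    proof (cases "\<tau> \<epsilon> \<eta>")
      case True
      then show ?thesis using 1 by (simp add: P_def)
    next
      case False
      then have "P \<epsilon> \<eta> = topspace ?XX - {p \<in> topspace ?XX. pattern R p \<epsilon> \<eta>}" by (auto simp: P_def)
      then show ?thesis using compl_sets[OF 1] by simp
    qed
  qed
  then have "A \<inter> (P False False \<inter> P False True \<inter> (P True False \<inter> P True True)) \<in> {A. borel_set_in ?XX A}"
    using A by (intro Int) auto
  moreover have "{p \<in> A. pattern R p = \<tau>} = A \<inter> (P False False \<inter> P False True \<inter> (P True False \<inter> P True True))"
  proof -
    have "A \<subseteq> topspace ?XX" using A sets_into_space by auto
    moreover have "pattern R p = \<tau> \<longleftrightarrow> (\<forall>\<epsilon> \<eta>. pattern R p \<epsilon> \<eta> = \<tau> \<epsilon> \<eta>)" for p by (auto simp: fun_eq_iff)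
    ultimately show ?thesis by (auto simp: P_def all_bool_eq)
  qed
  ultimately show ?thesis by simp
qed

text \<open>There are finitely many patterns, so separating all pairs of pieces would separate \<open>A\<close> from \<open>B\<close>.\<close>

lemma fsigma_separable_patterns:
  fixes R :: "('a \<times> 'a) set"
  assumes AB: "A \<subseteq> topspace T" and not: "\<not> fsigma_separable T A B"
  obtains \<tau> \<tau>' where "\<not> fsigma_separable T {p \<in> A. pattern R p = \<tau>} {p \<in> B. pattern R p = \<tau>'}"
proof -
  have "\<exists>\<tau> \<tau>'. \<not> fsigma_separable T {p \<in> A. pattern R p = \<tau>} {p \<in> B. pattern R p = \<tau>'}"
  proof (rule ccontr)
    assume "\<not> ?thesis"
    then have *: "fsigma_separable T {p \<in> A. pattern R p = \<tau>} {p \<in> B. pattern R p = \<tau>'}" for \<tau> \<tau>' by blast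
    have "fsigma_separable T {p \<in> A. pattern R p = \<tau>} (\<Union>\<tau>'\<in>UNIV. {p \<in> B. pattern R p = \<tau>'})" for \<tau>
      by (rule fsigma_separable_finite_Union_right) (use AB * in auto)
    moreover have "(\<Union>\<tau>'\<in>UNIV. {p \<in> B. pattern R p = \<tau>'}) = B" by auto
    ultimately have "fsigma_separable T {p \<in> A. pattern R p = \<tau>} B" for \<tau> by simp
    then have "fsigma_separable T (\<Union>(range (\<lambda>\<tau>. {p \<in> A. pattern R p = \<tau>}))) B"
      by (intro fsigma_separable_Union) (auto intro: countable_finite)
    moreover have "\<Union>(range (\<lambda>\<tau>. {p \<in> A. pattern R p = \<tau>})) = A" by auto
    ultimately show False using not by simp
  qed
  then show thesis using that by blast
qed

section \<open>The dichotomy\<close>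

lemma reducible_not_in_class:
  assumes "good \<Gamma> C" "continuous_map euclidean X f" "continuous_map euclidean X f'"
    "\<And>\<alpha> :: cantor. (f \<alpha>, f' \<alpha>) \<in> R \<longleftrightarrow> \<alpha> \<in> C"
  shows "\<not> in_class \<Gamma> (prod_topology X X) R"
proof
  assume R: "in_class \<Gamma> (prod_topology X X) R"
  have "continuous_map euclidean (prod_topology X X) (\<lambda>\<alpha>. (f \<alpha>, f' \<alpha>))"
    by (rule continuous_map_pairedI[OF assms(2,3)])
  from in_class_preimage[OF this R] have "in_class \<Gamma> (euclidean :: cantor topology) C"
    using assms(4) by simp
  then show False using good_not_in_class[OF assms(1)] by simp
qed

text \<open>For the class of F-sigma sets \<open>A\<close> is \<open>R\<close>, otherwise it is the complement of \<open>R\<close>. In both cases the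
sections of \<open>A\<close> are F-sigma and \<open>P\<^sub>\<infinity>\<close> is mapped into \<open>A\<close>, so that \<open>C\<close> is exactly the set mapped into \<open>R\<close>.\<close>

lemma not_in_class_embedding:
  fixes X :: "'a topology"
  assumes good: "good \<Gamma> C" and X: "analytic_space X" and R: "R \<subseteq> topspace X \<times> topspace X"
    and lc: "locally_countable X R" and borel: "borel_set_in (prod_topology X X) R"
    and sec: "sections_in_class \<Gamma> X R" and not: "\<not> in_class \<Gamma> (prod_topology X X) R"
  obtains f \<tau> \<tau>' where "\<And>\<epsilon>. continuous_map euclidean X (f \<epsilon>)" "\<And>\<epsilon>. inj (f \<epsilon>)"
    "\<And>\<alpha> \<epsilon> \<eta>. (f \<epsilon> \<alpha>, f \<eta> \<alpha>) \<in> R \<longleftrightarrow> (if \<alpha> \<in> P_inf then \<tau> \<epsilon> \<eta> else \<tau>' \<epsilon> \<eta>)"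
    "\<And>\<alpha>. (f False \<alpha>, f True \<alpha>) \<in> R \<longleftrightarrow> \<alpha> \<in> C"
    "\<And>\<alpha> \<beta> \<epsilon> \<eta>. \<alpha> \<noteq> \<beta> \<Longrightarrow> (f \<epsilon> \<alpha>, f \<eta> \<beta>) \<in> R \<Longrightarrow> \<alpha> \<in> P_fin \<and> \<beta> \<in> P_fin"
    "f False = f True \<or> (\<forall>\<alpha> \<beta>. f False \<alpha> \<noteq> f True \<beta>)"
proof -
  let ?XX = "prod_topology X X"
  have Xm: "metrizable_space X" using X by (simp add: analytic_space_def)
  have Haus: "Hausdorff_space X" using Xm by (rule metrizable_imp_Hausdorff_space)
  have HausXX: "Hausdorff_space ?XX" using Haus by (simp add: Hausdorff_space_prod_topology)
  have top: "topspace ?XX = topspace X \<times> topspace X" by simp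
  have "analytic_set_in X (topspace X)" using X by (rule analytic_space_imp_analytic_topspace)
  from analytic_set_in_Times[OF this this] have anXX: "analytic_set_in ?XX (topspace ?XX)" by simp
  note borel_analytic = borel_set_in_imp_analytic[OF HausXX anXX]
  interpret sigma_algebra "topspace ?XX" "{A. borel_set_in ?XX A}" by (rule borel_set_in_sigma_algebra)
  define A where "A = (if \<Gamma> = Sigma02 then R else topspace ?XX - R)"
  define B where "B = topspace ?XX - A"
  have AX: "A \<subseteq> topspace ?XX" using R by (auto simp: A_def)
  have bA: "borel_set_in ?XX A" using borel compl_sets[of R] by (auto simp: A_def)
  have insep: "\<not> fsigma_separable ?XX A B"
  proof
    assume "fsigma_separable ?XX A B"
    then obtain F where F: "fsigma_in ?XX F" "A \<subseteq> F" "F \<inter> B = {}" by (auto simp: fsigma_separable_def)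
    then have "F = A" using fsigma_in_subset[OF F(1)] by (auto simp: B_def)
    then show False using not F(1) R
      by (cases \<Gamma>) (auto simp: A_def gdelta_in_fsigma_in)
  qed
  have secA: "fsigma_in X {y. (x, y) \<in> A}" "fsigma_in X {y. (y, x) \<in> A}" if x: "x \<in> topspace X" for x
  proof -
    have in_class: "in_class \<Gamma> X {y. (x, y) \<in> R}" "in_class \<Gamma> X {y. (y, x) \<in> R}"
      using sec x by (auto simp: sections_in_class_def section_right_def section_left_def)
    have "{y. (x, y) \<in> topspace ?XX - R} = topspace X - {y. (x, y) \<in> R}"
      "{y. (y, x) \<in> topspace ?XX - R} = topspace X - {y. (y, x) \<in> R}" using x by auto
    then show "fsigma_in X {y. (x, y) \<in> A}" "fsigma_in X {y. (y, x) \<in> A}"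
      using in_class by (cases \<Gamma>; simp add: A_def gdelta_in_fsigma_in)+
  qed
  obtain \<tau> \<tau>' where insep':
    "\<not> fsigma_separable ?XX {p \<in> A. pattern R p = \<tau>} {p \<in> B. pattern R p = \<tau>'}"
    by (rule fsigma_separable_patterns[OF AX insep])
  define A' where "A' = {p \<in> A. pattern R p = \<tau>}"
  define B' where "B' = {p \<in> B. pattern R p = \<tau>'}"
  have sub: "A' \<subseteq> A" "B' \<subseteq> B" by (auto simp: A'_def B'_def)
  have anA': "analytic_set_in ?XX A'" unfolding A'_def by (rule borel_analytic[OF borel_pattern[OF borel bA]])
  have B'X: "B' \<subseteq> topspace X \<times> topspace X" by (auto simp: B'_def B_def)
  have A'X: "A \<subseteq> topspace X \<times> topspace X" "A \<inter> B' = {}" using AX by (auto simp: B'_def B_def)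
  have secA': "fsigma_separable ?XX {p \<in> A'. fst p = x} B'" "fsigma_separable ?XX {p \<in> A'. snd p = x} B'" for x
  proof -
    have "{p \<in> A'. fst p = x} \<subseteq> {p \<in> A. fst p = x}" "{p \<in> A'. snd p = x} \<subseteq> {p \<in> A. snd p = x}"
      using sub by auto
    then show "fsigma_separable ?XX {p \<in> A'. fst p = x} B'" "fsigma_separable ?XX {p \<in> A'. snd p = x} B'"
      using fsigma_sections_separable[OF Haus A'X secA, of x] fsigma_separable_subset by auto
  qed
  \<comment> \<open>The scheme only controls pairs whose first member comes from \<open>P\<^sub>\<infinity>\<close>; symmetry gives the other ones.\<close>
  define S where "S = R \<union> R\<inverse>"
  have "R\<inverse> = {p \<in> topspace ?XX. (snd p, fst p) \<in> R}" using R by auto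
  then have "borel_set_in ?XX (R\<inverse>)"
    using borel_set_in_preimage[OF continuous_map_pairedI[OF continuous_map_snd continuous_map_fst] borel] by simp
  then have anS: "analytic_set_in ?XX S" unfolding S_def using borel Un[of R "R\<inverse>"] by (intro borel_analytic) auto
  have cS: "countable {y. (x, y) \<in> S}" for x
  proof (cases "x \<in> topspace X")
    case True
    have "{y. (x, y) \<in> S} = section_right R x \<union> section_left R x"
      by (auto simp: S_def section_right_def section_left_def)
    then show ?thesis using lc True by (simp add: locally_countable_def)
  next
    case False
    then have "{y. (x, y) \<in> S} = {}" using R by (auto simp: S_def)
    then show ?thesis by simp
  qed
  have symS: "sym S" by (auto simp: S_def sym_def)
  obtain f where f: "\<And>\<epsilon> :: bool. continuous_map euclidean X (f \<epsilon>)" "\<And>\<epsilon>. inj (f \<epsilon>)"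
    "\<And>\<alpha>. \<alpha> \<in> P_fin \<Longrightarrow> (f False \<alpha>, f True \<alpha>) \<in> B'"
    "\<And>\<alpha>. \<alpha> \<in> P_inf \<Longrightarrow> (f False \<alpha>, f True \<alpha>) \<in> A'"
    "\<And>\<alpha> \<beta> \<epsilon> \<eta>. \<alpha> \<noteq> \<beta> \<Longrightarrow> (f \<epsilon> \<alpha>, f \<eta> \<beta>) \<in> S \<Longrightarrow> \<alpha> \<in> P_fin \<and> \<beta> \<in> P_fin"
    "f False = f True \<or> (\<forall>\<alpha> \<beta>. f False \<alpha> \<noteq> f True \<beta>)"
    by (rule pair_embedding[OF Xm anA' B'X insep'[folded A'_def B'_def] secA' anS cS symS], rule that) assumption+
  have pat: "pattern R (f False \<alpha>, f True \<alpha>) \<epsilon> \<eta> \<longleftrightarrow> (f \<epsilon> \<alpha>, f \<eta> \<alpha>) \<in> R" for \<alpha> \<epsilon> \<eta>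
    by (cases \<epsilon>; cases \<eta>) (simp_all add: pattern_def coord_def)
  show thesis
  proof (rule that[of f \<tau> \<tau>'])
    show "(f \<epsilon> \<alpha>, f \<eta> \<alpha>) \<in> R \<longleftrightarrow> (if \<alpha> \<in> P_inf then \<tau> \<epsilon> \<eta> else \<tau>' \<epsilon> \<eta>)" for \<alpha> \<epsilon> \<eta>
      using f(3,4)[of \<alpha>] pat[of \<alpha> \<epsilon> \<eta>] by (auto simp: A'_def B'_def P_fin_def)
    show "(f False \<alpha>, f True \<alpha>) \<in> R \<longleftrightarrow> \<alpha> \<in> C" for \<alpha>
      using f(3,4)[of \<alpha>] sub good by (cases \<Gamma>) (auto simp: A_def B_def P_fin_def)
    show "\<alpha> \<in> P_fin \<and> \<beta> \<in> P_fin" if "\<alpha> \<noteq> \<beta>" "(f \<epsilon> \<alpha>, f \<eta> \<beta>) \<in> R" for \<alpha> \<beta> \<epsilon> \<eta>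
      by (rule f(5)[OF that(1), of \<epsilon> \<eta>]) (use that(2) in \<open>simp add: S_def\<close>)
  qed (rule f(1) f(2) f(6))+
qed

lemma single_reduction:
  fixes h :: "cantor \<Rightarrow> 'a"
  assumes "continuous_map euclidean X h" "inj h" "\<And>\<alpha>. (h \<alpha>, h \<alpha>) \<in> R \<longleftrightarrow> \<alpha> \<in> C"
    "\<And>\<alpha> \<beta>. \<alpha> \<noteq> \<beta> \<Longrightarrow> (h \<alpha>, h \<beta>) \<in> R \<Longrightarrow> \<alpha> \<in> P_fin \<and> \<beta> \<in> P_fin"
  shows "\<exists>Q. diagonally_complex C Q \<and> reducible_c euclidean Q X R"
proof (intro exI conjI)
  let ?Q = "{(\<alpha>, \<beta>). (h \<alpha>, h \<beta>) \<in> R}"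
  show "diagonally_complex C ?Q"
    unfolding diagonally_complex_def
  proof (intro conjI subsetI)
    show "?Q \<inter> Id_on UNIV = Id_on C" using assms(3) by auto
    fix p assume p: "p \<in> ?Q"
    show "p \<in> Id_on C \<union> P_fin \<times> P_fin"
    proof (cases "fst p = snd p")
      case True
      then show ?thesis using p assms(3) by (auto simp: prod_eq_iff)
    next
      case False
      then show ?thesis using p assms(4) by auto
    qed
  qed
  show "reducible_c euclidean ?Q X R"
    unfolding reducible_c_def using assms(1,2) by (intro exI[of _ h]) auto
qed

lemma continuous_map_bool_times:
  fixes f :: "bool \<Rightarrow> 'b :: topological_space \<Rightarrow> 'a"
  assumes "\<And>\<epsilon>. continuous_map euclidean X (f \<epsilon>)"
  shows "continuous_map euclidean X (\<lambda>p. f (fst p) (snd p))"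
  unfolding continuous_map_def
proof (intro conjI allI impI)
  have "f \<epsilon> \<alpha> \<in> topspace X" for \<epsilon> \<alpha>
    using continuous_map_image_subset_topspace[OF assms[of \<epsilon>]] by auto
  then show "(\<lambda>p. f (fst p) (snd p)) \<in> topspace euclidean \<rightarrow> topspace X" by auto
  fix U assume U: "openin X U"
  have "open {\<alpha>. f \<epsilon> \<alpha> \<in> U}" for \<epsilon>
    using openin_continuous_map_preimage[OF assms[of \<epsilon>] U] by simp
  then have "open ({\<epsilon>} \<times> {\<alpha>. f \<epsilon> \<alpha> \<in> U})" for \<epsilon>
    by (rule open_Times[OF open_discrete])
  then have "open (\<Union>\<epsilon>. {\<epsilon>} \<times> {\<alpha>. f \<epsilon> \<alpha> \<in> U})" by (rule open_UN[rule_format])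
  moreover have "(\<Union>\<epsilon>. {\<epsilon>} \<times> {\<alpha>. f \<epsilon> \<alpha> \<in> U}) = {p. f (fst p) (snd p) \<in> U}"
  proof (rule set_eqI)
    show "p \<in> (\<Union>\<epsilon>. {\<epsilon>} \<times> {\<alpha>. f \<epsilon> \<alpha> \<in> U}) \<longleftrightarrow> p \<in> {p. f (fst p) (snd p) \<in> U}" for p
      by (cases p) simp
  qed
  ultimately show "openin euclidean {p \<in> topspace euclidean. f (fst p) (snd p) \<in> U}" by simp
qed

lemma good_cases: "good \<Gamma> C \<Longrightarrow> C = P_inf \<or> C = - P_inf"
  by (cases \<Gamma>) (simp_all add: P_fin_def)

theorem theorem2p15:
  fixes \<Gamma> :: rank_two_class
    and C :: "cantor set"
    and X :: "'a topology"
    and R :: "('a \<times> 'a) set"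
  assumes "good \<Gamma> C"
    and "analytic_space X"
    and "R \<subseteq> topspace X \<times> topspace X"
    and "locally_countable X R"
    and "borel_set_in (prod_topology X X) R"
    and "sections_in_class \<Gamma> X R"
  shows "in_class \<Gamma> (prod_topology X X) R \<longleftrightarrow>
    \<not> ((\<exists>Q :: (cantor \<times> cantor) set.
           diagonally_complex C Q \<and> reducible_c (euclidean :: cantor topology) Q X R)
       \<or>
       (\<exists>Q :: ((bool \<times> cantor) \<times> (bool \<times> cantor)) set.
           reducible_c (euclidean :: (bool \<times> cantor) topology) Q X R \<and>
           (\<exists>E :: bool \<Rightarrow> bool \<Rightarrow> cantor set.
              (\<forall>\<epsilon> \<eta>. component Q \<epsilon> \<eta> \<inter> Id_on UNIV = Id_on (E \<epsilon> \<eta>)) \<and>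
              E False True = C \<and>
              E True False \<in> {S_set C j | j. j \<le> 3} \<and>
              (\<forall>\<epsilon>. E \<epsilon> \<epsilon> \<in> {S_set C j | j. 1 \<le> j \<and> j \<le> 3}) \<and>
              (\<forall>\<epsilon> \<eta>. component Q \<epsilon> \<eta> \<subseteq> Id_on (E \<epsilon> \<eta>) \<union> P_fin \<times> P_fin))))"
    (is "_ \<longleftrightarrow> \<not> (?one \<or> ?two)")
proof
  assume in_class: "in_class \<Gamma> (prod_topology X X) R"
  show "\<not> (?one \<or> ?two)"
  proof
    assume "?one \<or> ?two"
    then show False
    proof
      assume ?one
      then obtain Q h where Q: "diagonally_complex C Q" and h: "continuous_map euclidean X h"
        "Q = {(x, y) \<in> topspace euclidean \<times> topspace euclidean. (h x, h y) \<in> R}"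
        unfolding reducible_c_def by (elim exE conjE)
      have "Q \<inter> Id_on UNIV = Id_on C" using Q by (simp add: diagonally_complex_def)
      then have "(h \<alpha>, h \<alpha>) \<in> R \<longleftrightarrow> \<alpha> \<in> C" for \<alpha> using h(2) by (auto simp: set_eq_iff)
      from reducible_not_in_class[OF assms(1) h(1) h(1) this] show False using in_class by simp
    next
      assume ?two
      then obtain Q E h where h: "continuous_map (euclidean :: (bool \<times> cantor) topology) X h"
        "Q = {(x, y) \<in> topspace euclidean \<times> topspace euclidean. (h x, h y) \<in> R}"
        and E: "\<forall>\<epsilon> \<eta>. component Q \<epsilon> \<eta> \<inter> Id_on UNIV = Id_on (E \<epsilon> \<eta>)" "E False True = C"
        unfolding reducible_c_def by (elim exE conjE)
      have c: "continuous_map euclidean X (\<lambda>\<alpha>. h (\<epsilon>, \<alpha>))" for \<epsilon>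
      proof -
        have "continuous_map euclidean euclidean (\<lambda>\<alpha> :: cantor. (\<epsilon>, \<alpha>))"
          by (simp add: continuous_on_Pair)
        from continuous_map_compose[OF this h(1)] show ?thesis by (simp add: o_def)
      qed
      have "component Q False True \<inter> Id_on UNIV = Id_on C" using E by simp
      then have "(h (False, \<alpha>), h (True, \<alpha>)) \<in> R \<longleftrightarrow> \<alpha> \<in> C" for \<alpha>
        using h(2) by (auto simp: set_eq_iff component_def)
      from reducible_not_in_class[OF assms(1) c c this] show False using in_class by simp
    qed
  qed
next
  assume not: "\<not> (?one \<or> ?two)"
  show "in_class \<Gamma> (prod_topology X X) R"
  proof (rule ccontr)
    assume not_in_class: "\<not> in_class \<Gamma> (prod_topology X X) R"
    obtain f \<tau> \<tau>' where f: "\<And>\<epsilon>. continuous_map euclidean X (f \<epsilon>)" "\<And>\<epsilon>. inj (f \<epsilon>)"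
      and pat: "\<And>\<alpha> \<epsilon> \<eta>. (f \<epsilon> \<alpha>, f \<eta> \<alpha>) \<in> R \<longleftrightarrow> (if \<alpha> \<in> P_inf then \<tau> \<epsilon> \<eta> else \<tau>' \<epsilon> \<eta>)"
      and C: "\<And>\<alpha>. (f False \<alpha>, f True \<alpha>) \<in> R \<longleftrightarrow> \<alpha> \<in> C"
      and off: "\<And>\<alpha> \<beta> \<epsilon> \<eta>. \<alpha> \<noteq> \<beta> \<Longrightarrow> (f \<epsilon> \<alpha>, f \<eta> \<beta>) \<in> R \<Longrightarrow> \<alpha> \<in> P_fin \<and> \<beta> \<in> P_fin"
      and alt: "f False = f True \<or> (\<forall>\<alpha> \<beta>. f False \<alpha> \<noteq> f True \<beta>)"
      by (rule not_in_class_embedding[OF assms not_in_class], rule that) assumption+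
    define E where "E \<epsilon> \<eta> = {\<alpha>. (f \<epsilon> \<alpha>, f \<eta> \<alpha>) \<in> R}" for \<epsilon> \<eta>
    have E_cases: "E \<epsilon> \<eta> \<in> {C, {}, - C, UNIV}" for \<epsilon> \<eta>
    proof -
      have "E \<epsilon> \<eta> = {\<alpha>. if \<alpha> \<in> P_inf then \<tau> \<epsilon> \<eta> else \<tau>' \<epsilon> \<eta>}" unfolding E_def pat ..
      then have "E \<epsilon> \<eta> \<in> {P_inf, {}, - P_inf, UNIV}"
        by (cases "\<tau> \<epsilon> \<eta>"; cases "\<tau>' \<epsilon> \<eta>") auto
      then show ?thesis using good_cases[OF assms(1)] by auto
    qed
    \<comment> \<open>Otherwise the coordinate \<open>\<epsilon>\<close> alone is a reduction of the first kind.\<close>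
    have none: "E \<epsilon> \<epsilon> \<noteq> C" for \<epsilon>
    proof
      assume "E \<epsilon> \<epsilon> = C"
      then have "(f \<epsilon> \<alpha>, f \<epsilon> \<alpha>) \<in> R \<longleftrightarrow> \<alpha> \<in> C" for \<alpha> by (auto simp: E_def)
      then have ?one by (rule single_reduction[OF f(1,2)]) (rule off)
      then show False using not by blast
    qed
    have disj: "f False \<alpha> \<noteq> f True \<beta>" for \<alpha> \<beta>
    proof -
      have "E False True = C" using C by (auto simp: E_def)
      then have "f False \<noteq> f True" using none[of False] by (auto simp: E_def)
      then show ?thesis using alt by blast
    qed
    let ?h = "\<lambda>p :: bool \<times> cantor. f (fst p) (snd p)"
    define Q where "Q = {(p, q). (?h p, ?h q) \<in> R}"
    have comp: "component Q \<epsilon> \<eta> = {(\<alpha>, \<beta>). (f \<epsilon> \<alpha>, f \<eta> \<beta>) \<in> R}" for \<epsilon> \<eta>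
      by (simp add: component_def Q_def)
    have "inj ?h"
    proof (rule injI)
      fix p q assume eq: "?h p = ?h q"
      then have "fst p = fst q" using disj by (cases "fst p"; cases "fst q") (auto, metis)
      then show "p = q" using eq injD[OF f(2)] by (auto simp: prod_eq_iff)
    qed
    then have red: "reducible_c euclidean Q X R"
      unfolding reducible_c_def Q_def using continuous_map_bool_times[OF f(1)] by (intro exI[of _ ?h]) auto
    have diag: "component Q \<epsilon> \<eta> \<inter> Id_on UNIV = Id_on (E \<epsilon> \<eta>)" for \<epsilon> \<eta>
      by (auto simp: comp E_def)
    have EC: "E False True = C" using C by (auto simp: E_def)
    have S: "S_set C 0 = C" "S_set C 1 = {}" "S_set C 2 = - C" "S_set C 3 = UNIV"
      by (simp_all add: S_set_def numeral_2_eq_2 numeral_3_eq_3)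
    have E10: "E True False \<in> {S_set C j | j. j \<le> 3}"
    proof -
      consider "E True False = S_set C 0" | "E True False = S_set C 1" | "E True False = S_set C 2"
        | "E True False = S_set C 3" using E_cases[of True False] S by auto
      then show ?thesis by cases (auto intro: exI[of _ 0] exI[of _ 1] exI[of _ 2] exI[of _ 3])
    qed
    have Ediag: "E \<epsilon> \<epsilon> \<in> {S_set C j | j. 1 \<le> j \<and> j \<le> 3}" for \<epsilon>
    proof -
      consider "E \<epsilon> \<epsilon> = S_set C 1" | "E \<epsilon> \<epsilon> = S_set C 2" | "E \<epsilon> \<epsilon> = S_set C 3"
        using E_cases[of \<epsilon> \<epsilon>] none[of \<epsilon>] S by auto
      then show ?thesis by cases (auto intro: exI[of _ 1] exI[of _ 2] exI[of _ 3])
    qed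
    have off_diag: "component Q \<epsilon> \<eta> \<subseteq> Id_on (E \<epsilon> \<eta>) \<union> P_fin \<times> P_fin" for \<epsilon> \<eta>
    proof
      fix p assume "p \<in> component Q \<epsilon> \<eta>"
      then obtain \<alpha> \<beta> where p: "p = (\<alpha>, \<beta>)" "(f \<epsilon> \<alpha>, f \<eta> \<beta>) \<in> R" by (auto simp: comp)
      show "p \<in> Id_on (E \<epsilon> \<eta>) \<union> P_fin \<times> P_fin"
      proof (cases "\<alpha> = \<beta>")
        case True
        then show ?thesis using p by (auto simp: E_def)
      next
        case False
        then show ?thesis using p off[of \<alpha> \<beta> \<epsilon> \<eta>] by simp
      qed
    qed
    have ?two
      by (intro exI[of _ Q] exI[of _ E] conjI allI red diag EC E10 Ediag off_diag)
    then show False using not by blast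
  qed
qed

end
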